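(* Let $D=(0,1)$, $\alpha\in(3/2,2)$, $\mu\ge\alpha$, $V=H^1_0(D)$, $f,q\in H^1(D)$, $c_0=\Gamma(\mu+1)/\Gamma(1+\mu-\alpha)$, $p(x)=c_0x^{\mu-\alpha}-q(x)x^\mu$, and assume $p\in H^1(D)$. Let $A(\psi,\varphi)=(\psi',\varphi')+({}_0^RD_x^{2-\alpha}\psi,q\varphi)+({}_0^RD_x^{2-\alpha}\psi)(1)(p,\varphi)$ satisfy: $A(w,v)=0\ \forall v\in V\Rightarrow w=0$, and $A(w,v)=0\ \forall w\in V\Rightarrow v=0$. Let $w\in V$ solve $A(w,\varphi)=(f,\varphi)$ for all $\varphi\in V$ and let $u={}_0^RD_x^{2-\alpha}w-({}_0^RD_x^{2-\alpha}w)(1)x^\mu$ be the corresponding solution of $-{}_0^RD_x^\alpha u+qu=f$ in $D$, $u(0)=u(1)=0$. For $k\in\{0,1\}$ let $w_h\in V_h$ solve $A(w_h,v_h)=(f,v_h)$ for all $v_h\in V_h$, and set $u_h={}_0^RD_x^{2-\alpha}w_h-({}_0^RD_x^{2-\alpha}w_h)(1)x^\mu$. Then there is $h_0>0$ such that for all $h\le h_0$ and every $\beta\in(2-\alpha,1/2)$, $$\|u-u_h\|_{L^2(D)}\le ch^{\alpha+k-1+\beta}\|f\|_{H^1(D)},$$ with $c$ independent of $h$ and $f$.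
   Context: $(\cdot,\cdot)$ is the $L^2(D)$ inner product. $({}_0I_x^\gamma g)(x)=\frac{1}{\Gamma(\gamma)}\int_0^x(x-t)^{\gamma-1}g(t)dt$; ${}_0^RD_x^\alpha u=\frac{d^2}{dx^2}({}_0I_x^{2-\alpha}u)$. For $w\in H^1_0(D)$, ${}_0^RD_x^{2-\alpha}w={}_0I_x^{\alpha-1}(w')$, i.e. ${}_0^RD_x^{2-\alpha}w(x)=\frac{1}{\Gamma(\alpha-1)}\int_0^x(x-t)^{\alpha-2}w'(t)dt$, and $({}_0^RD_x^{2-\alpha}w)(1)=\frac{1}{\Gamma(\alpha-1)}\int_0^1(1-t)^{\alpha-2}w'(t)dt$. $V_h$: for a quasi-uniform partition of $D$ with maximal subinterval length $h$, the space of continuous piecewise polynomials of degree at most $k+1$ vanishing at $0$ and $1$. *)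

theory Defs
  imports "HOL-Analysis.Analysis" "HOL-Computational_Algebra.Polynomial"
begin

abbreviation D :: "real set" where "D \<equiv> {0<..<1}"

definition l2_inner :: "(real \<Rightarrow> real) \<Rightarrow> (real \<Rightarrow> real) \<Rightarrow> real" where
  "l2_inner f g = (LINT x:D|lborel. f x * g x)"

definition L2D :: "(real \<Rightarrow> real) \<Rightarrow> bool" where
  "L2D f \<longleftrightarrow> set_borel_measurable lborel D f \<and> set_integrable lborel D (\<lambda>x. (f x)^2)"

definition test_fun :: "(real \<Rightarrow> real) \<Rightarrow> bool" where
  "test_fun \<phi> \<longleftrightarrow> (\<forall>n x. ((deriv ^^ n) \<phi>) differentiable (at x)) \<and>
     (\<exists>a b. 0 < a \<and> a \<le> b \<and> b < 1 \<and> (\<forall>x. x \<notin> {a..b} \<longrightarrow> \<phi> x = 0))"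

definition is_weak_deriv :: "(real \<Rightarrow> real) \<Rightarrow> (real \<Rightarrow> real) \<Rightarrow> bool" where
  "is_weak_deriv f g \<longleftrightarrow> (\<forall>\<phi>. test_fun \<phi> \<longrightarrow>
      (LINT x:D|lborel. f x * deriv \<phi> x) = - (LINT x:D|lborel. g x * \<phi> x))"

definition H1D :: "(real \<Rightarrow> real) \<Rightarrow> bool" where
  "H1D f \<longleftrightarrow> L2D f \<and> (\<exists>g. L2D g \<and> is_weak_deriv f g)"

text \<open>A chosen representative of the weak derivative (unique a.e. on D).\<close>
definition wderiv :: "(real \<Rightarrow> real) \<Rightarrow> real \<Rightarrow> real" where
  "wderiv f = (SOME g. L2D g \<and> is_weak_deriv f g)"

definition L2_norm :: "(real \<Rightarrow> real) \<Rightarrow> real" where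
  "L2_norm f = sqrt (LINT x:D|lborel. (f x)^2)"

definition H1_norm :: "(real \<Rightarrow> real) \<Rightarrow> real" where
  "H1_norm f = sqrt ((LINT x:D|lborel. (f x)^2) + (LINT x:D|lborel. (wderiv f x)^2))"

definition H01D :: "(real \<Rightarrow> real) \<Rightarrow> bool" where
  "H01D f \<longleftrightarrow> H1D f \<and> (\<exists>\<phi>s. (\<forall>n. test_fun (\<phi>s n)) \<and>
      (\<lambda>n. H1_norm (\<lambda>x. \<phi>s n x - f x)) \<longlonglongrightarrow> 0)"

definition frac_int :: "real \<Rightarrow> (real \<Rightarrow> real) \<Rightarrow> real \<Rightarrow> real" where
  "frac_int \<gamma> g x = (1 / Gamma \<gamma>) * (LINT t:{0<..<x}|lborel. (x - t) powr (\<gamma> - 1) * g t)"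

text \<open>For w in H^1_0(D): RL derivative of order 2-alpha, = I^(alpha-1)(w').\<close>
definition rl_D :: "real \<Rightarrow> (real \<Rightarrow> real) \<Rightarrow> real \<Rightarrow> real" where
  "rl_D \<alpha> w = frac_int (\<alpha> - 1) (wderiv w)"

definition bilA :: "real \<Rightarrow> (real \<Rightarrow> real) \<Rightarrow> (real \<Rightarrow> real)
    \<Rightarrow> (real \<Rightarrow> real) \<Rightarrow> (real \<Rightarrow> real) \<Rightarrow> real" where
  "bilA \<alpha> q p \<psi> \<phi> = l2_inner (wderiv \<psi>) (wderiv \<phi>)
      + l2_inner (rl_D \<alpha> \<psi>) (\<lambda>x. q x * \<phi> x)
      + rl_D \<alpha> \<psi> 1 * l2_inner p \<phi>"

definition recover :: "real \<Rightarrow> real \<Rightarrow> (real \<Rightarrow> real) \<Rightarrow> real \<Rightarrow> real" where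
  "recover \<alpha> \<mu> w x = rl_D \<alpha> w x - rl_D \<alpha> w 1 * x powr \<mu>"

definition partition01 :: "real list \<Rightarrow> bool" where
  "partition01 xs \<longleftrightarrow> length xs \<ge> 2 \<and> xs ! 0 = 0 \<and> last xs = 1 \<and> sorted_wrt (<) xs"

definition mesh :: "real list \<Rightarrow> real" where
  "mesh xs = Max ((\<lambda>i. xs ! Suc i - xs ! i) ` {..<length xs - 1})"

definition quasi_uniform :: "real \<Rightarrow> real list \<Rightarrow> bool" where
  "quasi_uniform \<sigma> xs \<longleftrightarrow> (\<forall>i < length xs - 1. xs ! Suc i - xs ! i \<ge> \<sigma> * mesh xs)"

definition Vh :: "nat \<Rightarrow> real list \<Rightarrow> (real \<Rightarrow> real) set" where
  "Vh k xs = {v. continuous_on {0..1} v \<and> v 0 = 0 \<and> v 1 = 0 \<and>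
     (\<forall>i < length xs - 1. \<exists>P :: real poly. degree P \<le> k + 1 \<and>
        (\<forall>x \<in> {xs ! i .. xs ! Suc i}. v x = poly P x))}"

end

theory Submission
  imports Defs "HOL-Complex_Analysis.Great_Picard" "HOL-Real_Asymp.Real_Asymp"
begin

text \<open>
  Since \<open>\<alpha> > 3/2\<close>, the kernel of \<open>I\<^sup>\<alpha>\<^sup>-\<^sup>1\<close> is square integrable. Hence \<open>Z g = I\<^sup>\<alpha>\<^sup>-\<^sup>1 g\<close> maps \<open>L\<^sup>2\<close> to
  continuous functions, and the variational problem becomes a second kind equation \<open>g + J (Z g) = F\<close>
  for \<open>g = w'\<close>, where \<open>J\<close> maps bounded functions to Lipschitz functions. By Arzela-Ascoli, injectivity gives the
  sup-norm stability bound \<open>\<bar>Z e\<bar> \<le> C sup \<bar>Z (e + J (Z e))\<bar>\<close>. For the Galerkin error \<open>e = w' - w\<^sub>h'\<close> the residual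
  \<open>r = e + J (Z e)\<close> is orthogonal to the piecewise polynomials, and the kernel is approximated by piecewise
  constants to order \<open>\<alpha> - 3/2\<close> in \<open>L\<^sup>2\<close>, so \<open>\<bar>Z r\<bar>\<close> is at most \<open>C h\<^sup>\<alpha>\<^sup>-\<^sup>3\<^sup>/\<^sup>2\<close> times the norm of \<open>r\<close>. This takes the place
  of a duality argument, and no adjoint problem has to be solved. The norm of \<open>r\<close> is of order
  \<open>h\<^sup>k\<^sup>+\<^sup>1\<close> by the regularity of \<open>w\<close>, and \<open>u - u\<^sub>h\<close> is bounded by \<open>2 sup \<bar>Z e\<bar>\<close>. The resulting exponent \<open>\<alpha> + k - 1/2\<close>
  exceeds \<open>\<alpha> + k - 1 + \<beta>\<close>.
\<close>

section \<open>Smooth functions and test functions\<close>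

text \<open>The obstacle at the level of definitions is that \<open>wderiv\<close> picks an
  arbitrary representative and \<open>H01D\<close> is a closure of test functions. So every function
  of the space is handled through its derivative \<open>g\<close>, of mean zero, and recovered as
  \<open>prim g\<close>. Membership in \<open>H01D\<close> then reduces to approximating
  \<open>g\<close> in L2 by test functions; this is needed only for continuous \<open>g\<close> (the
  limit in the compactness argument) and for piecewise polynomials (the discrete functions). The
  data \<open>q\<close>, \<open>p\<close>, \<open>f\<close> are replaced by continuous
  representatives, which have pointwise bounds. For \<open>k = 1\<close> the order h^2 requires a
  third derivative of w in L2. Here w'' is \<open>low (Z g)\<close> minus f, and the derivative of
  \<open>Z g\<close> has the singularity x^(\<alpha>-2) at 0, which is square integrable exactly for
  \<alpha> > 3/2. The residual contains \<open>J (Z e)\<close>, hence the unknown error. Its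
  distance to the piecewise constants carries an extra factor h, so this part is absorbed on fine
  meshes; that is why a threshold \<open>h0\<close> appears.\<close>

fun ndiff :: "nat \<Rightarrow> (real \<Rightarrow> real) \<Rightarrow> bool" where
  "ndiff 0 f = True"
| "ndiff (Suc n) f = (\<exists>f'. (\<forall>x. (f has_real_derivative f' x) (at x)) \<and> ndiff n f')"

text \<open>Derivatives are counted through existential witnesses, so that closure under sums,
  products and affine substitution is a plain induction without computing \<open>deriv\<close>.
  \<open>smooth_iff\<close> returns to the iterated form in \<open>test_fun\<close>.\<close>

definition smooth :: "(real \<Rightarrow> real) \<Rightarrow> bool" where
  "smooth f \<longleftrightarrow> (\<forall>n. ndiff n f)"

lemma ndiff_Suc_D: "ndiff (Suc n) f \<Longrightarrow> ndiff n f"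
  by (induction n arbitrary: f) auto

lemma ndiff_const: "ndiff n (\<lambda>_. c)"
  by (induction n arbitrary: c) (auto intro!: exI[of _ "\<lambda>_. 0"])

lemma ndiff_add: "ndiff n f \<Longrightarrow> ndiff n g \<Longrightarrow> ndiff n (\<lambda>x. f x + g x)"
proof (induction n arbitrary: f g)
  case (Suc n)
  then obtain f' g' where "\<And>x. (f has_real_derivative f' x) (at x)" "ndiff n f'"
    "\<And>x. (g has_real_derivative g' x) (at x)" "ndiff n g'" by auto
  with Suc.IH show ?case
    by (auto intro!: exI[of _ "\<lambda>x. f' x + g' x"] derivative_intros)
qed simp

lemma ndiff_mult: "ndiff n f \<Longrightarrow> ndiff n g \<Longrightarrow> ndiff n (\<lambda>x. f x * g x)"
proof (induction n arbitrary: f g)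
  case (Suc n)
  then obtain f' g' where d: "\<And>x. (f has_real_derivative f' x) (at x)" "ndiff n f'"
    "\<And>x. (g has_real_derivative g' x) (at x)" "ndiff n g'" by auto
  have "ndiff n (\<lambda>x. f' x * g x + g' x * f x)"
    using Suc.IH d ndiff_Suc_D[OF Suc.prems(1)] ndiff_Suc_D[OF Suc.prems(2)] by (intro ndiff_add) auto
  moreover have "((\<lambda>x. f x * g x) has_real_derivative f' x * g x + g' x * f x) (at x)" for x
    using d by (auto intro!: derivative_eq_intros)
  ultimately show ?case by (auto intro!: exI[of _ "\<lambda>x. f' x * g x + g' x * f x"])
qed simp

lemma ndiff_affine: "ndiff n f \<Longrightarrow> ndiff n (\<lambda>x. f (a * x + b))"
proof (induction n arbitrary: f)
  case (Suc n)
  then obtain f' where d: "\<And>x. (f has_real_derivative f' x) (at x)" "ndiff n f'" by auto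
  have "((\<lambda>x. f (a * x + b)) has_real_derivative f' (a * x + b) * a) (at x)" for x
    by (rule DERIV_chain2[OF d(1)]) (auto intro!: derivative_eq_intros)
  moreover have "ndiff n (\<lambda>x. f' (a * x + b) * a)"
    using Suc.IH[OF d(2)] ndiff_const by (intro ndiff_mult)
  ultimately show ?case by (auto intro!: exI[of _ "\<lambda>x. f' (a * x + b) * a"])
qed simp

lemma ndiff_poly: "ndiff n (\<lambda>x. poly P x)"
  by (induction n arbitrary: P) (auto intro!: exI[of _ "\<lambda>x. poly (pderiv P) x" for P] poly_DERIV)

lemma smooth_const: "smooth (\<lambda>_. c)"
  and smooth_add: "smooth f \<Longrightarrow> smooth g \<Longrightarrow> smooth (\<lambda>x. f x + g x)"
  and smooth_mult: "smooth f \<Longrightarrow> smooth g \<Longrightarrow> smooth (\<lambda>x. f x * g x)"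
  and smooth_affine: "smooth f \<Longrightarrow> smooth (\<lambda>x. f (a * x + b))"
  and smooth_poly: "smooth (\<lambda>x. poly P x)"
  by (auto simp: smooth_def ndiff_const ndiff_add ndiff_mult ndiff_affine ndiff_poly)

lemma smooth_antideriv:
  assumes "\<And>x. (f has_real_derivative f' x) (at x)" "smooth f'"
  shows "smooth f"
proof -
  have "ndiff n f" for n
    using assms by (cases n) (auto simp: smooth_def)
  then show ?thesis by (simp add: smooth_def)
qed

lemma smooth_deriv:
  assumes "smooth f"
  shows "(f has_real_derivative deriv f x) (at x)" "smooth (deriv f)"
proof -
  have "ndiff (Suc 0) f" using assms unfolding smooth_def by blast
  then show *: "(f has_real_derivative deriv f x) (at x)" for x
    using DERIV_deriv_iff_real_differentiable real_differentiable_def by auto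
  have "ndiff n (deriv f)" for n
  proof -
    have "ndiff (Suc n) f" using assms unfolding smooth_def by blast
    then obtain f' where f': "\<And>x. (f has_real_derivative f' x) (at x)" "ndiff n f'" by auto
    then have "f' = deriv f" by (intro ext sym[OF DERIV_imp_deriv])
    with f' show ?thesis by simp
  qed
  then show "smooth (deriv f)" by (simp add: smooth_def)
qed

lemma smooth_iff: "smooth f \<longleftrightarrow> (\<forall>n x. ((deriv ^^ n) f) differentiable (at x))"
proof
  assume f: "smooth f"
  have "smooth ((deriv ^^ n) f)" for n
    by (induction n) (auto simp: f smooth_deriv)
  then show "\<forall>n x. ((deriv ^^ n) f) differentiable (at x)"
    using smooth_deriv(1) real_differentiable_def by blast
next
  assume *: "\<forall>n x. ((deriv ^^ n) f) differentiable (at x)"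
  have "ndiff m ((deriv ^^ n) f)" for m n
  proof (induction m arbitrary: n)
    case (Suc m)
    have "((deriv ^^ n) f has_real_derivative (deriv ^^ Suc n) f x) (at x)" for x
      using * by (simp add: DERIV_deriv_iff_real_differentiable)
    with Suc[of "Suc n"] show ?case by (auto intro!: exI[of _ "(deriv ^^ Suc n) f"])
  qed simp
  from this[of _ 0] show "smooth f" by (simp add: smooth_def)
qed

lemma smooth_continuous_on: "smooth f \<Longrightarrow> continuous_on A f"
  by (meson DERIV_isCont continuous_at_imp_continuous_on smooth_deriv(1))

lemma test_fun_iff:
  "test_fun \<phi> \<longleftrightarrow> smooth \<phi> \<and> (\<exists>a b. 0 < a \<and> a \<le> b \<and> b < 1 \<and> (\<forall>x. x \<notin> {a..b} \<longrightarrow> \<phi> x = 0))"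
  by (simp add: test_fun_def smooth_iff)

lemma test_fun_mult_smooth:
  assumes "test_fun \<phi>" "smooth f"
  shows "test_fun (\<lambda>x. \<phi> x * f x)"
  using assms unfolding test_fun_iff by (metis smooth_mult mult_zero_left)

lemma test_fun_add:
  assumes "test_fun \<phi>" "test_fun \<psi>"
  shows "test_fun (\<lambda>x. \<phi> x + \<psi> x)"
proof -
  obtain a b c d where *: "0 < a" "a \<le> b" "b < 1" "\<And>x. x \<notin> {a..b} \<Longrightarrow> \<phi> x = 0"
    "0 < c" "c \<le> d" "d < 1" "\<And>x. x \<notin> {c..d} \<Longrightarrow> \<psi> x = 0"
    using assms unfolding test_fun_iff by metis
  have "\<phi> x + \<psi> x = 0" if "x \<notin> {min a c..max b d}" for x
    using *(4)[of x] *(8)[of x] that by (auto simp: min_def max_def split: if_splits)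
  moreover have "0 < min a c" "min a c \<le> max b d" "max b d < 1" using * by auto
  ultimately have "\<exists>a b. 0 < a \<and> a \<le> b \<and> b < 1 \<and> (\<forall>x. x \<notin> {a..b} \<longrightarrow> \<phi> x + \<psi> x = 0)"
    by blast
  with assms show ?thesis by (simp add: test_fun_iff smooth_add)
qed

lemma test_fun_cmult: "test_fun \<phi> \<Longrightarrow> test_fun (\<lambda>x. c * \<phi> x)"
  using test_fun_mult_smooth[of \<phi> "\<lambda>_. c"] smooth_const by (simp add: mult.commute)

lemma test_fun_diff:
  assumes "test_fun \<phi>" "test_fun \<psi>"
  shows "test_fun (\<lambda>x. \<phi> x - \<psi> x)"
  using test_fun_add[OF assms(1) test_fun_cmult[OF assms(2), of "-1"]] by simp

lemma test_fun_zero: "test_fun (\<lambda>_. 0)"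
  by (auto simp: test_fun_iff smooth_const intro!: exI[of _ "1/2"])

section \<open>Smooth cut-off functions of intervals\<close>

definition flat :: "real poly \<Rightarrow> real \<Rightarrow> real" where
  "flat P x = (if x > 0 then poly P (1 / x) * exp (- (1 / x)) else 0)"

lemma poly_exp_minus_tendsto: "((\<lambda>x. poly P x * exp (- x)) \<longlongrightarrow> (0::real)) at_top"
proof (induction P)
  case (pCons a P)
  have "((\<lambda>x. \<Sum>i\<le>degree (pCons a P). coeff (pCons a P) i * (x ^ i / exp x)) \<longlongrightarrow> (\<Sum>i\<le>degree (pCons a P). coeff (pCons a P) i * 0)) at_top"
    by (intro tendsto_sum tendsto_mult tendsto_const tendsto_power_div_exp_0)
  then show ?case
    by (simp only: poly_altdef exp_minus sum_distrib_right mult_zero_right sum.neutral_const divide_inverse mult.assoc)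
qed simp

lemma flat_tendsto: "(flat P \<longlongrightarrow> 0) (at 0)"
proof -
  have "((\<lambda>x. poly P (inverse x) * exp (- inverse x)) \<longlongrightarrow> 0) (at_right (0::real))"
    by (rule filterlim_compose[OF poly_exp_minus_tendsto filterlim_inverse_at_top_right])
  then have "(flat P \<longlongrightarrow> 0) (at_right 0)"
    by (rule Lim_transform_eventually)
       (auto simp: flat_def divide_inverse eventually_at_filter)
  moreover have "(flat P \<longlongrightarrow> 0) (at_left 0)"
    by (rule Lim_transform_eventually[OF tendsto_const])
       (auto simp: flat_def eventually_at_filter)
  ultimately show ?thesis by (simp add: filterlim_split_at_real)
qed

text \<open>The factor \<open>P (1/x)\<close> is carried along because this makes the family closed
  under differentiation: the derivative has (1/x)^2 (P - P')(1/x) in front of the exponential, and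
  multiplication by (1/x)^2 is the double \<open>pCons 0\<close>.\<close>

lemma flat_deriv:
  "(flat P has_real_derivative flat (pCons 0 (pCons 0 (P - pderiv P))) x) (at x)"
proof -
  consider "x > 0" | "x < 0" | "x = 0" by linarith
  then show ?thesis
  proof cases
    case 1
    have "((\<lambda>x. poly P (1 / x) * exp (- (1 / x))) has_real_derivative
        poly (pderiv P) (1/x) * (-(1/x^2)) * exp (- (1 / x)) + exp (- (1/x)) * (1/x^2) * poly P (1/x)) (at x)"
      using 1 by (auto intro!: derivative_eq_intros DERIV_chain2[OF poly_DERIV] simp: power2_eq_square)
    moreover have "poly (pderiv P) (1/x) * (-(1/x^2)) * exp (- (1 / x)) + exp (- (1/x)) * (1/x^2) * poly P (1/x)
      = flat (pCons 0 (pCons 0 (P - pderiv P))) x"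
      using 1 by (simp add: flat_def field_simps power2_eq_square)
    moreover have "eventually (\<lambda>y. y > 0) (nhds x)" using 1 eventually_nhds_in_open[of "{0<..}" x] by simp
    then have "eventually (\<lambda>y. flat P y = poly P (1 / y) * exp (- (1 / y))) (nhds x)"
      by eventually_elim (simp add: flat_def)
    ultimately show ?thesis by (subst DERIV_cong_ev[OF refl _ refl]) auto
  next
    case 2
    have "eventually (\<lambda>y. y < 0) (nhds x)" using 2 eventually_nhds_in_open[of "{..<0}" x] by simp
    then have "eventually (\<lambda>y. flat P y = 0) (nhds x)"
      by eventually_elim (simp add: flat_def)
    then show ?thesis using 2 by (subst DERIV_cong_ev[OF refl _ refl]) (auto simp: flat_def)
  next
    case 3
    \<comment> \<open>The difference quotient at 0 is again a member of the family, so its limit is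
      known.\<close>
    have "(\<lambda>h. (flat P (0 + h) - flat P 0) / h) = flat (pCons 0 P)"
      by (auto simp: flat_def fun_eq_iff)
    then show ?thesis using flat_tendsto[of "pCons 0 P"] 3
      by (simp add: DERIV_def flat_def[of _ 0])
  qed
qed

lemma smooth_flat: "smooth (flat P)"
proof -
  have "ndiff n (flat P)" for n
    by (induction n arbitrary: P) (use flat_deriv in fastforce)+
  then show ?thesis by (simp add: smooth_def)
qed

text \<open>The arguments are n (x - c) - 1 and n (d - x) - 1. The shift by 1 puts the support
  inside [c + 1/n, d - 1/n], hence compactly inside the unit interval even for c = 0 and d = 1; both
  arguments tend to infinity on the open interval, where the product therefore tends to 1.\<close>

definition cutoff :: "real \<Rightarrow> real \<Rightarrow> nat \<Rightarrow> real \<Rightarrow> real" where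
  "cutoff c d n x = flat 1 (real n * x + (- real n * c - 1)) * flat 1 (- real n * x + (real n * d - 1))"

lemma flat_1_bounds: "0 \<le> flat 1 x" "flat 1 x \<le> 1"
  by (auto simp: flat_def)

lemma cutoff_bounds: "0 \<le> cutoff c d n x" "cutoff c d n x \<le> 1"
  unfolding cutoff_def using flat_1_bounds by (auto simp: mult_le_one)

lemma cutoff_eq_0: "x \<le> c \<Longrightarrow> cutoff c d n x = 0" "x \<ge> d \<Longrightarrow> cutoff c d n x = 0"
  unfolding cutoff_def flat_def
  using mult_left_mono[of x c "real n"] mult_left_mono[of d x "real n"] by auto

lemma test_fun_cutoff:
  assumes "0 \<le> c" "c < d" "d \<le> 1"
  shows "test_fun (cutoff c d n)"
\<comment> \<open>For small n the interval from c + 1/n to d - 1/n may be empty; the function is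
  then zero, and \<open>test_fun\<close> asks for some nonempty interval all the same.\<close>
proof (cases "cutoff c d n = (\<lambda>_. 0)")
  case True
  then show ?thesis using test_fun_zero by simp
next
  case False
  have n: "n > 0"
    using False by (cases "n = 0") (auto simp: cutoff_def flat_def)
  define a b where "a = c + 1 / n" and "b = d - 1 / n"
  have supp: "x \<in> {a..b}" if "cutoff c d n x \<noteq> 0" for x
  proof -
    have "n * x + (- real n * c - 1) > 0" "- n * x + (real n * d - 1) > 0"
      using that unfolding cutoff_def flat_def by (auto split: if_splits)
    then show ?thesis using n by (auto simp: a_def b_def field_simps)
  qed
  have "smooth (cutoff c d n)"
    unfolding cutoff_def by (intro smooth_mult smooth_affine[OF smooth_flat])
  moreover have "a \<le> b"
    using supp False by fastforce
  moreover have "0 < a" "b < 1" using n assms by (auto simp: a_def b_def intro: add_nonneg_pos less_le_trans[of _ d])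
  ultimately show ?thesis using supp unfolding test_fun_iff by blast
qed

lemma flat_1_tendsto: "a > 0 \<Longrightarrow> (\<lambda>n. flat 1 (real n * a - 1)) \<longlonglongrightarrow> 1"
proof -
  assume a: "a > 0"
  have f: "filterlim (\<lambda>n. real n * a - 1) at_top sequentially"
    using a by real_asymp
  have "((\<lambda>x. exp (- (1 / x))) \<longlongrightarrow> (1::real)) at_top" by real_asymp
  then have "(flat 1 \<longlongrightarrow> 1) at_top"
    by (rule Lim_transform_eventually) (auto simp: flat_def intro: eventually_mono[OF eventually_gt_at_top[of 0]])
  from filterlim_compose[OF this f] show ?thesis .
qed

lemma cutoff_tendsto: "(\<lambda>n. cutoff c d n x) \<longlonglongrightarrow> indicator {c<..<d} x"
proof (cases "c < x \<and> x < d")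
  case True
  have "(\<lambda>n. flat 1 (real n * (x - c) - 1) * flat 1 (real n * (d - x) - 1)) \<longlonglongrightarrow> 1 * 1"
    using True by (intro tendsto_mult flat_1_tendsto) auto
  then show ?thesis using True by (simp add: cutoff_def algebra_simps)
next
  case False
  then show ?thesis using cutoff_eq_0[of x c d] cutoff_eq_0[of d x c] by (auto simp: indicator_def)
qed

section \<open>Square integrable functions on the unit interval\<close>

text \<open>Set integrals over \<open>D\<close> become ordinary integrals for a measure of total
  mass 1, so the L1 norm is at most the L2 norm and the L2 norm at most the supremum, with constant
  1.\<close>

definition leb01 :: "real measure" where "leb01 = restrict_space lborel D"

lemmas LINT_cong = Bochner_Integration.integral_cong

lemma space_leb01 [simp]: "space leb01 = D"
  by (simp add: leb01_def space_restrict_space)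

lemma emeasure_space_leb01: "emeasure leb01 D = 1"
  by (simp add: leb01_def emeasure_restrict_space)

interpretation leb01: finite_measure leb01
  by standard (simp add: emeasure_space_leb01)

lemma measure_space_leb01 [simp]: "measure leb01 D = 1"
  by (simp add: measure_def emeasure_space_leb01)

lemma measurable_leb01: "f \<in> borel_measurable borel \<Longrightarrow> f \<in> borel_measurable leb01"
  unfolding leb01_def by (intro measurable_restrict_space1) simp

lemma set_measurable_leb01_iff:
  fixes f :: "real \<Rightarrow> real"
  shows "set_borel_measurable lborel D f \<longleftrightarrow> f \<in> borel_measurable leb01"
  by (simp add: leb01_def set_borel_measurable_def borel_measurable_restrict_space_iff)

lemma set_integrable_leb01_iff:
  fixes f :: "real \<Rightarrow> real"
  shows "set_integrable lborel D f \<longleftrightarrow> integrable leb01 f"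
  by (simp add: leb01_def set_integrable_def integrable_restrict_space)

lemma set_integral_leb01:
  fixes f :: "real \<Rightarrow> real"
  shows "(LINT x:D|lborel. f x) = integral\<^sup>L leb01 f"
  by (simp add: leb01_def set_lebesgue_integral_def integral_restrict_space)

lemma AE_leb01_iff: "(AE x in leb01. P x) \<longleftrightarrow> (AE x in lborel. x \<in> D \<longrightarrow> P x)"
  unfolding leb01_def by (subst AE_restrict_space_iff) auto

lemma L2D_iff: "L2D f \<longleftrightarrow> f \<in> borel_measurable leb01 \<and> integrable leb01 (\<lambda>x. (f x)^2)"
  by (simp add: L2D_def set_measurable_leb01_iff set_integrable_leb01_iff)

lemma L2_norm_eq: "L2_norm f = sqrt (\<integral>x. (f x)^2 \<partial>leb01)"
  by (simp add: L2_norm_def set_integral_leb01)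

lemma l2_inner_eq: "l2_inner f g = (\<integral>x. f x * g x \<partial>leb01)"
  by (simp add: l2_inner_def set_integral_leb01)

lemma L2D_measurable: "L2D f \<Longrightarrow> f \<in> borel_measurable leb01"
  by (simp add: L2D_iff)

lemma L2_norm_nonneg [simp]: "0 \<le> L2_norm f"
  by (simp add: L2_norm_eq)

lemma L2_norm_power2: "(L2_norm f)^2 = (\<integral>x. (f x)^2 \<partial>leb01)"
  by (simp add: L2_norm_eq)

lemma L2D_bound:
  fixes f :: "real \<Rightarrow> real"
  assumes "f \<in> borel_measurable leb01" "L2D g" "\<And>x. x \<in> D \<Longrightarrow> \<bar>f x\<bar> \<le> \<bar>g x\<bar>"
  shows "L2D f" "L2_norm f \<le> L2_norm g"
proof -
  have le: "(f x)^2 \<le> (g x)^2" if "x \<in> D" for x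
    using assms(3)[OF that] by (simp add: abs_le_square_iff)
  have "integrable leb01 (\<lambda>x. (f x)^2)"
    by (rule Bochner_Integration.integrable_bound[of _ "\<lambda>x. (g x)^2"])
       (use assms le in \<open>auto simp: L2D_iff\<close>)
  then show "L2D f" using assms by (simp add: L2D_iff)
  then show "L2_norm f \<le> L2_norm g"
    unfolding L2_norm_eq using assms(2) le
    by (intro real_sqrt_le_mono integral_mono) (auto simp: L2D_iff)
qed

lemma L2D_const: "L2D (\<lambda>_. c)" and L2_norm_const: "L2_norm (\<lambda>_. c) = \<bar>c\<bar>"
  by (auto simp: L2D_iff L2_norm_eq)

lemma L2D_bounded:
  fixes f :: "real \<Rightarrow> real"
  assumes "f \<in> borel_measurable leb01" "\<And>x. x \<in> D \<Longrightarrow> \<bar>f x\<bar> \<le> B"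
  shows "L2D f" "L2_norm f \<le> B"
proof -
  have "B \<ge> 0" using assms(2)[of "1/2"] by auto
  then show "L2D f" "L2_norm f \<le> B"
    using L2D_bound[OF assms(1) L2D_const[of B]] assms(2) by (auto simp: L2_norm_const)
qed

lemma L2D_mult_integrable:
  assumes "L2D f" "L2D g"
  shows "integrable leb01 (\<lambda>x. f x * g x)"
proof (rule Bochner_Integration.integrable_bound[of _ "\<lambda>x. (f x)^2 + (g x)^2"])
  show "AE x in leb01. norm (f x * g x) \<le> norm ((f x)\<^sup>2 + (g x)\<^sup>2)"
  proof (rule AE_I2)
    fix x
    show "norm (f x * g x) \<le> norm ((f x)\<^sup>2 + (g x)\<^sup>2)"
      using sum_squares_bound[of "\<bar>f x\<bar>" "\<bar>g x\<bar>"] mult_nonneg_nonneg[of "\<bar>f x\<bar>" "\<bar>g x\<bar>"]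
      unfolding real_norm_def abs_mult power2_abs by linarith
  qed
qed (use assms in \<open>auto simp: L2D_iff\<close>)

lemma L2D_add: "L2D f \<Longrightarrow> L2D g \<Longrightarrow> L2D (\<lambda>x. f x + g x)"
  using L2D_mult_integrable[of f g] by (auto simp: L2D_iff power2_sum mult.assoc)

lemma L2D_cmult: "L2D f \<Longrightarrow> L2D (\<lambda>x. c * f x)"
  by (auto simp: L2D_iff power_mult_distrib)

lemma L2D_diff: "L2D f \<Longrightarrow> L2D g \<Longrightarrow> L2D (\<lambda>x. f x - g x)"
  using L2D_add[of f "\<lambda>x. (-1) * g x"] L2D_cmult[of g "-1"] by simp

lemma L2D_abs: "L2D f \<Longrightarrow> L2D (\<lambda>x. \<bar>f x\<bar>)"
  by (auto simp: L2D_iff)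

lemma L2D_sum: "finite A \<Longrightarrow> (\<And>i. i \<in> A \<Longrightarrow> L2D (f i)) \<Longrightarrow> L2D (\<lambda>x. \<Sum>i\<in>A. f i x)"
  by (induction A rule: finite_induct) (auto simp: L2D_const intro: L2D_add)

lemma L2D_integrable: "L2D f \<Longrightarrow> integrable leb01 f"
  using L2D_mult_integrable[of f "\<lambda>_. 1"] L2D_const[of 1] by simp

lemma L2D_mult_bounded:
  fixes f g :: "real \<Rightarrow> real"
  assumes "L2D f" "g \<in> borel_measurable leb01" "\<And>x. x \<in> D \<Longrightarrow> \<bar>g x\<bar> \<le> B"
  shows "L2D (\<lambda>x. g x * f x)"
proof (rule L2D_bound(1)[OF _ L2D_cmult[OF assms(1), of B]])
  show "(\<lambda>x. g x * f x) \<in> borel_measurable leb01"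
    using assms by (auto simp: L2D_iff)
  show "\<bar>g x * f x\<bar> \<le> \<bar>B * f x\<bar>" if "x \<in> D" for x
    using assms(3)[OF that] by (simp add: abs_mult mult_right_mono)
qed

lemma L2_norm_eq_0_AE:
  assumes "L2D f" "L2_norm f = 0"
  shows "AE x in leb01. f x = 0"
  using assms integral_nonneg_eq_0_iff_AE[of leb01 "\<lambda>x. (f x)^2"] by (auto simp: L2_norm_eq L2D_iff)

lemma L2_Cauchy_Schwarz:
  assumes "L2D f" "L2D g"
  shows "\<bar>\<integral>x. f x * g x \<partial>leb01\<bar> \<le> L2_norm f * L2_norm g"
proof (cases "L2_norm f = 0 \<or> L2_norm g = 0")
  case True
  then have "AE x in leb01. f x * g x = 0"
    using L2_norm_eq_0_AE assms by fastforce
  then have "(\<integral>x. f x * g x \<partial>leb01) = 0" by (rule integral_eq_zero_AE)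
  then show ?thesis by simp
next
  case False
  define a b where "a = L2_norm f" and "b = L2_norm g"
  have pos: "a > 0" "b > 0"
    using False L2_norm_nonneg[of f] L2_norm_nonneg[of g] unfolding a_def b_def by linarith+
  have int: "integrable leb01 (\<lambda>x. (f x)^2 / a^2)" "integrable leb01 (\<lambda>x. (g x)^2 / b^2)"
    using assms by (auto simp: L2D_iff)
  have "(\<integral>x. \<bar>f x * g x\<bar> \<partial>leb01) \<le> (\<integral>x. (a * b / 2) * ((f x)^2 / a^2 + (g x)^2 / b^2) \<partial>leb01)"
  proof (rule integral_mono)
    fix x
    have "2 * (\<bar>f x\<bar> / a) * (\<bar>g x\<bar> / b) \<le> (\<bar>f x\<bar> / a)^2 + (\<bar>g x\<bar> / b)^2"
      by (rule sum_squares_bound)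
    then have "(a * b / 2) * (2 * (\<bar>f x\<bar> / a) * (\<bar>g x\<bar> / b)) \<le> (a * b / 2) * ((f x)^2 / a^2 + (g x)^2 / b^2)"
      using pos by (intro mult_left_mono) (auto simp: power_divide)
    moreover have "(a * b / 2) * (2 * (\<bar>f x\<bar> / a) * (\<bar>g x\<bar> / b)) = \<bar>f x * g x\<bar>"
      using pos by (simp add: abs_mult)
    ultimately show "\<bar>f x * g x\<bar> \<le> (a * b / 2) * ((f x)^2 / a^2 + (g x)^2 / b^2)" by simp
  qed (use int L2D_mult_integrable[OF assms] in auto)
  also have "\<dots> = (a * b / 2) * ((\<integral>x. (f x)^2 \<partial>leb01) / a^2 + (\<integral>x. (g x)^2 \<partial>leb01) / b^2)"
    using int by (subst integral_mult_right_zero, subst Bochner_Integration.integral_add) auto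
  also have "\<dots> = a * b"
    unfolding L2_norm_power2[symmetric] a_def[symmetric] b_def[symmetric] using pos by simp
  finally show ?thesis
    using integral_abs_bound[of leb01 "\<lambda>x. f x * g x"] unfolding a_def b_def by linarith
qed

lemma L2_norm_cmult: "L2_norm (\<lambda>x. c * f x) = \<bar>c\<bar> * L2_norm f"
  by (simp add: L2_norm_eq power_mult_distrib real_sqrt_mult)

lemma L2_norm_add:
  assumes "L2D f" "L2D g"
  shows "L2_norm (\<lambda>x. f x + g x) \<le> L2_norm f + L2_norm g"
proof -
  have "(L2_norm (\<lambda>x. f x + g x))^2 = (L2_norm f)^2 + (L2_norm g)^2 + 2 * (\<integral>x. f x * g x \<partial>leb01)"
    using assms L2D_mult_integrable[OF assms]
    by (simp add: L2_norm_power2 power2_sum L2D_iff mult.assoc)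
  also have "\<dots> \<le> (L2_norm f + L2_norm g)^2"
    using L2_Cauchy_Schwarz[OF assms] by (simp add: power2_sum)
  finally show ?thesis by (rule power2_le_imp_le) simp
qed

lemma L2_norm_diff:
  assumes "L2D f" "L2D g"
  shows "L2_norm (\<lambda>x. f x - g x) \<le> L2_norm f + L2_norm g"
  using L2_norm_add[OF assms(1) L2D_cmult[OF assms(2), of "-1"]] L2_norm_cmult[of "-1" g] by simp

lemma L2_norm_cong_AE:
  assumes "AE x in leb01. f x = g x" "f \<in> borel_measurable leb01" "g \<in> borel_measurable leb01"
  shows "L2_norm f = L2_norm g"
  unfolding L2_norm_eq using assms by (intro arg_cong[where f=sqrt] integral_cong_AE) auto

lemma L1_le_L2_norm:
  assumes "L2D f"
  shows "(\<integral>x. \<bar>f x\<bar> \<partial>leb01) \<le> L2_norm f" "\<bar>\<integral>x. f x \<partial>leb01\<bar> \<le> L2_norm f"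
proof -
  have "L2_norm (\<lambda>x. \<bar>f x\<bar>) = L2_norm f" by (simp add: L2_norm_eq)
  then show "(\<integral>x. \<bar>f x\<bar> \<partial>leb01) \<le> L2_norm f"
    using L2_Cauchy_Schwarz[OF L2D_abs[OF assms] L2D_const[of 1]] by (simp add: L2_norm_const)
  then show "\<bar>\<integral>x. f x \<partial>leb01\<bar> \<le> L2_norm f"
    using integral_abs_bound[of leb01 f] by linarith
qed

section \<open>Primitives\<close>

text \<open>Since \<open>leb01\<close> lives on the unit interval, a half-line indicator suffices;
  the primitive is defined on the whole line, 0 to the left of 0 and equal to the total integral to
  the right of 1.\<close>

definition prim :: "(real \<Rightarrow> real) \<Rightarrow> real \<Rightarrow> real" where
  "prim b x = (\<integral>t. indicator {..<x} t * b t \<partial>leb01)"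

lemma integrable_indicator_mult:
  fixes b :: "real \<Rightarrow> real"
  assumes "integrable leb01 b" "A \<in> sets borel"
  shows "integrable leb01 (\<lambda>t. indicator A t * b t)"
proof (rule Bochner_Integration.integrable_bound[OF assms(1)])
  have "b \<in> borel_measurable leb01" "indicator A \<in> borel_measurable leb01"
    using assms by (auto intro!: measurable_leb01)
  then show "(\<lambda>t. indicator A t * b t) \<in> borel_measurable leb01" by measurable
qed (auto simp: indicator_def)

lemma prim_0: "x \<le> 0 \<Longrightarrow> prim b x = 0"
  unfolding prim_def by (rule integral_eq_zero_AE) (auto intro!: AE_I2 simp: indicator_def)

lemma prim_1: "x \<ge> 1 \<Longrightarrow> prim b x = integral\<^sup>L leb01 b"
  unfolding prim_def by (rule LINT_cong) (auto simp: indicator_def)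

lemma prim_diff:
  assumes "integrable leb01 b" "s \<le> t"
  shows "prim b t - prim b s = (\<integral>x. indicator {s..<t} x * b x \<partial>leb01)"
proof -
  have "prim b t - prim b s = (\<integral>x. indicator {..<t} x * b x - indicator {..<s} x * b x \<partial>leb01)"
    unfolding prim_def using assms by (intro Bochner_Integration.integral_diff[symmetric] integrable_indicator_mult) auto
  also have "\<dots> = (\<integral>x. indicator {s..<t} x * b x \<partial>leb01)"
    using assms(2) by (intro LINT_cong) (auto simp: indicator_def)
  finally show ?thesis .
qed

lemma prim_add: "integrable leb01 a \<Longrightarrow> integrable leb01 b \<Longrightarrow> prim (\<lambda>x. a x + b x) t = prim a t + prim b t"
  unfolding prim_def by (subst Bochner_Integration.integral_add[symmetric]) (auto intro!: integrable_indicator_mult simp: distrib_left)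

lemma prim_minus: "integrable leb01 a \<Longrightarrow> integrable leb01 b \<Longrightarrow> prim (\<lambda>x. a x - b x) t = prim a t - prim b t"
  unfolding prim_def by (subst Bochner_Integration.integral_diff[symmetric]) (auto intro!: integrable_indicator_mult simp: right_diff_distrib)

lemma prim_cmult: "prim (\<lambda>x. c * b x) t = c * prim b t"
  unfolding prim_def by (subst integral_mult_right_zero[symmetric]) (simp add: ac_simps)

lemma integral_indicator_le:
  fixes b :: "real \<Rightarrow> real"
  assumes "integrable leb01 b" "A \<in> sets borel"
  shows "\<bar>\<integral>x. indicator A x * b x \<partial>leb01\<bar> \<le> (\<integral>x. \<bar>b x\<bar> \<partial>leb01)"
proof -
  have "\<bar>\<integral>x. indicator A x * b x \<partial>leb01\<bar> \<le> (\<integral>x. \<bar>indicator A x * b x\<bar> \<partial>leb01)"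
    by (rule integral_abs_bound)
  also have "\<dots> \<le> (\<integral>x. \<bar>b x\<bar> \<partial>leb01)"
  proof (rule integral_mono)
    show "integrable leb01 (\<lambda>x. \<bar>indicator A x * b x\<bar>)"
      using integrable_indicator_mult[OF assms] by (intro integrable_abs) auto
  qed (use assms in \<open>auto simp: indicator_def\<close>)
  finally show ?thesis .
qed

lemma prim_abs_le: "integrable leb01 b \<Longrightarrow> \<bar>prim b t\<bar> \<le> (\<integral>x. \<bar>b x\<bar> \<partial>leb01)"
  unfolding prim_def by (rule integral_indicator_le) auto

lemma prim_diff_abs_le: "integrable leb01 b \<Longrightarrow> \<bar>prim b t - prim b s\<bar> \<le> (\<integral>x. \<bar>b x\<bar> \<partial>leb01)"
proof (induction s t rule: linorder_wlog)
  case (le s t)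
  then show ?case using prim_diff[of b s t] integral_indicator_le[of b "{s..<t}"] by auto
qed (simp add: abs_minus_commute)

lemma integral_leb01_indicator:
  assumes "0 \<le> s" "s \<le> t" "t \<le> 1"
  shows "(\<integral>x. indicator {s..<t} x \<partial>leb01) = t - s"
proof -
  have "(\<integral>x. indicator {s..<t} x \<partial>leb01) = (\<integral>x. indicator ({s..<t} \<inter> D) x \<partial>leb01 :: real)"
    by (intro LINT_cong) (auto simp: indicator_def)
  also have "\<dots> = measure leb01 ({s..<t} \<inter> D)"
    by (simp add: Int_assoc)
  also have "\<dots> = measure lborel ({s..<t} \<inter> D)"
    unfolding leb01_def by (subst measure_restrict_space) auto
  also have "measure lborel ({s..<t} \<inter> D) = t - s"
  proof (cases "s = 0")
    case True
    then have "{s..<t} \<inter> D = {s<..<t}" using assms by auto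
    then show ?thesis using assms by simp
  next
    case False
    then have "{s..<t} \<inter> D = {s..<t}" using assms by auto
    then show ?thesis using assms by simp
  qed
  finally show ?thesis .
qed

lemma integral_indicator_bounded_le:
  fixes b :: "real \<Rightarrow> real"
  assumes "b \<in> borel_measurable leb01" "\<And>x. x \<in> D \<Longrightarrow> \<bar>b x\<bar> \<le> B" "0 \<le> s" "s \<le> t" "t \<le> 1"
  shows "\<bar>\<integral>x. indicator {s..<t} x * b x \<partial>leb01\<bar> \<le> B * (t - s)"
proof -
  have b: "integrable leb01 b" using L2D_bounded[OF assms(1,2)] L2D_integrable by blast
  have i: "integrable leb01 (\<lambda>x. indicator {s..<t} x * B)"
    by (rule integrable_indicator_mult) auto
  have "\<bar>\<integral>x. indicator {s..<t} x * b x \<partial>leb01\<bar> \<le> (\<integral>x. \<bar>indicator {s..<t} x * b x\<bar> \<partial>leb01)"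
    by (rule integral_abs_bound)
  also have "\<dots> \<le> (\<integral>x. indicator {s..<t} x * B \<partial>leb01)"
  proof (rule integral_mono)
    show "integrable leb01 (\<lambda>x. \<bar>indicator {s..<t} x * b x\<bar>)"
      using integrable_indicator_mult[OF b] by (intro integrable_abs) auto
  qed (use i assms in \<open>auto simp: indicator_def\<close>)
  also have "\<dots> = B * (t - s)" using integral_leb01_indicator[OF assms(3-5)] by simp
  finally show ?thesis .
qed

lemma prim_Lipschitz:
  assumes "b \<in> borel_measurable leb01" "\<And>x. x \<in> D \<Longrightarrow> \<bar>b x\<bar> \<le> B" "0 \<le> s" "s \<le> t" "t \<le> 1"
  shows "\<bar>prim b t - prim b s\<bar> \<le> B * (t - s)"
  using prim_diff[of b s t] integral_indicator_bounded_le[OF assms] assms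
    L2D_integrable[OF L2D_bounded(1)[OF assms(1,2)]] by auto

text \<open>Cauchy-Schwarz against the indicator of the interval from s to t, whose L2 norm is the
  square root of its length.\<close>

lemma prim_Holder:
  assumes "L2D b" "0 \<le> s" "s \<le> t" "t \<le> 1"
  shows "\<bar>prim b t - prim b s\<bar> \<le> L2_norm b * sqrt (t - s)"
proof -
  have m: "L2D (indicator {s..<t})"
    by (rule L2D_bounded[of _ 1]) (auto intro!: measurable_leb01 simp: indicator_def)
  have "(\<integral>x. (indicator {s..<t} x)^2 \<partial>leb01) = (\<integral>x. indicator {s..<t} x \<partial>leb01 :: real)"
    by (intro LINT_cong) (auto simp: indicator_def)
  then have "L2_norm (indicator {s..<t}) = sqrt (t - s)"
    using integral_leb01_indicator[OF assms(2-4)] by (simp add: L2_norm_eq)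
  with L2_Cauchy_Schwarz[OF m assms(1)] show ?thesis
    using prim_diff[OF L2D_integrable[OF assms(1)] assms(3)] by (simp add: mult.commute)
qed

lemma prim_continuous_on:
  assumes "L2D b"
  shows "continuous_on {0..1} (prim b)"
proof -
  have H: "\<bar>prim b t - prim b s\<bar> \<le> L2_norm b * sqrt \<bar>t - s\<bar>" if "s \<in> {0..1}" "t \<in> {0..1}" for s t
    using that
  proof (induction s t rule: linorder_wlog)
    case (le s t)
    then show ?case using prim_Holder[OF assms, of s t] by auto
  qed (simp add: abs_minus_commute)
  show ?thesis unfolding continuous_on_def
  proof
    fix s :: real assume s: "s \<in> {0..1}"
    have "((\<lambda>t. L2_norm b * sqrt \<bar>t - s\<bar>) \<longlongrightarrow> L2_norm b * sqrt \<bar>s - s\<bar>) (at s within {0..1})"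
      by (intro tendsto_intros)
    then have lim: "((\<lambda>t. L2_norm b * sqrt \<bar>t - s\<bar>) \<longlongrightarrow> 0) (at s within {0..1})" by simp
    have "\<forall>\<^sub>F t in at s within {0..1}. norm (prim b t - prim b s) \<le> L2_norm b * sqrt \<bar>t - s\<bar>"
      unfolding eventually_at_filter real_norm_def using H[OF s] by (intro always_eventually) blast
    then have "((\<lambda>t. prim b t - prim b s) \<longlongrightarrow> 0) (at s within {0..1})"
      using lim by (rule Lim_null_comparison)
    then show "(prim b \<longlongrightarrow> prim b s) (at s within {0..1})"
      by (simp add: LIM_zero_iff)
  qed
qed

lemma continuous_on_measurable_leb01:
  fixes f :: "real \<Rightarrow> real"
  assumes "continuous_on {0..1} f"
  shows "f \<in> borel_measurable leb01"
proof -
  have "set_borel_measurable borel D f"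
    by (rule set_measurable_continuous_on[OF _ continuous_on_subset[OF assms]]) auto
  then show ?thesis
    by (simp add: set_measurable_leb01_iff[symmetric] set_borel_measurable_def)
qed

lemma prim_measurable: "L2D b \<Longrightarrow> prim b \<in> borel_measurable leb01"
  by (intro continuous_on_measurable_leb01 prim_continuous_on)

text \<open>Both sides integrate \<open>a x * b t\<close> over the triangle \<open>t < x\<close>.\<close>

lemma integral_prim_by_parts:
  assumes a: "integrable leb01 a" and b: "integrable leb01 b"
  shows "(\<integral>x. a x * prim b x \<partial>leb01) = (\<integral>x. b x * (integral\<^sup>L leb01 a - prim a x) \<partial>leb01)"
proof -
  interpret pair_sigma_finite leb01 leb01 by unfold_locales
  have [measurable]: "a \<in> borel_measurable leb01" "b \<in> borel_measurable leb01" using a b by auto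
  have [measurable]: "(\<lambda>x. x) \<in> borel_measurable leb01" by (simp add: measurable_leb01)
  define F where "F = (\<lambda>x t. indicator {..<x} t * (a x * b t))"
  have ind: "(\<lambda>z. indicator {..<fst z} (snd z) :: real) \<in> borel_measurable (leb01 \<Otimes>\<^sub>M leb01)"
  proof -
    have "(\<lambda>z :: real \<times> real. indicator {..<fst z} (snd z) :: real) = (\<lambda>z. if snd z < fst z then 1 else 0)"
      by (auto simp: indicator_def fun_eq_iff)
    moreover have f: "(\<lambda>z. fst z) \<in> borel_measurable (leb01 \<Otimes>\<^sub>M leb01)" "(\<lambda>z. snd z) \<in> borel_measurable (leb01 \<Otimes>\<^sub>M leb01)"
      by (rule measurable_compose[OF measurable_fst], simp add: measurable_leb01)
         (rule measurable_compose[OF measurable_snd], simp add: measurable_leb01)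
    moreover have "(\<lambda>z. if snd z < fst z then 1 else 0 :: real) \<in> borel_measurable (leb01 \<Otimes>\<^sub>M leb01)"
      using borel_measurable_less[OF f(2,1)] by (intro measurable_If) auto
    ultimately show ?thesis by (simp only:)
  qed
  have I: "integrable (leb01 \<Otimes>\<^sub>M leb01) (\<lambda>(x, t). a x * b t)"
  proof (rule Fubini_integrable)
    show "integrable leb01 (\<lambda>x. \<integral>t. norm (case (x, t) of (x, t) \<Rightarrow> a x * b t) \<partial>leb01)"
      using integrable_norm[OF a] by (auto simp: abs_mult)
  qed (use b in auto)
  have J: "integrable (leb01 \<Otimes>\<^sub>M leb01) (case_prod F)"
  proof (rule Bochner_Integration.integrable_bound[OF I])
    show "case_prod F \<in> borel_measurable (leb01 \<Otimes>\<^sub>M leb01)"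
      unfolding F_def case_prod_beta using ind by measurable
  qed (auto simp: F_def indicator_def)
  have "(\<integral>x. a x * prim b x \<partial>leb01) = (\<integral>x. (\<integral>t. F x t \<partial>leb01) \<partial>leb01)"
    unfolding prim_def F_def
    by (intro LINT_cong refl, subst integral_mult_right_zero[symmetric]) (simp add: ac_simps)
  also have "\<dots> = (\<integral>t. (\<integral>x. F x t \<partial>leb01) \<partial>leb01)"
    using Fubini_integral[OF J] by simp
  also have "\<dots> = (\<integral>t. b t * (integral\<^sup>L leb01 a - prim a t) \<partial>leb01)"
  proof (intro LINT_cong refl)
    fix t
    have "(\<integral>x. F x t \<partial>leb01) = b t * (\<integral>x. a x - indicator {..t} x * a x \<partial>leb01)"
      unfolding F_def
      by (subst integral_mult_right_zero[symmetric], intro LINT_cong) (auto simp: indicator_def)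
    also have "(\<integral>x. a x - indicator {..t} x * a x \<partial>leb01) = integral\<^sup>L leb01 a - (\<integral>x. indicator {..t} x * a x \<partial>leb01)"
      using a by (intro Bochner_Integration.integral_diff integrable_indicator_mult) auto
    \<comment> \<open>The complement of t < x contains the point t, which \<open>prim\<close> omits;
      a single point has measure zero.\<close>
    also have "(\<integral>x. indicator {..t} x * a x \<partial>leb01) = prim a t"
    proof -
      have "AE x in leb01. x \<noteq> t" unfolding AE_leb01_iff using AE_lborel_singleton[of t] by eventually_elim auto
      then have "AE x in leb01. indicator {..t} x * a x = indicator {..<t} x * a x"
        by eventually_elim (auto simp: indicator_def)
      then show ?thesis unfolding prim_def
        using a by (intro integral_cong_AE borel_measurable_integrable integrable_indicator_mult) auto
    qed
    finally show "(\<integral>x. F x t \<partial>leb01) = b t * (integral\<^sup>L leb01 a - prim a t)" .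
  qed
  finally show ?thesis .
qed

text \<open>The exceptional set is there for the mesh points, at which a continuous piecewise
  polynomial need not be differentiable.\<close>

lemma prim_FTC:
  assumes v: "continuous_on {0..1} v" and S: "finite S"
    and d: "\<And>x. x \<in> D - S \<Longrightarrow> (v has_real_derivative v' x) (at x)"
    and i: "integrable leb01 v'" and x: "x \<in> {0..1}"
  shows "v x = v 0 + prim v' x"
proof -
  have "(v' has_integral (v x - v 0)) {0..x}"
    using x d by (intro fundamental_theorem_of_calculus_interior_strong[OF S])
      (auto intro: continuous_on_subset[OF v] simp: has_real_derivative_iff_has_vector_derivative[symmetric])
  then have 1: "(v' has_integral (v x - v 0)) {0<..<x}"
    by (simp add: has_integral_Icc_iff_Ioo)
  have "set_integrable lborel D v'" using i by (simp add: set_integrable_leb01_iff)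
  then have si: "set_integrable lborel {0<..<x} v'"
    by (rule set_integrable_subset) (use x in auto)
  have "v x - v 0 = (LINT t:{0<..<x}|lborel. v' t)"
    using set_borel_integral_eq_integral(2)[OF si] 1 by (simp add: integral_unique)
  also have "\<dots> = prim v' x"
    unfolding prim_def set_integral_leb01[symmetric] set_lebesgue_integral_def
    using x by (intro LINT_cong) (auto simp: indicator_def)
  finally show ?thesis by simp
qed

text \<open>Extend \<open>g\<close> by zero to the line. The Borel sets over which the extension
  integrates to zero contain the intervals and are closed under complement and countable disjoint
  union, so they are all Borel sets; a density with all set integrals zero vanishes almost
  everywhere.\<close>

lemma AE_zero_if_interval_integrals_zero:
  fixes g :: "real \<Rightarrow> real"
  assumes g: "integrable leb01 g"
    and z: "\<And>c d. 0 \<le> c \<Longrightarrow> c < d \<Longrightarrow> d \<le> 1 \<Longrightarrow> (\<integral>x. g x * indicator {c<..<d} x \<partial>leb01) = 0"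
  shows "AE x in leb01. g x = 0"
proof -
  define G where "G = (\<lambda>x. indicator D x * g x)"
  have G: "integrable lborel G"
    using g unfolding G_def by (simp add: set_integrable_leb01_iff[symmetric] set_integrable_def)
  have GI: "integrable lborel (\<lambda>x. indicator A x * G x)" if "A \<in> sets borel" for A
    using integrable_mult_indicator[OF _ G, of A] that by simp
  have I: "(\<integral>x. indicator {a..b} x * G x \<partial>lborel) = 0" for a b
  proof -
    have AE: "AE x in lborel. indicator {a..b} x * G x = indicator D x * (g x * indicator {max 0 a<..<min 1 b} x)"
      using AE_lborel_singleton[of a] AE_lborel_singleton[of b]
      by eventually_elim (auto simp: G_def indicator_def)
    have "integrable leb01 (\<lambda>x. g x * indicator {max 0 a<..<min 1 b} x)"
      using integrable_indicator_mult[OF g, of "{max 0 a<..<min 1 b}"] by (simp add: mult.commute)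
    then have m: "(\<lambda>x. indicator D x * (g x * indicator {max 0 a<..<min 1 b} x)) \<in> borel_measurable lborel"
      unfolding set_integrable_leb01_iff[symmetric] set_integrable_def by simp
    have "(\<integral>x. indicator {a..b} x * G x \<partial>lborel) = (\<integral>x. g x * indicator {max 0 a<..<min 1 b} x \<partial>leb01)"
      unfolding set_integral_leb01[symmetric] set_lebesgue_integral_def real_scaleR_def
      using AE GI[of "{a..b}"] m by (intro integral_cong_AE) auto
    also have "\<dots> = 0"
    proof (cases "max 0 a < min 1 b")
      case False
      then have "{max 0 a<..<min 1 b} = {}" by auto
      then show ?thesis by simp
    qed (auto intro: z)
    finally show ?thesis .
  qed
  have P: "(\<integral>x. indicator A x * G x \<partial>lborel) = 0" if "A \<in> sets borel" for A
    using that
  proof (induction A rule: borel_set_induct)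
    case (interval a b)
    then show ?case by (rule_tac I)
  next
    case (compl A)
    have "(\<integral>x. indicator (- A) x * G x \<partial>lborel) = (\<integral>x. indicator {0..1} x * G x - indicator A x * G x \<partial>lborel)"
      by (intro LINT_cong) (auto simp: G_def indicator_def)
    also have "\<dots> = 0" using GI[of "{0..1}"] GI[of A] compl I by simp
    finally show ?case .
  next
    case (union f)
    have "set_integrable lborel (\<Union>i. f i) G"
      using GI[of "\<Union>i. f i"] union by (auto simp: set_integrable_def)
    then have "(LINT x:(\<Union>i. f i)|lborel. G x) = (\<Sum>i. (LINT x:(f i)|lborel. G x))"
      using union by (intro lebesgue_integral_countable_add) (auto simp: disjoint_family_on_def)
    then show ?case using union by (simp add: set_lebesgue_integral_def)
  qed simp
  have "AE x in lborel. G x = 0"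
    using P by (intro density_unique_real[OF G]) (auto simp: set_lebesgue_integral_def)
  then show ?thesis unfolding AE_leb01_iff by eventually_elim (auto simp: G_def)
qed

section \<open>Weak derivatives and the space \<open>H\<^sub>0\<^sup>1\<close>\<close>

lemma is_weak_deriv_iff:
  "is_weak_deriv f g \<longleftrightarrow> (\<forall>\<phi>. test_fun \<phi> \<longrightarrow>
      (\<integral>x. f x * deriv \<phi> x \<partial>leb01) = - (\<integral>x. g x * \<phi> x \<partial>leb01))"
  by (simp add: is_weak_deriv_def set_integral_leb01)

lemma continuous_on_bounded01:
  fixes f :: "real \<Rightarrow> real"
  assumes "continuous_on {0..1} f"
  obtains B where "\<And>x. x \<in> {0..1} \<Longrightarrow> \<bar>f x\<bar> \<le> B"
proof -
  have "bounded (f ` {0..1})"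
    by (intro compact_imp_bounded compact_continuous_image assms) auto
  then show ?thesis using that unfolding bounded_iff by (metis imageI real_norm_def)
qed

lemma smooth_L2D: "smooth f \<Longrightarrow> L2D f"
proof -
  assume f: "smooth f"
  obtain B where "\<And>x. x \<in> {0..1} \<Longrightarrow> \<bar>f x\<bar> \<le> B"
    using continuous_on_bounded01[OF smooth_continuous_on[OF f]] by blast
  then show ?thesis
    by (intro L2D_bounded[of f B] continuous_on_measurable_leb01 smooth_continuous_on f) auto
qed

lemma test_fun_L2D: "test_fun \<phi> \<Longrightarrow> L2D \<phi>"
  and test_fun_deriv_L2D: "test_fun \<phi> \<Longrightarrow> L2D (deriv \<phi>)"
  using smooth_L2D smooth_deriv(2) by (auto simp: test_fun_iff)

lemma test_fun_boundary:
  assumes "test_fun \<phi>" shows "\<phi> 0 = 0" "\<phi> 1 = 0"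
  using assms unfolding test_fun_iff by fastforce+

lemma test_fun_eq_prim:
  assumes "test_fun \<phi>" "x \<in> {0..1}" shows "\<phi> x = prim (deriv \<phi>) x"
  using prim_FTC[of \<phi> "{}" "deriv \<phi>" x] assms test_fun_boundary[OF assms(1)] test_fun_deriv_L2D[OF assms(1)]
  by (auto simp: test_fun_iff smooth_continuous_on smooth_deriv L2D_integrable)

lemma test_fun_deriv_integral:
  assumes "test_fun \<phi>" shows "integral\<^sup>L leb01 (deriv \<phi>) = 0"
  using test_fun_eq_prim[OF assms, of 1] test_fun_boundary[OF assms] prim_1[of 1 "deriv \<phi>"] by simp

lemma cutoff_integral_tendsto:
  assumes g: "integrable leb01 g" and cd: "0 \<le> c" "c < d" "d \<le> 1"
  shows "(\<lambda>n. \<integral>x. g x * cutoff c d n x \<partial>leb01) \<longlonglongrightarrow> (\<integral>x. g x * indicator {c<..<d} x \<partial>leb01)"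
proof (rule integral_dominated_convergence[where w="\<lambda>x. \<bar>g x\<bar>"])
  have m: "cutoff c d n \<in> borel_measurable leb01" for n
    using test_fun_L2D[OF test_fun_cutoff[OF cd]] L2D_measurable by blast
  show "(\<lambda>x. g x * cutoff c d n x) \<in> borel_measurable leb01" for n
    using g m by auto
  show "(\<lambda>x. g x * indicator {c<..<d} x) \<in> borel_measurable leb01"
    using integrable_indicator_mult[OF g, of "{c<..<d}"] by (simp add: mult.commute)
  show "AE x in leb01. (\<lambda>n. g x * cutoff c d n x) \<longlonglongrightarrow> g x * indicator {c<..<d} x"
    by (intro AE_I2 tendsto_intros cutoff_tendsto)
  show "AE x in leb01. norm (g x * cutoff c d n x) \<le> \<bar>g x\<bar>" for n
    by (intro AE_I2) (use cutoff_bounds in \<open>auto simp: abs_mult intro: mult_left_le\<close>)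
qed (use g in auto)

lemma AE_zero_if_test_integrals_zero:
  assumes g: "integrable leb01 g" and z: "\<And>\<phi>. test_fun \<phi> \<Longrightarrow> (\<integral>x. g x * \<phi> x \<partial>leb01) = 0"
  shows "AE x in leb01. g x = 0"
proof (rule AE_zero_if_interval_integrals_zero[OF g])
  fix c d :: real assume cd: "0 \<le> c" "c < d" "d \<le> 1"
  show "(\<integral>x. g x * indicator {c<..<d} x \<partial>leb01) = 0"
    using cutoff_integral_tendsto[OF g cd] z[OF test_fun_cutoff[OF cd]] by (simp add: LIMSEQ_const_iff)
qed

lemma weak_deriv_unique:
  assumes "L2D g" "L2D h" "is_weak_deriv f g" "is_weak_deriv f h"
  shows "AE x in leb01. g x = h x"
proof -
  have "AE x in leb01. g x - h x = 0"
  proof (rule AE_zero_if_test_integrals_zero)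
    show "integrable leb01 (\<lambda>x. g x - h x)" by (intro L2D_integrable L2D_diff assms)
    show "(\<integral>x. (g x - h x) * \<phi> x \<partial>leb01) = 0" if "test_fun \<phi>" for \<phi>
      using assms that test_fun_L2D[OF that] by (simp add: left_diff_distrib L2D_mult_integrable is_weak_deriv_iff)
  qed
  then show ?thesis by eventually_elim simp
qed

lemma wderiv_props:
  assumes "H1D f"
  shows "L2D (wderiv f)" "is_weak_deriv f (wderiv f)"
proof -
  have "\<exists>g. L2D g \<and> is_weak_deriv f g" using assms by (simp add: H1D_def)
  from someI_ex[OF this] show "L2D (wderiv f)" "is_weak_deriv f (wderiv f)"
    unfolding wderiv_def by auto
qed

lemma wderiv_AE_eq:
  assumes "L2D g" "is_weak_deriv f g"
  shows "L2D (wderiv f)" "AE x in leb01. wderiv f x = g x"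
proof -
  have "\<exists>g. L2D g \<and> is_weak_deriv f g" using assms by blast
  from someI_ex[OF this] have *: "L2D (wderiv f)" "is_weak_deriv f (wderiv f)"
    unfolding wderiv_def by auto
  then show "L2D (wderiv f)" "AE x in leb01. wderiv f x = g x"
    using weak_deriv_unique assms by blast+
qed

lemma is_weak_deriv_prim:
  assumes g: "L2D g" and f: "\<And>x. x \<in> D \<Longrightarrow> f x = prim g x"
  shows "is_weak_deriv f g"
  unfolding is_weak_deriv_iff
proof (intro allI impI)
  fix \<phi> assume \<phi>: "test_fun \<phi>"
  have "(\<integral>x. f x * deriv \<phi> x \<partial>leb01) = (\<integral>x. deriv \<phi> x * prim g x \<partial>leb01)"
    by (intro LINT_cong) (auto simp: f)
  also have "\<dots> = (\<integral>x. g x * (integral\<^sup>L leb01 (deriv \<phi>) - prim (deriv \<phi>) x) \<partial>leb01)"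
    using g \<phi> by (intro integral_prim_by_parts L2D_integrable test_fun_deriv_L2D)
  also have "\<dots> = (\<integral>x. - (g x * \<phi> x) \<partial>leb01)"
    using \<phi> by (intro LINT_cong)
      (auto simp: test_fun_deriv_integral test_fun_eq_prim[symmetric])
  finally show "(\<integral>x. f x * deriv \<phi> x \<partial>leb01) = - (\<integral>x. g x * \<phi> x \<partial>leb01)" by simp
qed

text \<open>Multiples of such a function correct the mean of a test function without leaving the
  class.\<close>

lemma test_fun_unit_integral: "\<exists>\<rho>. test_fun \<rho> \<and> integral\<^sup>L leb01 \<rho> = 1"
proof -
  have "(\<lambda>n. \<integral>x. 1 * cutoff 0 1 n x \<partial>leb01) \<longlonglongrightarrow> (\<integral>x. 1 * indicator D x \<partial>leb01)"
    by (rule cutoff_integral_tendsto) auto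
  moreover have "(\<integral>x. 1 * indicator D x \<partial>leb01) = (\<integral>x. 1 \<partial>leb01 :: real)"
    by (intro LINT_cong) auto
  ultimately have "(\<lambda>n. integral\<^sup>L leb01 (cutoff 0 1 n)) \<longlonglongrightarrow> 1" by simp
  then have "\<forall>\<^sub>F n in sequentially. integral\<^sup>L leb01 (cutoff 0 1 n) > 0" by (rule order_tendstoD) simp
  then obtain n where n: "integral\<^sup>L leb01 (cutoff 0 1 n) > 0" by (auto simp: eventually_sequentially)
  show ?thesis
    using n test_fun_cmult[OF test_fun_cutoff[of 0 1 n], of "1 / integral\<^sup>L leb01 (cutoff 0 1 n)"]
    by (intro exI[of _ "\<lambda>x. 1 / integral\<^sup>L leb01 (cutoff 0 1 n) * cutoff 0 1 n x"]) auto
qed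

text \<open>The primitive vanishes to the left of the support of \<psi> and is constant to the right
  of it. That constant is the integral of \<psi>, so mean zero is exactly what restores compact
  support.\<close>

lemma test_fun_antideriv:
  assumes \<psi>: "test_fun \<psi>" and z: "integral\<^sup>L leb01 \<psi> = 0"
  shows "\<exists>\<phi>. test_fun \<phi> \<and> deriv \<phi> = \<psi>"
proof -
  obtain a b where ab: "0 < a" "a \<le> b" "b < 1" "\<And>x. x \<notin> {a..b} \<Longrightarrow> \<psi> x = 0" and sm: "smooth \<psi>"
    using \<psi> unfolding test_fun_iff by metis
  \<comment> \<open>For negative x the interval is empty and the value is 0, so the definition is
    already right on the whole line.\<close>
  define \<phi> where "\<phi> x = integral {0..x} \<psi>" for x
  have low: "\<phi> x = 0" if "x < a" for x
    unfolding \<phi>_def by (intro integral_unique has_integral_is_0) (use ab that in auto)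
  have d: "(\<phi> has_real_derivative \<psi> x) (at x)" for x
  proof (cases "x > 0")
    case True
    have "((\<lambda>x. integral {0..x} \<psi>) has_real_derivative \<psi> x) (at x within {0..x+1})"
      using True by (intro integral_has_real_derivative smooth_continuous_on sm) auto
    moreover have "at x within {0..x+1} = at x"
      using True by (intro at_within_interior) auto
    ultimately show ?thesis by (simp add: \<phi>_def[abs_def])
  next
    case False
    then have "\<forall>\<^sub>F y in nhds x. y \<in> {..<a}" using ab by (intro eventually_nhds_in_open) auto
    then have "\<forall>\<^sub>F y in nhds x. \<phi> y = 0" by eventually_elim (auto simp: low)
    then show ?thesis using False ab by (subst DERIV_cong_ev[OF refl _ refl]) auto
  qed
  have "smooth \<phi>" by (rule smooth_antideriv[OF d sm])
  have "\<phi> 1 = \<phi> 0 + prim \<psi> 1"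
    using d smooth_continuous_on[OF \<open>smooth \<phi>\<close>] by (intro prim_FTC[of _ "{}"] L2D_integrable test_fun_L2D[OF \<psi>]) auto
  then have "\<phi> 1 = 0" using z low[of 0] ab by (simp add: prim_1)
  have high: "\<phi> x = 0" if "x > b" for x
  proof -
    have "\<phi> x = \<phi> 1"
    proof (rule DERIV_isconst3[of b "max x 1 + 1" x 1 \<phi>])
      show "(\<phi> has_real_derivative 0) (at y)" if "y \<in> {b<..<max x 1 + 1}" for y
        using d[of y] ab(4)[of y] that by simp
    qed (use that ab in auto)
    then show ?thesis using \<open>\<phi> 1 = 0\<close> by simp
  qed
  have "test_fun \<phi>" unfolding test_fun_iff
    using \<open>smooth \<phi>\<close> low high ab by (metis atLeastAtMost_iff not_le)
  moreover have "deriv \<phi> = \<psi>" using DERIV_imp_deriv[OF d] by auto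
  ultimately show ?thesis by blast
qed

text \<open>Derivatives of test functions are the test functions of mean zero. Subtracting a
  multiple of \<rho> brings an arbitrary \<psi> into this class, and the constant that appears is
  the \<rho>-weighted mean of \<open>g\<close>.\<close>

lemma du_Bois_Reymond:
  assumes g: "L2D g" and z: "\<And>\<phi>. test_fun \<phi> \<Longrightarrow> (\<integral>x. g x * deriv \<phi> x \<partial>leb01) = 0"
  shows "\<exists>c. AE x in leb01. g x = c"
proof -
  obtain \<rho> where \<rho>: "test_fun \<rho>" "integral\<^sup>L leb01 \<rho> = 1" using test_fun_unit_integral by blast
  define c where "c = (\<integral>x. g x * \<rho> x \<partial>leb01)"
  have "AE x in leb01. g x - c = 0"
  proof (rule AE_zero_if_test_integrals_zero)
    show "integrable leb01 (\<lambda>x. g x - c)" by (intro L2D_integrable L2D_diff g L2D_const)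
    fix \<psi> assume \<psi>: "test_fun \<psi>"
    define m where "m = integral\<^sup>L leb01 \<psi>"
    have i: "integrable leb01 \<psi>" "integrable leb01 \<rho>" using \<psi> \<rho> test_fun_L2D L2D_integrable by blast+
    have gi: "integrable leb01 (\<lambda>x. g x * \<psi> x)" "integrable leb01 (\<lambda>x. g x * \<rho> x)"
      using \<psi> \<rho> test_fun_L2D L2D_mult_integrable g by blast+
    have "test_fun (\<lambda>x. \<psi> x - m * \<rho> x)" by (intro test_fun_diff test_fun_cmult \<psi> \<rho>)
    moreover have "integral\<^sup>L leb01 (\<lambda>x. \<psi> x - m * \<rho> x) = 0"
      using i \<rho> by (simp add: m_def)
    ultimately obtain \<phi> where "test_fun \<phi>" "deriv \<phi> = (\<lambda>x. \<psi> x - m * \<rho> x)"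
      using test_fun_antideriv by blast
    from z[OF this(1)] this(2) have "(\<integral>x. g x * (\<psi> x - m * \<rho> x) \<partial>leb01) = 0" by simp
    also have "(\<lambda>x. g x * (\<psi> x - m * \<rho> x)) = (\<lambda>x. g x * \<psi> x - m * (g x * \<rho> x))"
      by (auto simp: algebra_simps)
    finally have "(\<integral>x. g x * \<psi> x \<partial>leb01) = m * c" using gi by (simp add: c_def)
    then show "(\<integral>x. (g x - c) * \<psi> x \<partial>leb01) = 0"
      using gi i by (simp add: left_diff_distrib m_def)
  qed
  then have "AE x in leb01. g x = c" by eventually_elim simp
  then show ?thesis by blast
qed

lemma L2D_prim: "L2D g \<Longrightarrow> L2D (prim g)"
  by (rule L2D_bounded[of _ "L2_norm g"])
     (use prim_abs_le[OF L2D_integrable] L1_le_L2_norm(1) prim_measurable in \<open>auto intro: order_trans\<close>)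

text \<open>The difference of \<open>f\<close> and \<open>prim g\<close> has weak derivative zero,
  hence is constant.\<close>

lemma weak_deriv_imp_prim:
  assumes f: "L2D f" and g: "L2D g" and w: "is_weak_deriv f g"
  shows "\<exists>c. AE x in leb01. f x = c + prim g x"
proof -
  note p = L2D_prim[OF g]
  have "is_weak_deriv (prim g) g" by (rule is_weak_deriv_prim[OF g]) simp
  then have "\<exists>c. AE x in leb01. f x - prim g x = c"
    using w L2D_mult_integrable[OF f test_fun_deriv_L2D] L2D_mult_integrable[OF p test_fun_deriv_L2D]
    by (intro du_Bois_Reymond L2D_diff f p) (simp add: left_diff_distrib is_weak_deriv_iff)
  then obtain c where "AE x in leb01. f x - prim g x = c" by blast
  then have "AE x in leb01. f x = c + prim g x" by eventually_elim simp
  then show ?thesis by blast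
qed

lemma H1_norm_ge:
  assumes "H1D f"
  shows "L2_norm f \<le> H1_norm f" "L2_norm (wderiv f) \<le> H1_norm f" "0 \<le> H1_norm f"
proof -
  have "H1_norm f = sqrt ((L2_norm f)^2 + (L2_norm (wderiv f))^2)"
    by (simp add: H1_norm_def L2_norm_power2 set_integral_leb01)
  then show "L2_norm f \<le> H1_norm f" "L2_norm (wderiv f) \<le> H1_norm f" "0 \<le> H1_norm f"
    by (auto intro!: real_le_rsqrt)
qed

text \<open>The one-dimensional Sobolev embedding. For the bound, F x = F y + (F x - F y) is
  averaged over y: the first part contributes at most the L2 norm of \<open>f\<close>, the
  oscillation at most that of \<open>wderiv f\<close>, and each is at most \<open>H1_norm f\<close>,
  whence the factor 2.\<close>

lemma H1D_representative:
  assumes "H1D f"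
  obtains F where "continuous_on {0..1} F" "AE x in leb01. f x = F x"
    "\<And>x. x \<in> {0..1} \<Longrightarrow> \<bar>F x\<bar> \<le> 2 * H1_norm f"
    "\<And>s t. F t - F s = prim (wderiv f) t - prim (wderiv f) s"
proof -
  have f: "L2D f" using assms by (simp add: H1D_def)
  note g = wderiv_props[OF assms]
  obtain c where c: "AE x in leb01. f x = c + prim (wderiv f) x"
    using weak_deriv_imp_prim[OF f g] by blast
  define F where "F x = c + prim (wderiv f) x" for x
  have cont: "continuous_on {0..1} F"
    unfolding F_def by (intro continuous_intros prim_continuous_on g)
  have F: "L2D F" unfolding F_def by (intro L2D_add L2D_const L2D_prim g)
  have "\<bar>F x\<bar> \<le> 2 * H1_norm f" for x
  proof -
    have "\<bar>F x\<bar> = \<bar>(\<integral>y. F x \<partial>leb01)\<bar>" by simp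
    also have "\<dots> = \<bar>(\<integral>y. F y + (F x - F y) \<partial>leb01)\<bar>" by simp
    also have "\<dots> \<le> (\<integral>y. \<bar>F y + (F x - F y)\<bar> \<partial>leb01)" by (rule integral_abs_bound)
    also have "\<dots> \<le> (\<integral>y. \<bar>F y\<bar> + L2_norm (wderiv f) \<partial>leb01)"
    proof (rule integral_mono)
      show "integrable leb01 (\<lambda>y. \<bar>F y\<bar> + L2_norm (wderiv f))"
        using L2D_integrable[OF F] by auto
      show "\<bar>F y + (F x - F y)\<bar> \<le> \<bar>F y\<bar> + L2_norm (wderiv f)" for y
        using prim_diff_abs_le[OF L2D_integrable[OF g(1)], of x y] L1_le_L2_norm(1)[OF g(1)]
        unfolding F_def by linarith
    qed simp
    also have "\<dots> = (\<integral>y. \<bar>F y\<bar> \<partial>leb01) + L2_norm (wderiv f)" using L2D_integrable[OF F] by simp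
    also have "\<dots> \<le> L2_norm F + L2_norm (wderiv f)" using L1_le_L2_norm(1)[OF F] by simp
    also have "L2_norm F = L2_norm f"
      using c L2D_measurable f F unfolding F_def by (intro L2_norm_cong_AE) auto
    finally show ?thesis using H1_norm_ge[OF assms] by linarith
  qed
  with that[of F] cont c show ?thesis by (auto simp: F_def)
qed

text \<open>\<open>H1_norm\<close> of a difference involves \<open>wderiv\<close> of the difference,
  an independently chosen representative; uniqueness almost everywhere makes it computable from the
  two derivatives.\<close>

lemma H1_norm_test_diff:
  assumes w: "L2D w" and g: "L2D g" "is_weak_deriv w g" and \<phi>: "test_fun \<phi>"
  shows "(H1_norm (\<lambda>x. \<phi> x - w x))^2 = (L2_norm (\<lambda>x. \<phi> x - w x))^2 + (L2_norm (\<lambda>x. deriv \<phi> x - g x))^2"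
proof -
  have wd: "is_weak_deriv \<phi> (deriv \<phi>)"
    by (rule is_weak_deriv_prim[OF test_fun_deriv_L2D[OF \<phi>]]) (use test_fun_eq_prim[OF \<phi>] in auto)
  have L: "L2D (\<lambda>x. deriv \<phi> x - g x)" by (intro L2D_diff test_fun_deriv_L2D \<phi> g)
  have "is_weak_deriv (\<lambda>x. \<phi> x - w x) (\<lambda>x. deriv \<phi> x - g x)"
    using wd g(2) L2D_mult_integrable[OF _ test_fun_L2D] L2D_mult_integrable[OF _ test_fun_deriv_L2D]
      test_fun_deriv_L2D[OF \<phi>] test_fun_L2D[OF \<phi>] g(1) w
    unfolding is_weak_deriv_iff by (simp add: left_diff_distrib)
  note * = wderiv_AE_eq[OF L this]
  have "L2_norm (wderiv (\<lambda>x. \<phi> x - w x)) = L2_norm (\<lambda>x. deriv \<phi> x - g x)"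
    by (intro L2_norm_cong_AE * L2D_measurable L)
  then show ?thesis
    by (simp add: H1_norm_def set_integral_leb01 flip: L2_norm_power2)
qed

text \<open>This extracts the zero boundary values from the closure. A test function has a
  derivative of mean zero and is the primitive of that derivative; both properties survive the
  limit, because the mean and \<open>prim\<close> are bounded in the L2 norm.\<close>

lemma H01D_imp_prim:
  assumes "H01D w"
  shows "integral\<^sup>L leb01 (wderiv w) = 0" "AE x in leb01. w x = prim (wderiv w) x"
proof -
  have H1: "H1D w" using assms by (simp add: H01D_def)
  have w: "L2D w" using H1 by (simp add: H1D_def)
  define g where "g = wderiv w"
  have g: "L2D g" "is_weak_deriv w g" using wderiv_props[OF H1] by (auto simp: g_def)
  obtain \<phi>s where t: "\<And>n. test_fun (\<phi>s n)" and lim: "(\<lambda>n. H1_norm (\<lambda>x. \<phi>s n x - w x)) \<longlonglongrightarrow> 0"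
    using assms by (auto simp: H01D_def)
  define \<epsilon> where "\<epsilon> n = H1_norm (\<lambda>x. \<phi>s n x - w x)" for n
  have \<epsilon>0: "\<epsilon> n \<ge> 0" for n unfolding \<epsilon>_def H1_norm_def by (auto simp: set_integral_leb01 integral_nonneg_AE)
  have d1: "L2_norm (\<lambda>x. \<phi>s n x - w x) \<le> \<epsilon> n" and d2: "L2_norm (\<lambda>x. deriv (\<phi>s n) x - g x) \<le> \<epsilon> n" for n
  proof -
    have *: "(\<epsilon> n)^2 = (L2_norm (\<lambda>x. \<phi>s n x - w x))^2 + (L2_norm (\<lambda>x. deriv (\<phi>s n) x - g x))^2"
      unfolding \<epsilon>_def by (rule H1_norm_test_diff[OF w g t])
    show "L2_norm (\<lambda>x. \<phi>s n x - w x) \<le> \<epsilon> n" "L2_norm (\<lambda>x. deriv (\<phi>s n) x - g x) \<le> \<epsilon> n"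
      by (rule power2_le_imp_le[OF _ \<epsilon>0], simp add: *)+
  qed
  have L: "L2D (\<lambda>x. deriv (\<phi>s n) x - g x)" for n by (intro L2D_diff test_fun_deriv_L2D t g)
  have "\<bar>integral\<^sup>L leb01 g\<bar> \<le> \<epsilon> n" for n
  proof -
    have "(\<integral>x. deriv (\<phi>s n) x - g x \<partial>leb01) = - integral\<^sup>L leb01 g"
      using test_fun_deriv_integral[OF t] L2D_integrable[OF test_fun_deriv_L2D[OF t]] L2D_integrable[OF g(1)] by simp
    then show ?thesis using L1_le_L2_norm(2)[OF L[of n]] d2[of n] by simp
  qed
  then have "\<bar>integral\<^sup>L leb01 g\<bar> \<le> 0"
    by (intro LIMSEQ_le_const[OF lim]) (auto simp: \<epsilon>_def)
  then show "integral\<^sup>L leb01 (wderiv w) = 0" by (simp add: g_def)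
  have "L2_norm (\<lambda>x. w x - prim g x) \<le> 2 * \<epsilon> n" for n
  proof -
    have "L2_norm (\<lambda>x. \<phi>s n x - prim g x) \<le> \<epsilon> n"
    proof (rule L2D_bounded)
      show "(\<lambda>x. \<phi>s n x - prim g x) \<in> borel_measurable leb01"
        by (intro L2D_measurable L2D_diff test_fun_L2D t L2D_prim g)
      fix x :: real assume "x \<in> D"
      then have "\<phi>s n x - prim g x = prim (\<lambda>x. deriv (\<phi>s n) x - g x) x"
        using test_fun_eq_prim[OF t, of x n]
        by (subst prim_minus) (auto intro: L2D_integrable test_fun_deriv_L2D t g)
      also have "\<bar>\<dots>\<bar> \<le> \<epsilon> n"
        using prim_abs_le[OF L2D_integrable[OF L]] L1_le_L2_norm(1)[OF L] d2 by (meson order_trans)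
      finally show "\<bar>\<phi>s n x - prim g x\<bar> \<le> \<epsilon> n" .
    qed
    moreover have "L2_norm (\<lambda>x. (\<phi>s n x - prim g x) - (\<phi>s n x - w x)) \<le> L2_norm (\<lambda>x. \<phi>s n x - prim g x) + L2_norm (\<lambda>x. \<phi>s n x - w x)"
      by (intro L2_norm_diff L2D_diff test_fun_L2D t L2D_prim g w)
    ultimately show ?thesis using d1[of n] by simp
  qed
  then have "L2_norm (\<lambda>x. w x - prim g x) \<le> 0"
    by (intro LIMSEQ_le_const[OF tendsto_mult_right_zero[OF lim, of 2]]) (auto simp: \<epsilon>_def)
  then have "AE x in leb01. w x - prim g x = 0"
    by (intro L2_norm_eq_0_AE L2D_diff w L2D_prim g) (simp add: antisym)
  then show "AE x in leb01. w x = prim (wderiv w) x" unfolding g_def[symmetric] by eventually_elim simp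
qed

section \<open>Functions that are L2 limits of test functions, and the primitives they provide in
  \<open>H01D\<close>\<close>

definition test_dense :: "(real \<Rightarrow> real) \<Rightarrow> bool" where
  "test_dense G \<longleftrightarrow> L2D G \<and> (\<forall>\<epsilon>>0. \<exists>\<psi>. test_fun \<psi> \<and> L2_norm (\<lambda>x. \<psi> x - G x) < \<epsilon>)"

text \<open>An approximation \<psi> of G need not have mean zero, so its primitive need not be a
  test function. Its mean m is at most the L2 distance of \<psi> and G, because G has mean zero, and
  subtracting m \<rho> repairs it at the cost of a factor 1 + R.\<close>

lemma H01D_prim:
  assumes G: "test_dense G" and z: "integral\<^sup>L leb01 G = 0"
    and w: "\<And>x. x \<in> D \<Longrightarrow> w x = prim G x"
  shows "H01D w" "AE x in leb01. wderiv w x = G x"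
proof -
  have L: "L2D G" using G by (simp add: test_dense_def)
  have wm: "w \<in> borel_measurable leb01"
    using measurable_cong[of leb01 w "prim G" borel] prim_measurable[OF L] w by auto
  have Lw: "L2D w" by (rule L2D_bound(1)[OF wm L2D_prim[OF L]]) (use w in auto)
  have wd: "is_weak_deriv w G" by (rule is_weak_deriv_prim[OF L w])
  show "AE x in leb01. wderiv w x = G x" by (rule wderiv_AE_eq(2)[OF L wd])
  obtain \<rho> where \<rho>: "test_fun \<rho>" "integral\<^sup>L leb01 \<rho> = 1" using test_fun_unit_integral by blast
  define R where "R = L2_norm \<rho>"
  have "\<exists>\<phi>. test_fun \<phi> \<and> H1_norm (\<lambda>x. \<phi> x - w x) < \<epsilon>" if "\<epsilon> > 0" for \<epsilon>
  proof -
    \<comment> \<open>The derivatives then differ by less than \<epsilon>/2. The functions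
      themselves differ by no more than the derivatives do, which uses the other half.\<close>
    define \<delta> where "\<delta> = (\<epsilon> / 2) / (1 + R)"
    have R: "R \<ge> 0" and \<delta>: "\<delta> > 0" using that by (auto simp: R_def \<delta>_def add_pos_nonneg)
    then obtain \<psi> where \<psi>: "test_fun \<psi>" "L2_norm (\<lambda>x. \<psi> x - G x) < \<delta>" using G by (auto simp: test_dense_def)
    define m where "m = integral\<^sup>L leb01 \<psi>"
    have LG: "L2D (\<lambda>x. \<psi> x - G x)" by (intro L2D_diff test_fun_L2D \<psi> L)
    have "m = (\<integral>x. \<psi> x - G x \<partial>leb01)"
      using z L2D_integrable[OF test_fun_L2D[OF \<psi>(1)]] L2D_integrable[OF L] by (simp add: m_def)
    then have m: "\<bar>m\<bar> < \<delta>" using L1_le_L2_norm(2)[OF LG] \<psi> by simp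
    have "test_fun (\<lambda>x. \<psi> x - m * \<rho> x)" by (intro test_fun_diff test_fun_cmult \<psi> \<rho>)
    moreover have "integral\<^sup>L leb01 (\<lambda>x. \<psi> x - m * \<rho> x) = 0"
      using \<rho> L2D_integrable[OF test_fun_L2D[OF \<psi>(1)]] L2D_integrable[OF test_fun_L2D[OF \<rho>(1)]] by (simp add: m_def)
    ultimately obtain \<phi> where \<phi>: "test_fun \<phi>" "deriv \<phi> = (\<lambda>x. \<psi> x - m * \<rho> x)"
      using test_fun_antideriv by blast
    have LD: "L2D (\<lambda>x. deriv \<phi> x - G x)" by (intro L2D_diff test_fun_deriv_L2D \<phi> L)
    have "L2_norm (\<lambda>x. (\<psi> x - G x) - m * \<rho> x) \<le> L2_norm (\<lambda>x. \<psi> x - G x) + L2_norm (\<lambda>x. m * \<rho> x)"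
      by (intro L2_norm_diff LG L2D_cmult test_fun_L2D \<rho>)
    also have "\<dots> < \<delta> + \<delta> * R"
      using \<psi>(2) m mult_right_mono[of "\<bar>m\<bar>" \<delta> R] R by (simp add: L2_norm_cmult R_def[symmetric])
    also have "\<delta> + \<delta> * R = \<delta> * (1 + R)" by (simp add: algebra_simps)
    also have "\<delta> * (1 + R) = \<epsilon> / 2"
    proof -
      have "1 + R \<noteq> 0" using R by linarith
      then show ?thesis unfolding \<delta>_def by (metis nonzero_eq_divide_eq)
    qed
    finally have n2: "L2_norm (\<lambda>x. deriv \<phi> x - G x) < \<epsilon> / 2"
      by (simp add: \<phi>(2) algebra_simps)
    have n1: "L2_norm (\<lambda>x. \<phi> x - w x) \<le> L2_norm (\<lambda>x. deriv \<phi> x - G x)"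
    proof (rule L2D_bounded)
      show "(\<lambda>x. \<phi> x - w x) \<in> borel_measurable leb01"
        by (intro L2D_measurable L2D_diff test_fun_L2D \<phi> Lw)
      fix x :: real assume "x \<in> D"
      then have "\<phi> x - w x = prim (\<lambda>x. deriv \<phi> x - G x) x"
        using test_fun_eq_prim[OF \<phi>(1), of x] w[of x]
        by (subst prim_minus) (auto intro: L2D_integrable test_fun_deriv_L2D \<phi> L)
      also have "\<bar>\<dots>\<bar> \<le> L2_norm (\<lambda>x. deriv \<phi> x - G x)"
        using prim_abs_le[OF L2D_integrable[OF LD]] L1_le_L2_norm(1)[OF LD] by (meson order_trans)
      finally show "\<bar>\<phi> x - w x\<bar> \<le> L2_norm (\<lambda>x. deriv \<phi> x - G x)" .
    qed
    have "(H1_norm (\<lambda>x. \<phi> x - w x))^2 \<le> (L2_norm (\<lambda>x. \<phi> x - w x) + L2_norm (\<lambda>x. deriv \<phi> x - G x))^2"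
      unfolding H1_norm_test_diff[OF Lw L wd \<phi>(1)] by (simp add: power2_sum)
    then have "H1_norm (\<lambda>x. \<phi> x - w x) \<le> L2_norm (\<lambda>x. \<phi> x - w x) + L2_norm (\<lambda>x. deriv \<phi> x - G x)"
      by (rule power2_le_imp_le) simp
    then show ?thesis using \<phi>(1) n1 n2 by (intro exI[of _ \<phi>]) auto
  qed
  then have "\<forall>n. \<exists>\<phi>. test_fun \<phi> \<and> H1_norm (\<lambda>x. \<phi> x - w x) < 1 / Suc n" by simp
  then obtain \<phi>s where \<phi>s: "\<And>n. test_fun (\<phi>s n)" "\<And>n. H1_norm (\<lambda>x. \<phi>s n x - w x) < 1 / Suc n" by metis
  have "(\<lambda>n. H1_norm (\<lambda>x. \<phi>s n x - w x)) \<longlonglongrightarrow> 0"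
  proof (rule tendsto_sandwich[OF always_eventually always_eventually])
    show "\<forall>n. 0 \<le> H1_norm (\<lambda>x. \<phi>s n x - w x)" by (auto simp: H1_norm_def set_integral_leb01)
    show "\<forall>n. H1_norm (\<lambda>x. \<phi>s n x - w x) \<le> 1 / Suc n" using \<phi>s(2) less_imp_le by blast
    show "(\<lambda>n. 1 / real (Suc n)) \<longlonglongrightarrow> 0" using LIMSEQ_inverse_real_of_nat by (simp add: divide_inverse)
  qed simp
  then show "H01D w"
    using Lw L wd \<phi>s(1) unfolding H01D_def H1D_def by blast
qed

lemma test_dense_smooth_indicator:
  assumes f: "smooth f" and cd: "0 \<le> c" "c < d" "d \<le> 1"
  shows "test_dense (\<lambda>x. f x * indicator {c<..<d} x)"
proof -
  let ?d = "\<lambda>n x. cutoff c d n x * f x - f x * indicator {c<..<d} x"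
  note fL = smooth_L2D[OF f]
  have im: "indicator {c<..<d} \<in> borel_measurable leb01" by (rule measurable_leb01) simp
  have L: "L2D (\<lambda>x. f x * indicator {c<..<d} x)"
    using L2D_mult_bounded[OF fL im, of 1] by (auto simp: indicator_def mult.commute)
  have t: "test_fun (\<lambda>x. cutoff c d n x * f x)" for n
    by (intro test_fun_mult_smooth test_fun_cutoff cd f)
  have "(\<lambda>n. (\<integral>x. (?d n x)^2 \<partial>leb01)) \<longlonglongrightarrow> (\<integral>x. 0 \<partial>leb01)"
  proof (rule integral_dominated_convergence[where w="\<lambda>x. (f x)^2"])
    show "integrable leb01 (\<lambda>x. (f x)^2)" using fL by (simp add: L2D_iff)
    show "(\<lambda>x. (?d n x)^2) \<in> borel_measurable leb01" for n
      using L2D_diff[OF test_fun_L2D[OF t[of n]] L] by (auto simp: L2D_iff)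
    show "AE x in leb01. (\<lambda>n. (?d n x)^2) \<longlonglongrightarrow> 0"
    proof (rule AE_I2)
      fix x
      have "(\<lambda>n. (?d n x)^2) \<longlonglongrightarrow> (indicator {c<..<d} x * f x - f x * indicator {c<..<d} x)^2"
        by (intro tendsto_intros cutoff_tendsto)
      then show "(\<lambda>n. (?d n x)^2) \<longlonglongrightarrow> 0" by simp
    qed
    show "AE x in leb01. norm ((?d n x)^2) \<le> (f x)^2" for n
    proof (rule AE_I2)
      fix x
      have "\<bar>cutoff c d n x - indicator {c<..<d} x\<bar> \<le> 1"
        using cutoff_bounds[of c d n x] by (auto simp: indicator_def)
      then have "(cutoff c d n x - indicator {c<..<d} x)^2 * (f x)^2 \<le> 1 * (f x)^2"
        by (intro mult_right_mono) (auto simp: abs_square_le_1)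
      then show "norm ((?d n x)^2) \<le> (f x)^2"
        by (simp add: power_mult_distrib[symmetric] algebra_simps)
    qed
  qed simp
  then have "(\<lambda>n. sqrt (\<integral>x. (?d n x)^2 \<partial>leb01)) \<longlonglongrightarrow> sqrt 0"
    by (intro tendsto_real_sqrt) simp
  then have lim: "(\<lambda>n. L2_norm (?d n)) \<longlonglongrightarrow> 0"
    by (simp add: L2_norm_eq)
  have "\<exists>\<psi>. test_fun \<psi> \<and> L2_norm (\<lambda>x. \<psi> x - f x * indicator {c<..<d} x) < \<epsilon>" if "\<epsilon> > 0" for \<epsilon>
    using order_tendstoD(2)[OF lim that] t by (auto simp: eventually_sequentially)
  with L show ?thesis by (simp add: test_dense_def)
qed

lemma test_dense_zero: "test_dense (\<lambda>_. 0)"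
  unfolding test_dense_def using test_fun_zero by (auto simp: L2D_const L2_norm_const intro!: exI[of _ "\<lambda>_. 0"])

lemma test_dense_add:
  assumes "test_dense F" "test_dense G"
  shows "test_dense (\<lambda>x. F x + G x)"
  unfolding test_dense_def
proof (intro conjI allI impI)
  have FG: "L2D F" "L2D G" using assms by (auto simp: test_dense_def)
  then show "L2D (\<lambda>x. F x + G x)" by (rule L2D_add)
  fix \<epsilon> :: real assume "\<epsilon> > 0"
  then have "\<epsilon> / 2 > 0" by simp
  then obtain \<phi> \<psi> where *: "test_fun \<phi>" "L2_norm (\<lambda>x. \<phi> x - F x) < \<epsilon> / 2" "test_fun \<psi>" "L2_norm (\<lambda>x. \<psi> x - G x) < \<epsilon> / 2"
    using assms unfolding test_dense_def by metis
  have "L2_norm (\<lambda>x. (\<phi> x - F x) + (\<psi> x - G x)) \<le> L2_norm (\<lambda>x. \<phi> x - F x) + L2_norm (\<lambda>x. \<psi> x - G x)"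
    by (intro L2_norm_add L2D_diff test_fun_L2D * FG)
  then show "\<exists>\<psi>. test_fun \<psi> \<and> L2_norm (\<lambda>x. \<psi> x - (F x + G x)) < \<epsilon>"
    using * test_fun_add[OF *(1,3)] by (intro exI[of _ "\<lambda>x. \<phi> x + \<psi> x"]) (auto simp: algebra_simps)
qed

lemma test_dense_sum: "finite A \<Longrightarrow> (\<And>i. i \<in> A \<Longrightarrow> test_dense (F i)) \<Longrightarrow> test_dense (\<lambda>x. \<Sum>i\<in>A. F i x)"
  by (induction A rule: finite_induct) (auto intro: test_dense_zero test_dense_add)

lemma test_dense_cong_AE:
  assumes F: "test_dense F" and AE: "AE x in leb01. F x = G x" and G: "L2D G"
  shows "test_dense G"
  unfolding test_dense_def
proof (intro conjI allI impI G)
  fix \<epsilon> :: real assume "\<epsilon> > 0"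
  then obtain \<psi> where \<psi>: "test_fun \<psi>" "L2_norm (\<lambda>x. \<psi> x - F x) < \<epsilon>" using F by (auto simp: test_dense_def)
  have FL: "L2D F" using F by (simp add: test_dense_def)
  have "L2_norm (\<lambda>x. \<psi> x - F x) = L2_norm (\<lambda>x. \<psi> x - G x)"
    using AE by (intro L2_norm_cong_AE L2D_measurable L2D_diff test_fun_L2D \<psi> FL G) auto
  with \<psi> show "\<exists>\<psi>. test_fun \<psi> \<and> L2_norm (\<lambda>x. \<psi> x - G x) < \<epsilon>" by auto
qed

text \<open>A polynomial that is uniformly close is smooth, so the cut-off argument with the full
  interval, whose indicator is 1 on \<open>D\<close>, applies to it.\<close>

lemma test_dense_continuous:
  assumes G: "continuous_on {0..1} G"
  shows "test_dense G"
  unfolding test_dense_def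
proof (intro conjI allI impI)
  obtain B where "\<And>x. x \<in> {0..1} \<Longrightarrow> \<bar>G x\<bar> \<le> B"
    using continuous_on_bounded01[OF G] by blast
  then show GL: "L2D G"
    by (intro L2D_bounded[of G B] continuous_on_measurable_leb01 G) auto
  fix \<epsilon> :: real assume \<epsilon>: "\<epsilon> > 0"
  then have \<epsilon>2: "\<epsilon> / 2 > 0" by simp
  obtain p where p: "real_polynomial_function p" "\<And>x. x \<in> {0..1} \<Longrightarrow> \<bar>G x - p x\<bar> < \<epsilon> / 2"
    using Stone_Weierstrass_real_polynomial_function[OF _ G \<epsilon>2] by auto
  obtain a n where an: "p = (\<lambda>x. \<Sum>i\<le>n. a i * x ^ i)"
    using p(1) real_polynomial_function_iff_sum by auto
  have sm: "smooth p"
  proof -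
    have "p = poly (\<Sum>i\<le>n. monom (a i) i)" by (auto simp: an poly_sum poly_monom fun_eq_iff)
    then show ?thesis using smooth_poly by simp
  qed
  have "test_dense (\<lambda>x. p x * indicator D x)"
    by (intro test_dense_smooth_indicator sm) auto
  then obtain \<psi> where \<psi>: "test_fun \<psi>" "L2_norm (\<lambda>x. \<psi> x - p x * indicator D x) < \<epsilon> / 2"
    using \<epsilon>2 unfolding test_dense_def by blast
  have pL: "L2D p" by (rule smooth_L2D[OF sm])
  have "L2_norm (\<lambda>x. \<psi> x - p x * indicator D x) = L2_norm (\<lambda>x. \<psi> x - p x)"
    unfolding L2_norm_eq by (intro arg_cong[where f=sqrt] LINT_cong) auto
  moreover have "L2_norm (\<lambda>x. G x - p x) \<le> \<epsilon> / 2"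
    by (rule L2D_bounded) (use p(2) in \<open>auto intro!: less_imp_le L2D_measurable L2D_diff GL pL\<close>)
  moreover have "L2_norm (\<lambda>x. (\<psi> x - p x) - (G x - p x)) \<le> L2_norm (\<lambda>x. \<psi> x - p x) + L2_norm (\<lambda>x. G x - p x)"
    by (intro L2_norm_diff L2D_diff test_fun_L2D \<psi> GL pL)
  ultimately show "\<exists>\<psi>. test_fun \<psi> \<and> L2_norm (\<lambda>x. \<psi> x - G x) < \<epsilon>"
    using \<psi> by (intro exI[of _ \<psi>]) auto
qed

section \<open>The Riemann-Liouville kernel\<close>

text \<open>The integrands to come may be unbounded at an endpoint. Nonnegativity turns gauge
  integrability, which the fundamental theorem delivers, into absolute integrability; Borel
  measurability then passes from the completed measure to \<open>lborel\<close>.\<close>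

lemma integral_nonneg_FTC:
  fixes f F :: "real \<Rightarrow> real"
  assumes ab: "0 \<le> a" "a \<le> b" "b \<le> 1" and F: "continuous_on {a..b} F"
    and d: "\<And>t. t \<in> {a<..<b} \<Longrightarrow> (F has_real_derivative f t) (at t)"
    and nn: "\<And>t. t \<in> {a<..<b} \<Longrightarrow> 0 \<le> f t" and m: "f \<in> borel_measurable borel"
  shows "integrable leb01 (\<lambda>t. indicator {a..<b} t * f t)"
    and "(\<integral>t. indicator {a..<b} t * f t \<partial>leb01) = F b - F a"
proof -
  have "(f has_integral (F b - F a)) {a..b}"
    using ab d by (intro fundamental_theorem_of_calculus_interior F)
      (auto simp: has_real_derivative_iff_has_vector_derivative[symmetric])
  then have I: "(f has_integral (F b - F a)) {a<..<b}"
    by (simp add: has_integral_Icc_iff_Ioo)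
  then have "f absolutely_integrable_on {a<..<b}"
    using nn by (intro nonnegative_absolutely_integrable_1) auto
  moreover have "(\<lambda>x. indicat_real {a<..<b} x *\<^sub>R f x) \<in> borel_measurable lborel"
    using m by auto
  ultimately have S: "set_integrable lborel {a<..<b} f"
    unfolding set_integrable_def by (subst (asm) integrable_completion) auto
  have AE: "AE t in lborel. indicator D t * (indicator {a..<b} t * f t) = indicator {a<..<b} t * f t"
    using AE_lborel_singleton[of a] by eventually_elim (use ab in \<open>auto simp: indicator_def\<close>)
  have "integrable lborel (\<lambda>t. indicator D t * (indicator {a..<b} t * f t))"
    using S AE m unfolding set_integrable_def by (subst integrable_cong_AE[where g="\<lambda>t. indicator {a<..<b} t * f t"]) auto
  then show "integrable leb01 (\<lambda>t. indicator {a..<b} t * f t)"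
    unfolding set_integrable_leb01_iff[symmetric] set_integrable_def by simp
  have "(\<integral>t. indicator {a..<b} t * f t \<partial>leb01) = (LINT t:{a<..<b}|lborel. f t)"
    unfolding set_integral_leb01[symmetric] set_lebesgue_integral_def real_scaleR_def
    using AE m by (intro integral_cong_AE) auto
  also have "\<dots> = F b - F a"
    using set_borel_integral_eq_integral(2)[OF S] I by (simp add: integral_unique)
  finally show "(\<integral>t. indicator {a..<b} t * f t \<partial>leb01) = F b - F a" .
qed

lemma integral_reflected_powr:
  fixes a b c e :: real
  assumes ab: "0 \<le> a" "a \<le> b" "b \<le> 1" "b \<le> c" and e: "e > -1"
  shows "integrable leb01 (\<lambda>t. indicator {a..<b} t * (c - t) powr e)"
    and "(\<integral>t. indicator {a..<b} t * (c - t) powr e \<partial>leb01) = ((c - a) powr (e + 1) - (c - b) powr (e + 1)) / (e + 1)"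
proof -
  define F where "F t = - ((c - t) powr (e + 1) / (e + 1))" for t
  have "continuous_on {a..b} F"
    unfolding F_def using ab e by (intro continuous_intros continuous_on_powr') auto
  moreover have "(F has_real_derivative (c - t) powr e) (at t)" if "t \<in> {a<..<b}" for t
    unfolding F_def using that ab e by (auto intro!: derivative_eq_intros simp: divide_simps)
  ultimately have *: "integrable leb01 (\<lambda>t. indicator {a..<b} t * (c - t) powr e)"
      "(\<integral>t. indicator {a..<b} t * (c - t) powr e \<partial>leb01) = F b - F a"
    using integral_nonneg_FTC[OF ab(1-3), of F "\<lambda>t. (c - t) powr e"] by auto
  show "integrable leb01 (\<lambda>t. indicator {a..<b} t * (c - t) powr e)" by (rule *)
  show "(\<integral>t. indicator {a..<b} t * (c - t) powr e \<partial>leb01) = ((c - a) powr (e + 1) - (c - b) powr (e + 1)) / (e + 1)"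
    unfolding *(2) F_def by (simp add: diff_divide_distrib)
qed

lemma integral_powr:
  fixes a b e :: real
  assumes ab: "0 \<le> a" "a \<le> b" "b \<le> 1" and e: "e > -1"
  shows "integrable leb01 (\<lambda>t. indicator {a..<b} t * t powr e)"
    and "(\<integral>t. indicator {a..<b} t * t powr e \<partial>leb01) = (b powr (e + 1) - a powr (e + 1)) / (e + 1)"
proof -
  define F where "F t = t powr (e + 1) / (e + 1)" for t
  have "continuous_on {a..b} F"
    unfolding F_def using ab e by (intro continuous_intros continuous_on_powr') auto
  moreover have "(F has_real_derivative t powr e) (at t)" if "t \<in> {a<..<b}" for t
    unfolding F_def using that ab e by (auto intro!: derivative_eq_intros simp: divide_simps)
  ultimately have *: "integrable leb01 (\<lambda>t. indicator {a..<b} t * t powr e)"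
      "(\<integral>t. indicator {a..<b} t * t powr e \<partial>leb01) = F b - F a"
    using integral_nonneg_FTC[OF ab(1-3), of F "\<lambda>t. t powr e"] by auto
  show "integrable leb01 (\<lambda>t. indicator {a..<b} t * t powr e)" by (rule *)
  show "(\<integral>t. indicator {a..<b} t * t powr e \<partial>leb01) = (b powr (e + 1) - a powr (e + 1)) / (e + 1)"
    unfolding *(2) F_def by (simp add: diff_divide_distrib)
qed

section \<open>The fractional integral of order \<alpha> - 1 on L2 and the L2 modulus of its
  kernel\<close>

locale frac_kernel =
  fixes \<alpha> :: real
  assumes \<alpha>: "3/2 < \<alpha>" "\<alpha> < 2"
begin

definition ker :: "real \<Rightarrow> real \<Rightarrow> real" where
  "ker x t = indicator {..<x} t * (x - t) powr (\<alpha> - 2)"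

definition Z :: "(real \<Rightarrow> real) \<Rightarrow> real \<Rightarrow> real" where
  "Z g x = (\<integral>t. ker x t * g t \<partial>leb01) / Gamma (\<alpha> - 1)"

text \<open>The exponent left after integrating the squared kernel, 2 (\<alpha> - 2) + 1. Its
  positivity is the condition \<alpha> > 3/2, and \<eta>/2 is the order in all kernel
  estimates.\<close>

definition \<eta> :: real where "\<eta> = 2 * \<alpha> - 3"

lemma \<eta>: "0 < \<eta>" "\<eta> < 1" using \<alpha> by (auto simp: \<eta>_def)

lemma sqrt_powr_eta: "sqrt (2 / \<eta> * h powr \<eta>) = sqrt (2 / \<eta>) * h powr (\<alpha> - 3/2)"
proof -
  have "sqrt (h powr \<eta>) = h powr (\<eta> / 2)"
    by (rule real_sqrt_unique) (simp_all add: power2_eq_square powr_add[symmetric])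
  moreover have "\<eta> / 2 = \<alpha> - 3/2" by (simp add: \<eta>_def)
  ultimately show ?thesis by (simp only: real_sqrt_mult)
qed

lemma Gamma_pos: "0 < Gamma (\<alpha> - 1)"
  using \<alpha> by (intro Gamma_real_pos) auto

lemma frac_int_eq_Z:
  assumes "x \<le> 1" shows "frac_int (\<alpha> - 1) g x = Z g x"
proof -
  have "(LINT t:{0<..<x}|lborel. (x - t) powr (\<alpha> - 1 - 1) * g t) = (\<integral>t. ker x t * g t \<partial>leb01)"
    unfolding set_integral_leb01[symmetric] set_lebesgue_integral_def ker_def
    using assms by (intro LINT_cong) (auto simp: indicator_def)
  then show ?thesis by (simp add: frac_int_def Z_def)
qed

lemma ker_measurable: "ker x \<in> borel_measurable leb01"
  unfolding ker_def[abs_def] by (intro measurable_leb01) measurable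

lemma ker_nonneg: "0 \<le> ker x t"
  by (simp add: ker_def)

lemma ker_square: "(ker x t)^2 = indicator {..<x} t * (x - t) powr (2 * \<alpha> - 4)"
proof -
  have "((x - t) powr (\<alpha> - 2))^2 = (x - t) powr (2 * \<alpha> - 4)"
    by (simp add: power2_eq_square powr_add[symmetric])
  then show ?thesis by (auto simp: ker_def power_mult_distrib indicator_def)
qed

lemma ker_square_integral:
  assumes "0 \<le> a" "a \<le> b" "b \<le> 1" "b \<le> x"
  shows "integrable leb01 (\<lambda>t. indicator {a..<b} t * (ker x t)^2)"
    and "(\<integral>t. indicator {a..<b} t * (ker x t)^2 \<partial>leb01) = ((x - a) powr \<eta> - (x - b) powr \<eta>) / \<eta>"
proof -
  have eq: "(\<lambda>t. indicator {a..<b} t * (ker x t)^2) = (\<lambda>t. indicator {a..<b} t * (x - t) powr (2 * \<alpha> - 4))"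
    using assms by (auto simp: ker_square indicator_def fun_eq_iff)
  have e: "2 * \<alpha> - 4 > -1" using \<alpha> by simp
  have e1: "2 * \<alpha> - 4 + 1 = \<eta>" by (simp add: \<eta>_def)
  show "integrable leb01 (\<lambda>t. indicator {a..<b} t * (ker x t)^2)"
    unfolding eq using integral_reflected_powr(1)[OF assms e] .
  show "(\<integral>t. indicator {a..<b} t * (ker x t)^2 \<partial>leb01) = ((x - a) powr \<eta> - (x - b) powr \<eta>) / \<eta>"
    unfolding eq using integral_reflected_powr(2)[OF assms e] unfolding e1 .
qed

lemma ker_L2D:
  assumes "0 \<le> x" "x \<le> 1"
  shows "L2D (ker x)" "L2_norm (ker x) \<le> 1 / sqrt \<eta>"
proof -
  have eq: "(\<lambda>t. indicator {0..<x} t * (ker x t)^2) t = (ker x t)^2" if "t \<in> D" for t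
    using that by (auto simp: ker_def indicator_def)
  have "integrable leb01 (\<lambda>t. (ker x t)^2)"
    using ker_square_integral(1)[of 0 x x] assms eq
    by (subst Bochner_Integration.integrable_cong[OF refl, of _ _ "\<lambda>t. indicator {0..<x} t * (ker x t)^2"]) auto
  then show "L2D (ker x)" using ker_measurable by (simp add: L2D_iff)
  have "(\<integral>t. (ker x t)^2 \<partial>leb01) = (\<integral>t. indicator {0..<x} t * (ker x t)^2 \<partial>leb01)"
    using eq by (intro LINT_cong) auto
  also have "\<dots> = x powr \<eta> / \<eta>"
    using ker_square_integral(2)[of 0 x x] assms \<eta> by simp
  also have "\<dots> \<le> 1 / \<eta>"
    using assms \<eta> by (intro divide_right_mono powr_le1) auto
  finally show "L2_norm (ker x) \<le> 1 / sqrt \<eta>"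
    unfolding L2_norm_eq by (metis real_sqrt_divide real_sqrt_le_mono real_sqrt_one)
qed

text \<open>The integrand is at most \<open>(ker y t)\<^sup>2 - (ker (y + h) t)\<^sup>2\<close>, whose integral telescopes.\<close>

lemma ker_shift_integral:
  assumes y: "0 \<le> y" "y \<le> 1" and h: "0 \<le> h"
  shows "integrable leb01 (\<lambda>t. indicator {..<y} t * (ker y t - ker (y + h) t)^2)"
    and "(\<integral>t. indicator {..<y} t * (ker y t - ker (y + h) t)^2 \<partial>leb01) \<le> h powr \<eta> / \<eta>"
proof -
  let ?R = "\<lambda>t. indicator {0..<y} t * (ker y t)^2 - indicator {0..<y} t * (ker (y + h) t)^2"
  have le: "indicator {..<y} t * (ker y t - ker (y + h) t)^2 \<le> ?R t" if t: "t \<in> D" for t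
  proof (cases "t < y")
    case True
    have "(y + h - t) powr (\<alpha> - 2) \<le> (y - t) powr (\<alpha> - 2)"
      using True h \<alpha> by (intro powr_mono2') auto
    then have A: "ker (y + h) t \<le> ker y t" using True h by (simp add: ker_def)
    have "(ker y t - ker (y + h) t)^2 \<le> (ker y t)^2 - (ker (y + h) t)^2"
      using mult_left_mono[OF A ker_nonneg[of "y + h" t]] by (simp add: power2_eq_square algebra_simps)
    then show ?thesis using True t by simp
  qed auto
  have R: "integrable leb01 ?R"
    using y h by (intro Bochner_Integration.integrable_diff ker_square_integral) auto
  show I: "integrable leb01 (\<lambda>t. indicator {..<y} t * (ker y t - ker (y + h) t)^2)"
  proof (rule Bochner_Integration.integrable_bound[OF R])
    have "indicator {..<y} \<in> borel_measurable leb01" by (rule measurable_leb01) simp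
    then show "(\<lambda>t. indicator {..<y} t * (ker y t - ker (y + h) t)^2) \<in> borel_measurable leb01"
      using ker_measurable[of y] ker_measurable[of "y + h"] by measurable
    show "AE t in leb01. norm (indicator {..<y} t * (ker y t - ker (y + h) t)^2) \<le> norm (?R t)"
    proof (rule AE_I2)
      fix t assume "t \<in> space leb01"
      then have "indicator {..<y} t * (ker y t - ker (y + h) t)^2 \<le> ?R t" using le by simp
      moreover have "0 \<le> indicator {..<y} t * (ker y t - ker (y + h) t)^2" by simp
      ultimately show "norm (indicator {..<y} t * (ker y t - ker (y + h) t)^2) \<le> norm (?R t)"
        unfolding real_norm_def by linarith
    qed
  qed
  have "(\<integral>t. indicator {..<y} t * (ker y t - ker (y + h) t)^2 \<partial>leb01) \<le> integral\<^sup>L leb01 ?R"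
    using le by (intro integral_mono I R) auto
  also have "\<dots> = (y powr \<eta> - 0 powr \<eta>) / \<eta> - ((y + h) powr \<eta> - h powr \<eta>) / \<eta>"
    using y h ker_square_integral[of 0 y y] ker_square_integral[of 0 y "y + h"] by simp
  also have "\<dots> \<le> h powr \<eta> / \<eta>"
    using powr_mono2[of \<eta> y "y + h"] y h \<eta> by (simp add: field_simps)
  finally show "(\<integral>t. indicator {..<y} t * (ker y t - ker (y + h) t)^2 \<partial>leb01) \<le> h powr \<eta> / \<eta>" .
qed

text \<open>Counterpart of the shift bound on the window of width h next to the singularity, where
  the kernel is not compared with a shifted copy but dropped altogether.\<close>

lemma ker_tail_integral:
  assumes y: "0 \<le> y" "y \<le> 1" and h: "0 \<le> h"
  shows "integrable leb01 (\<lambda>t. indicator {y - h..<y} t * (ker y t)^2)"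
    and "(\<integral>t. indicator {y - h..<y} t * (ker y t)^2 \<partial>leb01) \<le> h powr \<eta> / \<eta>"
proof -
  define a where "a = max 0 (y - h)"
  have eq: "indicator {y - h..<y} t * (ker y t)^2 = indicator {a..<y} t * (ker y t)^2" if "t \<in> D" for t
    using that by (auto simp: a_def indicator_def)
  have a: "0 \<le> a" "a \<le> y" "y - a \<le> h" using y h by (auto simp: a_def)
  show "integrable leb01 (\<lambda>t. indicator {y - h..<y} t * (ker y t)^2)"
    using ker_square_integral(1)[of a y y] a y eq
    by (subst Bochner_Integration.integrable_cong[OF refl, of _ _ "\<lambda>t. indicator {a..<y} t * (ker y t)^2"]) auto
  have "(\<integral>t. indicator {y - h..<y} t * (ker y t)^2 \<partial>leb01) = (\<integral>t. indicator {a..<y} t * (ker y t)^2 \<partial>leb01)"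
    using eq by (intro LINT_cong) auto
  also have "\<dots> = (y - a) powr \<eta> / \<eta>"
    using ker_square_integral(2)[of a y y] a y \<eta> by simp
  also have "\<dots> \<le> h powr \<eta> / \<eta>"
    using a y \<eta> by (intro divide_right_mono powr_mono2) auto
  finally show "(\<integral>t. indicator {y - h..<y} t * (ker y t)^2 \<partial>leb01) \<le> h powr \<eta> / \<eta>" .
qed

text \<open>Piecewise constant approximations of \<open>ker y\<close> on a mesh of width \<open>h\<close> satisfy the hypothesis:
  away from the singularity they take the value at the left end of the cell, and they vanish on the
  cell containing \<open>y\<close>.\<close>

lemma ker_approx_norm:
  assumes y: "0 \<le> y" "y \<le> 1" and h: "0 \<le> h" and s: "s \<in> borel_measurable leb01"
    and b: "\<And>t. t \<in> D \<Longrightarrow> \<bar>ker y t - s t\<bar> \<le> indicator {..<y} t * \<bar>ker y t - ker (y + h) t\<bar>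
       \<or> \<bar>ker y t - s t\<bar> \<le> indicator {y - h..<y} t * ker y t"
  shows "L2_norm (\<lambda>t. ker y t - s t) \<le> sqrt (2 / \<eta>) * h powr (\<alpha> - 3/2)"
proof -
  let ?R = "\<lambda>t. indicator {..<y} t * (ker y t - ker (y + h) t)^2 + indicator {y - h..<y} t * (ker y t)^2"
  have R: "integrable leb01 ?R"
    using ker_shift_integral(1)[OF y h] ker_tail_integral(1)[OF y h] by simp
  have le: "(ker y t - s t)^2 \<le> ?R t" if "t \<in> D" for t
    using b[OF that]
  proof
    assume "\<bar>ker y t - s t\<bar> \<le> indicator {..<y} t * \<bar>ker y t - ker (y + h) t\<bar>"
    then have "\<bar>ker y t - s t\<bar>^2 \<le> (indicator {..<y} t * \<bar>ker y t - ker (y + h) t\<bar>)^2"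
      by (intro power_mono) auto
    also have "\<dots> = indicator {..<y} t * (ker y t - ker (y + h) t)^2" by (auto simp: indicator_def)
    finally show ?thesis by (simp add: add_increasing2)
  next
    assume "\<bar>ker y t - s t\<bar> \<le> indicator {y - h..<y} t * ker y t"
    then have "\<bar>ker y t - s t\<bar>^2 \<le> (indicator {y - h..<y} t * ker y t)^2"
      by (intro power_mono) auto
    also have "\<dots> = indicator {y - h..<y} t * (ker y t)^2" by (auto simp: indicator_def)
    finally show ?thesis by (simp add: add_increasing)
  qed
  have I: "integrable leb01 (\<lambda>t. (ker y t - s t)^2)"
    by (rule Bochner_Integration.integrable_bound[OF R])
       (use le s ker_measurable[of y] in \<open>auto intro!: AE_I2 order_trans[OF _ abs_ge_self]\<close>)
  have "(\<integral>t. (ker y t - s t)^2 \<partial>leb01) \<le> integral\<^sup>L leb01 ?R"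
    using le by (intro integral_mono I R) auto
  also have "\<dots> \<le> 2 / \<eta> * h powr \<eta>"
    using ker_shift_integral[OF y h] ker_tail_integral[OF y h] by simp
  finally have "L2_norm (\<lambda>t. ker y t - s t) \<le> sqrt (2 / \<eta> * h powr \<eta>)"
    unfolding L2_norm_eq by (rule real_sqrt_le_mono)
  also have "\<dots> = sqrt (2 / \<eta>) * h powr (\<alpha> - 3/2)"
    by (rule sqrt_powr_eta)
  finally show ?thesis .
qed

text \<open>Below y the two kernels differ by a shift of x - y; between y and x only
  \<open>ker x\<close> remains, on a window of the same width. This yields Hoelder continuity of
  \<open>Z g\<close> with exponent \<alpha> - 3/2.\<close>

lemma ker_diff_norm:
  assumes "0 \<le> y" "y \<le> x" "x \<le> 1"
  shows "L2_norm (\<lambda>t. ker x t - ker y t) \<le> sqrt (2 / \<eta>) * (x - y) powr (\<alpha> - 3/2)"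
proof -
  let ?h = "x - y"
  let ?R = "\<lambda>t. indicator {..<y} t * (ker y t - ker (y + ?h) t)^2 + indicator {x - ?h..<x} t * (ker x t)^2"
  have R: "integrable leb01 ?R"
    using ker_shift_integral(1)[of y ?h] ker_tail_integral(1)[of x ?h] assms by simp
  have le: "(ker x t - ker y t)^2 \<le> ?R t" for t
    using assms by (auto simp: ker_def indicator_def power2_commute)
  have I: "integrable leb01 (\<lambda>t. (ker x t - ker y t)^2)"
    by (rule Bochner_Integration.integrable_bound[OF R])
       (use le ker_measurable[of y] ker_measurable[of x] in \<open>auto intro!: AE_I2 order_trans[OF _ abs_ge_self]\<close>)
  have "(\<integral>t. (ker x t - ker y t)^2 \<partial>leb01) \<le> integral\<^sup>L leb01 ?R"
    using le by (intro integral_mono I R) auto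
  also have "\<dots> \<le> 2 / \<eta> * ?h powr \<eta>"
    using ker_shift_integral[of y ?h] ker_tail_integral[of x ?h] assms by simp
  finally have "L2_norm (\<lambda>t. ker x t - ker y t) \<le> sqrt (2 / \<eta> * ?h powr \<eta>)"
    unfolding L2_norm_eq by (rule real_sqrt_le_mono)
  also have "\<dots> = sqrt (2 / \<eta>) * ?h powr (\<alpha> - 3/2)"
    by (rule sqrt_powr_eta)
  finally show ?thesis .
qed

definition CZ :: real where "CZ = 1 / (sqrt \<eta> * Gamma (\<alpha> - 1))"

lemma CZ_pos: "0 < CZ" using \<eta> Gamma_pos by (simp add: CZ_def)

lemma Z_bound:
  assumes g: "L2D g" and x: "0 \<le> x" "x \<le> 1"
  shows "\<bar>Z g x\<bar> \<le> CZ * L2_norm g"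
proof -
  have "\<bar>\<integral>t. ker x t * g t \<partial>leb01\<bar> \<le> L2_norm (ker x) * L2_norm g"
    by (intro L2_Cauchy_Schwarz ker_L2D x g)
  also have "\<dots> \<le> (1 / sqrt \<eta>) * L2_norm g"
    by (intro mult_right_mono ker_L2D x) simp
  finally show ?thesis
    using Gamma_pos \<eta> unfolding Z_def CZ_def by (simp add: abs_divide field_simps)
qed

lemma Z_add:
  assumes "L2D f" "L2D g" "0 \<le> x" "x \<le> 1"
  shows "Z (\<lambda>t. f t + g t) x = Z f x + Z g x"
  using L2D_mult_integrable[OF ker_L2D(1)[OF assms(3,4)]] assms
  by (simp add: Z_def distrib_left add_divide_distrib)

lemma Z_diff:
  assumes "L2D f" "L2D g" "0 \<le> x" "x \<le> 1"
  shows "Z (\<lambda>t. f t - g t) x = Z f x - Z g x"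
  using L2D_mult_integrable[OF ker_L2D(1)[OF assms(3,4)]] assms
  by (simp add: Z_def right_diff_distrib diff_divide_distrib)

lemma Z_cmult: "Z (\<lambda>t. c * g t) x = c * Z g x"
proof -
  have "(\<lambda>t. ker x t * (c * g t)) = (\<lambda>t. c * (ker x t * g t))" by (simp add: ac_simps)
  then show ?thesis by (simp add: Z_def)
qed

lemma Z_cong_AE:
  assumes "AE t in leb01. f t = g t" "L2D f" "L2D g"
  shows "Z f x = Z g x"
  unfolding Z_def using assms ker_measurable[of x]
  by (intro arg_cong2[where f="(/)"] integral_cong_AE) (auto simp: L2D_iff)

lemma Z_continuous_on:
  assumes g: "L2D g"
  shows "continuous_on {0..1} (Z g)"
proof -
  define C where "C = sqrt (2 / \<eta>) * L2_norm g / Gamma (\<alpha> - 1)"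
  have H: "\<bar>Z g t - Z g s\<bar> \<le> C * \<bar>t - s\<bar> powr (\<alpha> - 3/2)" if "s \<in> {0..1}" "t \<in> {0..1}" for s t
    using that
  proof (induction s t rule: linorder_wlog)
    case (le s t)
    note k = ker_L2D(1)[of s] ker_L2D(1)[of t]
    have "Z g t - Z g s = (\<integral>r. (ker t r - ker s r) * g r \<partial>leb01) / Gamma (\<alpha> - 1)"
      using L2D_mult_integrable[OF k(1) g] L2D_mult_integrable[OF k(2) g] le
      by (simp add: Z_def left_diff_distrib diff_divide_distrib)
    also have "\<bar>\<dots>\<bar> \<le> L2_norm (\<lambda>r. ker t r - ker s r) * L2_norm g / Gamma (\<alpha> - 1)"
      using L2_Cauchy_Schwarz[OF L2D_diff[OF k(2,1)] g] Gamma_pos le by (simp add: abs_divide divide_right_mono)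
    also have "\<dots> \<le> (sqrt (2 / \<eta>) * (t - s) powr (\<alpha> - 3/2)) * L2_norm g / Gamma (\<alpha> - 1)"
      using Gamma_pos le by (intro divide_right_mono mult_right_mono ker_diff_norm) auto
    finally show ?case using le by (simp add: C_def algebra_simps)
  qed (simp add: abs_minus_commute)
  show ?thesis unfolding continuous_on_def
  proof
    fix s :: real assume s: "s \<in> {0..1}"
    have "((\<lambda>t. C * \<bar>t - s\<bar> powr (\<alpha> - 3/2)) \<longlongrightarrow> C * \<bar>s - s\<bar> powr (\<alpha> - 3/2)) (at s within {0..1})"
      using \<alpha> by (intro tendsto_intros tendsto_powr') auto
    then have lim: "((\<lambda>t. C * \<bar>t - s\<bar> powr (\<alpha> - 3/2)) \<longlongrightarrow> 0) (at s within {0..1})" by simp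
    have "\<forall>\<^sub>F t in at s within {0..1}. norm (Z g t - Z g s) \<le> C * \<bar>t - s\<bar> powr (\<alpha> - 3/2)"
      unfolding eventually_at_filter real_norm_def using H[OF s] by (intro always_eventually) blast
    then have "((\<lambda>t. Z g t - Z g s) \<longlongrightarrow> 0) (at s within {0..1})"
      using lim by (rule Lim_null_comparison)
    then show "(Z g \<longlongrightarrow> Z g s) (at s within {0..1})"
      by (simp add: LIM_zero_iff)
  qed
qed

text \<open>For \<open>g = c + prim m\<close>, integration by parts moves the derivative onto the kernel:
  \<open>Z g x\<close> is a multiple of \<open>c x\<^sup>\<alpha>\<^sup>-\<^sup>1 + \<integral> (x - t)\<^sup>\<alpha>\<^sup>-\<^sup>1 m t\<close>.\<close>

lemma Z_regularity:
  assumes g: "\<And>x. x \<in> D \<Longrightarrow> g x = c + prim m x"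
    and c: "\<bar>c\<bar> \<le> L" and m: "m \<in> borel_measurable leb01" "\<And>x. x \<in> D \<Longrightarrow> \<bar>m x\<bar> \<le> L"
    and st: "0 \<le> s" "s \<le> t" "t \<le> 1"
  shows "\<bar>Z g t - Z g s\<bar> \<le> L / ((\<alpha> - 1) * Gamma (\<alpha> - 1)) * ((t powr (\<alpha> - 1) - s powr (\<alpha> - 1)) + (t powr \<alpha> - s powr \<alpha>) / \<alpha>)"
proof -
  \<comment> \<open>Up to the factor \<alpha> - 1 this is the integral of \<open>ker x\<close> from
    y on. It increases with x, so the difference for t and s can be integrated without absolute
    values, which gives increments of powers.\<close>
  define K where "K x y = indicator {..<x} y * (x - y) powr (\<alpha> - 1)" for x y :: real
  note mL = L2D_bounded(1)[OF m]
  note mi = L2D_integrable[OF mL]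
  have K_meas: "K x \<in> borel_measurable leb01" for x
    unfolding K_def[abs_def] by (intro measurable_leb01) measurable
  have K_le: "\<bar>K x y\<bar> \<le> 1" if "x \<le> 1" "y \<in> D" for x y
    using that \<alpha> by (auto simp: K_def indicator_def intro!: powr_le1)
  have Kint: "(\<integral>y. K x y \<partial>leb01) = x powr \<alpha> / \<alpha>" "integrable leb01 (K x)" if x: "0 \<le> x" "x \<le> 1" for x
  proof -
    have eq: "K x y = indicator {0..<x} y * (x - y) powr (\<alpha> - 1)" if "y \<in> D" for y
      using that by (auto simp: K_def indicator_def)
    have "(\<integral>y. K x y \<partial>leb01) = (\<integral>y. indicator {0..<x} y * (x - y) powr (\<alpha> - 1) \<partial>leb01)"
      using eq by (intro LINT_cong) auto
    then show "(\<integral>y. K x y \<partial>leb01) = x powr \<alpha> / \<alpha>"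
      using integral_reflected_powr(2)[of 0 x x "\<alpha> - 1"] x \<alpha> by simp
    show "integrable leb01 (K x)"
      using K_meas K_le[OF x(2)] by (intro L2D_integrable L2D_bounded[of _ 1]) auto
  qed
  have Zg: "Z g x = (c * x powr (\<alpha> - 1) + (\<integral>y. m y * K x y \<partial>leb01)) / ((\<alpha> - 1) * Gamma (\<alpha> - 1))"
    if x: "0 \<le> x" "x \<le> 1" for x
  proof -
    have e: "\<alpha> - 2 > -1" using \<alpha> by simp
    have e1: "\<alpha> - 2 + 1 = \<alpha> - 1" by simp
    have ki: "integrable leb01 (ker x)" by (intro L2D_integrable ker_L2D x)
    have tail: "(\<integral>t. ker x t \<partial>leb01) - prim (ker x) y = K x y / (\<alpha> - 1)" if y: "y \<in> {0..1}" for y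
    proof -
      have "(\<integral>t. ker x t \<partial>leb01) - prim (ker x) y = (\<integral>t. indicator {y..<1} t * ker x t \<partial>leb01)"
        using prim_diff[OF ki, of y 1] y prim_1[of 1 "ker x"] by simp
      also have "\<dots> = (\<integral>t. indicator {min x y..<x} t * (x - t) powr (\<alpha> - 2) \<partial>leb01)"
        using x y by (intro LINT_cong) (auto simp: ker_def indicator_def)
      also have "\<dots> = (x - min x y) powr (\<alpha> - 1) / (\<alpha> - 1)"
        using integral_reflected_powr(2)[of "min x y" x x "\<alpha> - 2"] x y e \<alpha> unfolding e1 by simp
      also have "\<dots> = K x y / (\<alpha> - 1)" by (auto simp: K_def min_def)
      finally show ?thesis .
    qed
    have k0: "(\<integral>t. ker x t \<partial>leb01) = x powr (\<alpha> - 1) / (\<alpha> - 1)"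
      using tail[of 0] x by (auto simp: prim_0 K_def indicator_def)
    have "(\<integral>y. ker x y * g y \<partial>leb01) = (\<integral>y. c * ker x y + ker x y * prim m y \<partial>leb01)"
      by (intro LINT_cong) (auto simp: g algebra_simps)
    also have "\<dots> = c * (\<integral>y. ker x y \<partial>leb01) + (\<integral>y. ker x y * prim m y \<partial>leb01)"
      using ki L2D_mult_integrable[OF ker_L2D(1)[OF x] L2D_prim[OF mL]] by simp
    also have "(\<integral>y. ker x y * prim m y \<partial>leb01) = (\<integral>y. m y * ((\<integral>t. ker x t \<partial>leb01) - prim (ker x) y) \<partial>leb01)"
      by (rule integral_prim_by_parts[OF ki mi])
    also have "\<dots> = (\<integral>y. m y * K x y / (\<alpha> - 1) \<partial>leb01)"
      by (intro LINT_cong) (auto simp: tail)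
    also have "\<dots> = (\<integral>y. m y * K x y \<partial>leb01) / (\<alpha> - 1)" by simp
    finally show ?thesis
      by (simp only: Z_def k0 times_divide_eq_right add_divide_distrib[symmetric] divide_divide_eq_left)
  qed
  have mK: "integrable leb01 (\<lambda>y. m y * K x y)" if "0 \<le> x" "x \<le> 1" for x
    using L2D_mult_bounded[OF mL K_meas K_le[OF that(2)]] by (auto simp: mult.commute intro: L2D_integrable)
  have Kmono: "K s y \<le> K t y" for y
    using st \<alpha> by (auto simp: K_def indicator_def intro!: powr_mono2)
  have "\<bar>(\<integral>y. m y * K t y \<partial>leb01) - (\<integral>y. m y * K s y \<partial>leb01)\<bar> = \<bar>\<integral>y. m y * (K t y - K s y) \<partial>leb01\<bar>"
    using mK[of s] mK[of t] st by (simp add: right_diff_distrib)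
  also have "\<dots> \<le> (\<integral>y. \<bar>m y * (K t y - K s y)\<bar> \<partial>leb01)" by (rule integral_abs_bound)
  also have "\<dots> \<le> (\<integral>y. L * (K t y - K s y) \<partial>leb01)"
  proof (rule integral_mono)
    have "integrable leb01 (\<lambda>y. m y * K t y - m y * K s y)"
      using mK[of s] mK[of t] st by (intro Bochner_Integration.integrable_diff) auto
    then show "integrable leb01 (\<lambda>y. \<bar>m y * (K t y - K s y)\<bar>)"
      by (intro integrable_abs) (simp add: right_diff_distrib)
    show "integrable leb01 (\<lambda>y. L * (K t y - K s y))"
      using Kint(2)[of s] Kint(2)[of t] st by (intro integrable_mult_right Bochner_Integration.integrable_diff) auto
    show "\<bar>m y * (K t y - K s y)\<bar> \<le> L * (K t y - K s y)" if "y \<in> space leb01" for y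
      unfolding abs_mult using m(2)[of y] Kmono[of y] that by (auto intro!: mult_right_mono)
  qed
  also have "\<dots> = L * ((t powr \<alpha> - s powr \<alpha>) / \<alpha>)"
    using Kint[of s] Kint[of t] st by (simp add: diff_divide_distrib)
  finally have A: "\<bar>(\<integral>y. m y * K t y \<partial>leb01) - (\<integral>y. m y * K s y \<partial>leb01)\<bar> \<le> L * ((t powr \<alpha> - s powr \<alpha>) / \<alpha>)" .
  have pm: "s powr (\<alpha> - 1) \<le> t powr (\<alpha> - 1)" using st \<alpha> by (intro powr_mono2) auto
  have B: "\<bar>c * t powr (\<alpha> - 1) - c * s powr (\<alpha> - 1)\<bar> \<le> L * (t powr (\<alpha> - 1) - s powr (\<alpha> - 1))"
    using c pm by (simp add: right_diff_distrib[symmetric] abs_mult mult_right_mono)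
  have pos: "(\<alpha> - 1) * Gamma (\<alpha> - 1) > 0" using \<alpha> Gamma_pos by simp
  have "\<bar>Z g t - Z g s\<bar> = \<bar>(c * t powr (\<alpha> - 1) - c * s powr (\<alpha> - 1)) + ((\<integral>y. m y * K t y \<partial>leb01) - (\<integral>y. m y * K s y \<partial>leb01))\<bar> / ((\<alpha> - 1) * Gamma (\<alpha> - 1))"
    using Zg[of s] Zg[of t] st pos by (simp add: diff_divide_distrib[symmetric] abs_divide algebra_simps)
  also have "\<dots> \<le> (L * (t powr (\<alpha> - 1) - s powr (\<alpha> - 1)) + L * ((t powr \<alpha> - s powr \<alpha>) / \<alpha>)) / ((\<alpha> - 1) * Gamma (\<alpha> - 1))"
    using A B pos by (intro divide_right_mono) linarith+
  finally show ?thesis by (simp only: distrib_left[symmetric] times_divide_eq_left)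
qed

end

section \<open>The operator form of the problem and its stability\<close>

text \<open>A fixed choice is made because the representatives of \<open>q\<close> and
  \<open>p\<close> enter the definition of an operator.\<close>

definition repr :: "(real \<Rightarrow> real) \<Rightarrow> real \<Rightarrow> real" where
  "repr f = (SOME F. continuous_on {0..1} F \<and> (AE x in leb01. f x = F x) \<and>
    (\<forall>x\<in>{0..1}. \<bar>F x\<bar> \<le> 2 * H1_norm f) \<and>
    (\<forall>s t. F t - F s = prim (wderiv f) t - prim (wderiv f) s))"

lemma repr:
  assumes "H1D f"
  shows "continuous_on {0..1} (repr f)" "AE x in leb01. f x = repr f x"
    "\<And>x. x \<in> {0..1} \<Longrightarrow> \<bar>repr f x\<bar> \<le> 2 * H1_norm f"
    "\<And>s t. repr f t - repr f s = prim (wderiv f) t - prim (wderiv f) s"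
proof -
  have "\<exists>F. continuous_on {0..1} F \<and> (AE x in leb01. f x = F x) \<and>
    (\<forall>x\<in>{0..1}. \<bar>F x\<bar> \<le> 2 * H1_norm f) \<and>
    (\<forall>s t. F t - F s = prim (wderiv f) t - prim (wderiv f) s)"
    by (rule H1D_representative[OF assms]) blast
  from someI_ex[OF this] show "continuous_on {0..1} (repr f)" "AE x in leb01. f x = repr f x"
    "\<And>x. x \<in> {0..1} \<Longrightarrow> \<bar>repr f x\<bar> \<le> 2 * H1_norm f"
    "\<And>s t. repr f t - repr f s = prim (wderiv f) t - prim (wderiv f) s"
    unfolding repr_def by blast+
qed

text \<open>The bound is asked on the closed interval, since \<open>low\<close> evaluates its
  argument at the endpoint 1.\<close>

definition bounded_by :: "real \<Rightarrow> (real \<Rightarrow> real) \<Rightarrow> bool" where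
  "bounded_by B z \<longleftrightarrow> z \<in> borel_measurable leb01 \<and> (\<forall>x\<in>{0..1}. \<bar>z x\<bar> \<le> B)"

lemma bounded_byD: "bounded_by B z \<Longrightarrow> x \<in> {0..1} \<Longrightarrow> \<bar>z x\<bar> \<le> B"
  by (simp add: bounded_by_def)

lemma bounded_by_nonneg: "bounded_by B z \<Longrightarrow> 0 \<le> B"
  using bounded_byD[of B z 0] by auto

lemma bounded_by_L2D: "bounded_by B z \<Longrightarrow> L2D z" "bounded_by B z \<Longrightarrow> L2_norm z \<le> B"
  unfolding bounded_by_def by (auto intro!: L2D_bounded)

locale frac_problem = frac_kernel +
  fixes q p :: "real \<Rightarrow> real"
  assumes q: "H1D q" and p: "H1D p"
    and inj: "\<And>w. H01D w \<Longrightarrow> (\<And>v. H01D v \<Longrightarrow> bilA \<alpha> q p w v = 0) \<Longrightarrow> AE x in leb01. w x = 0"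
begin

definition Cm :: real where "Cm = 2 * H1_norm q + 2 * H1_norm p"

text \<open>With z = \<open>Z g\<close> these are the two lower order terms of \<open>bilA\<close>,
  including the nonlocal one with the value at 1, merged into one function to be paired with the
  test function.\<close>

definition low :: "(real \<Rightarrow> real) \<Rightarrow> real \<Rightarrow> real" where
  "low z x = repr q x * z x + z 1 * repr p x"

text \<open>In terms of \<open>g = w'\<close> the form is \<open>A(w, v) = (T g, v')\<close> with \<open>T g = g + J (Z g)\<close>; the constant in
  \<open>J\<close> keeps its values orthogonal to constants.\<close>

definition J :: "(real \<Rightarrow> real) \<Rightarrow> real \<Rightarrow> real" where
  "J z x = integral\<^sup>L leb01 (prim (low z)) - prim (low z) x"

lemma Cm_nonneg: "0 \<le> Cm"
  using H1_norm_ge(3)[OF q] H1_norm_ge(3)[OF p] by (simp add: Cm_def)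

lemma low_bounded:
  assumes z: "bounded_by B z" shows "bounded_by (Cm * B) (low z)"
  unfolding bounded_by_def
proof
  show "low z \<in> borel_measurable leb01"
    using z repr(1)[OF q, THEN continuous_on_measurable_leb01] repr(1)[OF p, THEN continuous_on_measurable_leb01]
    unfolding low_def[abs_def] bounded_by_def by auto
  show "\<forall>x\<in>{0..1}. \<bar>low z x\<bar> \<le> Cm * B"
  proof
    fix x :: real assume x: "x \<in> {0..1}"
    have "\<bar>low z x\<bar> \<le> \<bar>repr q x * z x\<bar> + \<bar>z 1 * repr p x\<bar>" unfolding low_def by (rule abs_triangle_ineq)
    also have "\<dots> \<le> (2 * H1_norm q) * B + B * (2 * H1_norm p)"
      unfolding abs_mult using bounded_by_nonneg[OF z] H1_norm_ge(3)[OF q] H1_norm_ge(3)[OF p]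
      by (intro add_mono mult_mono bounded_byD[OF z] repr(3) q p x) auto
    finally show "\<bar>low z x\<bar> \<le> Cm * B" by (simp add: Cm_def algebra_simps)
  qed
qed

lemma low_diff: "low (\<lambda>x. y x - z x) = (\<lambda>x. low y x - low z x)"
  and low_cmult: "low (\<lambda>x. c * z x) = (\<lambda>x. c * low z x)"
  by (auto simp: low_def fun_eq_iff algebra_simps)

lemma low_L2D: "bounded_by B z \<Longrightarrow> L2D (low z)"
  using low_bounded bounded_by_L2D by blast

text \<open>Linearity of \<open>Z\<close> is available only on the unit interval, so agreement there
  has to suffice.\<close>

lemma J_cong:
  assumes "\<And>x. x \<in> {0..1} \<Longrightarrow> y x = z x" shows "J y = J z"
proof -
  have "low y t = low z t" if "t \<in> D" for t using assms that by (simp add: low_def)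
  then have "prim (low y) = prim (low z)"
    unfolding prim_def by (intro ext LINT_cong) auto
  then show ?thesis by (simp add: J_def[abs_def])
qed

lemma J_diff:
  assumes y: "bounded_by A y" and z: "bounded_by B z"
  shows "J (\<lambda>x. y x - z x) t = J y t - J z t"
proof -
  note L = low_L2D[OF y] low_L2D[OF z]
  have "prim (low (\<lambda>x. y x - z x)) = (\<lambda>x. prim (low y) x - prim (low z) x)"
    unfolding low_diff by (intro ext prim_minus L2D_integrable L)
  then show ?thesis using L2D_integrable[OF L2D_prim[OF L(1)]] L2D_integrable[OF L2D_prim[OF L(2)]]
    by (simp add: J_def)
qed

lemma J_cmult: "J (\<lambda>x. c * z x) t = c * J z t"
proof -
  have "prim (low (\<lambda>x. c * z x)) = (\<lambda>x. c * prim (low z) x)"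
    unfolding low_cmult by (intro ext prim_cmult)
  then show ?thesis by (simp add: J_def right_diff_distrib)
qed

text \<open>The derivative gained here is used twice: for equicontinuity in the compactness
  argument, and for a factor h when \<open>J (Z e)\<close> is approximated by piecewise
  constants.\<close>

lemma J_Lipschitz:
  assumes "bounded_by B z" "0 \<le> s" "s \<le> t" "t \<le> 1"
  shows "\<bar>J z t - J z s\<bar> \<le> Cm * B * (t - s)"
proof -
  have "\<bar>prim (low z) t - prim (low z) s\<bar> \<le> Cm * B * (t - s)"
    using low_bounded[OF assms(1)] assms(2-) unfolding bounded_by_def by (intro prim_Lipschitz) auto
  then show ?thesis by (simp add: J_def)
qed

lemma J_continuous_on: "bounded_by B z \<Longrightarrow> continuous_on {0..1} (J z)"
  unfolding J_def[abs_def] by (intro continuous_intros prim_continuous_on low_L2D)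

lemma J_bounded:
  assumes z: "bounded_by B z" shows "bounded_by (2 * Cm * B) (J z)"
  unfolding bounded_by_def
proof
  show "J z \<in> borel_measurable leb01" by (intro continuous_on_measurable_leb01 J_continuous_on[OF z])
  note L = low_L2D[OF z]
  have P: "\<bar>prim (low z) x\<bar> \<le> Cm * B" for x
    using prim_abs_le[OF L2D_integrable[OF L]] L1_le_L2_norm(1)[OF L] bounded_by_L2D(2)[OF low_bounded[OF z]]
    by (meson order_trans)
  have "\<bar>integral\<^sup>L leb01 (prim (low z))\<bar> \<le> L2_norm (prim (low z))" by (rule L1_le_L2_norm(2)[OF L2D_prim[OF L]])
  also have "\<dots> \<le> Cm * B" using P prim_measurable[OF L] by (intro L2D_bounded) auto
  finally have M: "\<bar>integral\<^sup>L leb01 (prim (low z))\<bar> \<le> Cm * B" .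
  show "\<forall>x\<in>{0..1}. \<bar>J z x\<bar> \<le> 2 * Cm * B"
  proof
    fix x :: real
    have "\<bar>J z x\<bar> \<le> \<bar>integral\<^sup>L leb01 (prim (low z))\<bar> + \<bar>prim (low z) x\<bar>"
      unfolding J_def by (rule abs_triangle_ineq4)
    then show "\<bar>J z x\<bar> \<le> 2 * Cm * B" using M P[of x] by linarith
  qed
qed

lemma J_L2D: "bounded_by B z \<Longrightarrow> L2D (J z)"
  using J_bounded bounded_by_L2D by blast

lemma J_integral:
  assumes z: "bounded_by B z" shows "integral\<^sup>L leb01 (J z) = 0"
  using L2D_integrable[OF L2D_prim[OF low_L2D[OF z]]] by (simp add: J_def[abs_def])

lemma Z_bounded_by: "L2D g \<Longrightarrow> bounded_by (CZ * L2_norm g) (Z g)"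
  unfolding bounded_by_def
  by (intro conjI ballI Z_bound continuous_on_measurable_leb01 Z_continuous_on) auto

definition T :: "(real \<Rightarrow> real) \<Rightarrow> real \<Rightarrow> real" where "T g x = g x + J (Z g) x"

lemma T_L2D: "L2D g \<Longrightarrow> L2D (T g)"
  unfolding T_def[abs_def] using J_L2D[OF Z_bounded_by, of g] L2D_add[of g "J (Z g)"] by simp

text \<open>Integration by parts gives the same with another additive constant in place of the one
  in \<open>J\<close>; constants are invisible to \<gamma>, which has mean zero.\<close>

lemma integral_low_mult_prim:
  assumes z: "bounded_by B z" and \<gamma>: "L2D \<gamma>" "integral\<^sup>L leb01 \<gamma> = 0"
  shows "(\<integral>x. low z x * prim \<gamma> x \<partial>leb01) = (\<integral>x. J z x * \<gamma> x \<partial>leb01)"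
proof -
  note L = low_L2D[OF z]
  define c where "c = integral\<^sup>L leb01 (low z) - integral\<^sup>L leb01 (prim (low z))"
  have "(\<integral>x. low z x * prim \<gamma> x \<partial>leb01) = (\<integral>x. \<gamma> x * (integral\<^sup>L leb01 (low z) - prim (low z) x) \<partial>leb01)"
    by (intro integral_prim_by_parts L2D_integrable L \<gamma>)
  also have "\<dots> = (\<integral>x. J z x * \<gamma> x + c * \<gamma> x \<partial>leb01)"
    by (intro LINT_cong) (auto simp: J_def c_def algebra_simps)
  also have "\<dots> = (\<integral>x. J z x * \<gamma> x \<partial>leb01)"
    using L2D_mult_integrable[OF J_L2D[OF z] \<gamma>(1)] L2D_integrable[OF \<gamma>(1)] \<gamma>(2) by simp
  finally show ?thesis .
qed

text \<open>The derivative of the first argument enters through any function equal to it almost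
  everywhere, so that for discrete functions \<open>g\<close> can be an honest piecewise
  polynomial.\<close>

lemma bilA_eq:
  assumes g: "L2D g" "AE x in leb01. wderiv \<psi> x = g x" and w: "L2D (wderiv \<psi>)" and \<phi>: "H01D \<phi>"
  shows "bilA \<alpha> q p \<psi> \<phi> = (\<integral>x. T g x * wderiv \<phi> x \<partial>leb01)"
proof -
  define \<gamma> where "\<gamma> = wderiv \<phi>"
  have H1: "H1D \<phi>" using \<phi> by (simp add: H01D_def)
  have \<gamma>: "L2D \<gamma>" "integral\<^sup>L leb01 \<gamma> = 0" "AE x in leb01. \<phi> x = prim \<gamma> x"
    using wderiv_props[OF H1] H01D_imp_prim[OF \<phi>] by (auto simp: \<gamma>_def)
  have L: "L2D \<phi>" "L2D q" "L2D p" using H1 q p by (auto simp: H1D_def)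
  have qm: "repr q \<in> borel_measurable leb01" "repr p \<in> borel_measurable leb01"
    using repr(1)[OF q] repr(1)[OF p] continuous_on_measurable_leb01 by auto
  have rl: "rl_D \<alpha> \<psi> x = Z g x" if "x \<le> 1" for x
    using frac_int_eq_Z[OF that] Z_cong_AE[OF g(2) w g(1)] by (simp add: rl_D_def)
  note zb = Z_bounded_by[OF g(1)]
  have zm: "Z g \<in> borel_measurable leb01" using zb by (simp add: bounded_by_def)
  have LP: "L2D (prim \<gamma>)" by (rule L2D_prim[OF \<gamma>(1)])
  have LZ: "L2D (Z g)" using bounded_by_L2D zb by blast
  have rqb: "\<bar>repr q x\<bar> \<le> 2 * H1_norm q" "\<bar>repr p x\<bar> \<le> 2 * H1_norm p" if "x \<in> D" for x
    using repr(3)[OF q, of x] repr(3)[OF p, of x] that by auto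
  have Lq: "L2D (\<lambda>x. repr q x * Z g x)" by (rule L2D_mult_bounded[OF LZ qm(1) rqb(1)])
  have Lp: "L2D (\<lambda>x. repr p x)" by (rule L2D_bounded[OF qm(2) rqb(2)])
  have "l2_inner (wderiv \<psi>) (wderiv \<phi>) = (\<integral>x. g x * \<gamma> x \<partial>leb01)"
    unfolding l2_inner_eq \<gamma>_def[symmetric] using g w \<gamma>
    by (intro integral_cong_AE borel_measurable_times L2D_measurable) auto
  moreover have "l2_inner (rl_D \<alpha> \<psi>) (\<lambda>x. q x * \<phi> x) = (\<integral>x. (repr q x * Z g x) * prim \<gamma> x \<partial>leb01)"
  proof -
    have "l2_inner (rl_D \<alpha> \<psi>) (\<lambda>x. q x * \<phi> x) = (\<integral>x. Z g x * (q x * \<phi> x) \<partial>leb01)"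
      unfolding l2_inner_eq by (intro LINT_cong) (auto simp: rl)
    also have "\<dots> = (\<integral>x. (repr q x * Z g x) * prim \<gamma> x \<partial>leb01)"
      using repr(2)[OF q] \<gamma>(3) zm qm L2D_measurable[OF L(1)] L2D_measurable[OF L(2)] L2D_measurable[OF LP]
      by (intro integral_cong_AE) auto
    finally show ?thesis .
  qed
  moreover have "l2_inner p \<phi> = (\<integral>x. repr p x * prim \<gamma> x \<partial>leb01)"
    unfolding l2_inner_eq
    using repr(2)[OF p] \<gamma>(3) qm L2D_measurable[OF L(1)] L2D_measurable[OF L(3)] L2D_measurable[OF LP]
    by (intro integral_cong_AE) auto
  ultimately have "bilA \<alpha> q p \<psi> \<phi> = (\<integral>x. g x * \<gamma> x \<partial>leb01) +
      ((\<integral>x. (repr q x * Z g x) * prim \<gamma> x \<partial>leb01) + Z g 1 * (\<integral>x. repr p x * prim \<gamma> x \<partial>leb01))"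
    by (simp add: bilA_def rl)
  also have "(\<integral>x. (repr q x * Z g x) * prim \<gamma> x \<partial>leb01) + Z g 1 * (\<integral>x. repr p x * prim \<gamma> x \<partial>leb01) =
      (\<integral>x. low (Z g) x * prim \<gamma> x \<partial>leb01)"
    unfolding low_def distrib_right using L2D_mult_integrable[OF Lq LP] L2D_mult_integrable[OF Lp LP]
    by (subst Bochner_Integration.integral_add) (auto simp: mult.assoc)
  also have "\<dots> = (\<integral>x. J (Z g) x * \<gamma> x \<partial>leb01)"
    by (rule integral_low_mult_prim[OF zb \<gamma>(1,2)])
  also have "(\<integral>x. g x * \<gamma> x \<partial>leb01) + (\<integral>x. J (Z g) x * \<gamma> x \<partial>leb01) = (\<integral>x. T g x * \<gamma> x \<partial>leb01)"
    unfolding T_def distrib_right using L2D_mult_integrable[OF g(1) \<gamma>(1)] L2D_mult_integrable[OF J_L2D[OF zb] \<gamma>(1)]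
    by simp
  finally show ?thesis by (simp add: \<gamma>_def)
qed

text \<open>Continuity places \<open>prim g\<close> in \<open>H01D\<close>. There the form vanishes
  against every test function, so injectivity makes \<open>prim g\<close> zero, and uniqueness of
  the weak derivative makes \<open>g\<close> zero.\<close>

lemma kernel_trivial:
  assumes g: "continuous_on {0..1} g" and z: "integral\<^sup>L leb01 g = 0" and T0: "\<And>x. x \<in> D \<Longrightarrow> T g x = 0"
  shows "AE x in leb01. g x = 0"
proof -
  note td = test_dense_continuous[OF g]
  have L: "L2D g" using td by (simp add: test_dense_def)
  note w = H01D_prim[OF td z, of "prim g", OF refl]
  have wL: "L2D (wderiv (prim g))" using wderiv_props w(1) by (auto simp: H01D_def)
  have "AE x in leb01. prim g x = 0"
  proof (rule inj[OF w(1)])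
    fix v assume v: "H01D v"
    have "bilA \<alpha> q p (prim g) v = (\<integral>x. T g x * wderiv v x \<partial>leb01)"
      by (rule bilA_eq[OF L w(2) wL v])
    also have "\<dots> = (\<integral>x. 0 \<partial>leb01)" by (intro LINT_cong) (auto simp: T0)
    finally show "bilA \<alpha> q p (prim g) v = 0" by simp
  qed
  then have "is_weak_deriv (prim g) (\<lambda>_. 0)"
    unfolding is_weak_deriv_iff
  proof (intro allI impI)
    fix \<phi> assume "AE x in leb01. prim g x = 0"
    then have "(\<integral>x. prim g x * deriv \<phi> x \<partial>leb01) = 0" by (intro integral_eq_zero_AE) auto
    then show "(\<integral>x. prim g x * deriv \<phi> x \<partial>leb01) = - (\<integral>x. 0 * \<phi> x \<partial>leb01)" by simp
  qed
  with is_weak_deriv_prim[OF L, of "prim g"] show ?thesis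
    using weak_deriv_unique[OF L L2D_const[of 0]] by simp
qed

text \<open>\<open>Z (e n)\<close> is \<open>Z (T (e n))\<close>, which tends to 0 uniformly, minus
  \<open>Z (J (Z (e n)))\<close>. If a subsequence of \<open>J (Z (e n))\<close> tends uniformly to
  g, then \<open>Z (e n)\<close> tends to -\<open>Z g\<close> along it; applying \<open>J\<close>
  gives g = - \<open>J (Z g)\<close>, so \<open>T g\<close> vanishes and g = 0. Then
  \<open>Z (e n)\<close> tends to 0, against the value 1 at \<open>y n\<close>. Compactness comes
  from the bound on \<open>Z (e n)\<close> alone; the L2 norms of \<open>e n\<close> may
  grow.\<close>

lemma no_bad_sequence:
  assumes e: "\<And>n::nat. L2D (e n)" "\<And>n. integral\<^sup>L leb01 (e n) = 0"
    and b: "\<And>n x. x \<in> {0..1} \<Longrightarrow> \<bar>Z (e n) x\<bar> \<le> 1"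
    and r: "\<And>n x. x \<in> {0..1} \<Longrightarrow> \<bar>Z (T (e n)) x\<bar> \<le> 1 / Suc n"
    and y: "\<And>n. y n \<in> {0..1}" "\<And>n. \<bar>Z (e n) (y n)\<bar> = 1"
  shows False
proof -
  define z where "z n = Z (e n)" for n
  have zb: "bounded_by 1 (z n)" for n
    using b Z_bounded_by[OF e(1)] by (simp add: bounded_by_def z_def)
  have "\<And>n x. x \<in> {0..1::real} \<Longrightarrow> norm (J (z n) x) \<le> 2 * Cm"
    using bounded_byD[OF J_bounded[OF zb]] by simp
  moreover have "\<exists>d>0. \<forall>n y. y \<in> {0..1::real} \<and> norm (x - y) < d \<longrightarrow> norm (J (z n) x - J (z n) y) < \<epsilon>"
    if x: "x \<in> {0..1}" and \<epsilon>: "0 < \<epsilon>" for x \<epsilon> :: real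
  proof (intro exI[of _ "\<epsilon> / (Cm + 1)"] conjI allI impI)
    show "0 < \<epsilon> / (Cm + 1)" using \<epsilon> Cm_nonneg by (simp add: add_nonneg_pos)
    fix n y assume y: "y \<in> {0..1::real} \<and> norm (x - y) < \<epsilon> / (Cm + 1)"
    have "\<bar>J (z n) x - J (z n) y\<bar> \<le> Cm * \<bar>x - y\<bar>"
      using J_Lipschitz[OF zb, of x y n] J_Lipschitz[OF zb, of y x n] x y
      by (cases "x \<le> y") (auto simp: abs_minus_commute)
    also have "\<dots> \<le> (Cm + 1) * \<bar>x - y\<bar>" by (intro mult_right_mono) auto
    also have "\<dots> < \<epsilon>"
      using y Cm_nonneg by (simp add: pos_less_divide_eq mult.commute)
    finally show "norm (J (z n) x - J (z n) y) < \<epsilon>" by simp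
  qed
  ultimately obtain g k where g: "continuous_on {0..1} g" and k: "strict_mono (k :: nat \<Rightarrow> nat)"
    and lim: "\<And>\<epsilon>. 0 < \<epsilon> \<Longrightarrow> \<exists>N. \<forall>n x. n \<ge> N \<and> x \<in> {0..1} \<longrightarrow> norm (J (z (k n)) x - g x) < \<epsilon>"
    using Arzela_Ascoli[of "{0..1::real}" "\<lambda>n. J (z n)" "2 * Cm"] by (metis compact_Icc)
  have gL: "L2D g" using test_dense_continuous[OF g] by (simp add: test_dense_def)
  note Zgb = Z_bounded_by[OF gL]
  have zlim: "\<exists>N. \<forall>n x. n \<ge> N \<and> x \<in> {0..1} \<longrightarrow> \<bar>z (k n) x + Z g x\<bar> \<le> \<epsilon>" if \<epsilon>: "0 < \<epsilon>" for \<epsilon>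
  proof -
    have "0 < \<epsilon> / (2 * CZ)" using \<epsilon> CZ_pos by simp
    from lim[OF this] obtain N where N: "\<And>n x. n \<ge> N \<Longrightarrow> x \<in> {0..1} \<Longrightarrow> \<bar>J (z (k n)) x - g x\<bar> < \<epsilon> / (2 * CZ)" by auto
    obtain M where M: "1 / real (Suc M) < \<epsilon> / 2" using \<epsilon> nat_approx_posE[of "\<epsilon> / 2"] by auto
    show ?thesis
    proof (intro exI[of _ "max N M"] allI impI)
      fix n x assume n: "max N M \<le> n \<and> x \<in> {0..1::real}"
      then have x: "0 \<le> x" "x \<le> 1" by auto
      note JL = J_L2D[OF zb[of "k n"]]
      have eq: "z (k n) x + Z g x = Z (T (e (k n))) x - Z (\<lambda>t. J (z (k n)) t - g t) x"
        unfolding T_def[abs_def] using Z_add[OF e(1) JL[unfolded z_def] x] Z_diff[OF JL gL x] by (simp add: z_def)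
      have "\<bar>Z (\<lambda>t. J (z (k n)) t - g t) x\<bar> \<le> CZ * L2_norm (\<lambda>t. J (z (k n)) t - g t)"
        by (intro Z_bound L2D_diff JL gL x)
      also have "\<dots> \<le> CZ * (\<epsilon> / (2 * CZ))"
      proof (intro mult_left_mono L2D_bounded)
        show "(\<lambda>t. J (z (k n)) t - g t) \<in> borel_measurable leb01"
          by (intro L2D_measurable L2D_diff JL gL)
        show "\<bar>J (z (k n)) t - g t\<bar> \<le> \<epsilon> / (2 * CZ)" if "t \<in> D" for t
          using N[of n t] n that by auto
        show "0 \<le> CZ" using CZ_pos by simp
      qed
      also have "\<dots> = \<epsilon> / 2" using CZ_pos by simp
      finally have 1: "\<bar>Z (\<lambda>t. J (z (k n)) t - g t) x\<bar> \<le> \<epsilon> / 2" .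
      have "\<bar>Z (T (e (k n))) x\<bar> \<le> 1 / Suc (k n)" using r n by blast
      also have "\<dots> \<le> 1 / Suc M"
        using seq_suble[OF k, of n] n by (intro divide_left_mono) auto
      finally show "\<bar>z (k n) x + Z g x\<bar> \<le> \<epsilon>" using 1 M unfolding eq by linarith
    qed
  qed
  have fix_g: "g x = - J (Z g) x" if x: "x \<in> {0..1}" for x
  proof -
    have "\<bar>g x + J (Z g) x\<bar> \<le> \<epsilon>" if \<epsilon>: "\<epsilon> > 0" for \<epsilon>
    proof -
      \<comment> \<open>\<open>2 * Cm\<close> is the sup bound for \<open>J\<close>; the added 1
        keeps the denominator positive when \<open>Cm\<close> is 0.\<close>
      define \<delta> where "\<delta> = (\<epsilon> / 2) / (2 * Cm + 1)"
      have pos: "2 * Cm + 1 > 0" using Cm_nonneg by simp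
      then have \<delta>: "\<delta> > 0" using \<epsilon> by (simp add: \<delta>_def)
      obtain N where N: "\<And>n x. n \<ge> N \<Longrightarrow> x \<in> {0..1} \<Longrightarrow> \<bar>z (k n) x + Z g x\<bar> \<le> \<delta>" using zlim[OF \<delta>] by blast
      have "\<epsilon> / 2 > 0" using \<epsilon> by simp
      from lim[OF this] obtain M where M: "\<And>n x. n \<ge> M \<Longrightarrow> x \<in> {0..1} \<Longrightarrow> \<bar>J (z (k n)) x - g x\<bar> < \<epsilon> / 2" by auto
      define n where "n = max N M"
      \<comment> \<open>A sum in the shape of a difference, so that \<open>J_diff\<close> and
        \<open>J_cmult\<close> give the linearity.\<close>
      let ?d = "\<lambda>x. z (k n) x - (-1) * Z g x"
      have mb: "bounded_by (CZ * L2_norm g) (\<lambda>x. (-1) * Z g x)" using Zgb by (auto simp: bounded_by_def)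
      have "bounded_by \<delta> ?d"
        using N[of n] zb[of "k n"] Zgb by (auto simp: bounded_by_def n_def)
      then have "\<bar>J ?d x\<bar> \<le> 2 * Cm * \<delta>" using bounded_byD[OF J_bounded x] by blast
      also have "\<dots> \<le> (2 * Cm + 1) * \<delta>" using \<delta> by (intro mult_right_mono) auto
      also have "\<dots> = \<epsilon> / 2" unfolding \<delta>_def using pos by (metis less_irrefl nonzero_eq_divide_eq mult.commute)
      finally have "\<bar>J (z (k n)) x + J (Z g) x\<bar> \<le> \<epsilon> / 2"
        using J_diff[OF zb[of "k n"] mb, of x] J_cmult[of "-1" "Z g" x] by simp
      moreover have "\<bar>J (z (k n)) x - g x\<bar> < \<epsilon> / 2" using M[of n] x by (simp add: n_def)
      ultimately show ?thesis by linarith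
    qed
    then have "\<bar>g x + J (Z g) x\<bar> \<le> 0" by (rule field_le_epsilon) simp
    then show ?thesis by simp
  qed
  have "integral\<^sup>L leb01 g = (\<integral>x. - J (Z g) x \<partial>leb01)"
    by (intro LINT_cong) (auto simp: fix_g)
  then have g0: "integral\<^sup>L leb01 g = 0" using J_integral[OF Zgb] by simp
  have "T g x = 0" if "x \<in> D" for x
    unfolding T_def using fix_g[of x] that by simp
  then have "AE x in leb01. g x = 0"
    by (rule kernel_trivial[OF g g0])
  then have Z0: "Z g x = 0" for x
    using Z_cong_AE[OF _ gL L2D_const[of 0], of x] by (simp add: Z_def)
  obtain N where "\<And>n x. n \<ge> N \<Longrightarrow> x \<in> {0..1} \<Longrightarrow> \<bar>z (k n) x + Z g x\<bar> \<le> 1 / 2" using zlim[of "1/2"] by auto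
  from this[of N "y (k N)"] y Z0 show False by (simp add: z_def)
qed

text \<open>Both sides are measured after applying \<open>Z\<close>. In this weak norm the Galerkin
  residual gains the factor h^(\<alpha>-3/2), which a bound through the L2 norm of
  \<open>T e\<close> would lose.\<close>

definition stable :: "real \<Rightarrow> bool" where
  "stable C \<longleftrightarrow> 0 \<le> C \<and> (\<forall>e B. L2D e \<longrightarrow> integral\<^sup>L leb01 e = 0 \<longrightarrow> (\<forall>x\<in>{0..1}. \<bar>Z (T e) x\<bar> \<le> B) \<longrightarrow>
     (\<forall>x\<in>{0..1}. \<bar>Z e x\<bar> \<le> C * B))"

lemma stability: "\<exists>C. stable C"
proof (rule ccontr)
  assume neg: "\<nexists>C. stable C"
  have "\<exists>e B x. L2D e \<and> integral\<^sup>L leb01 e = 0 \<and> (\<forall>x\<in>{0..1}. \<bar>Z (T e) x\<bar> \<le> B) \<and> x \<in> {0..1} \<and> \<bar>Z e x\<bar> > real (Suc n) * B" for n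
    using neg unfolding stable_def by (meson not_le of_nat_0_le_iff)
  then obtain e B x where *: "\<And>n. L2D (e n)" "\<And>n. integral\<^sup>L leb01 (e n) = 0"
    "\<And>n t. t \<in> {0..1} \<Longrightarrow> \<bar>Z (T (e n)) t\<bar> \<le> B n" "\<And>n. x n \<in> {0..1}" "\<And>n. \<bar>Z (e n) (x n)\<bar> > real (Suc n) * B n"
    by metis
  have "\<exists>y\<in>{0..1}. \<forall>t\<in>{0..1}. \<bar>Z (e n) t\<bar> \<le> \<bar>Z (e n) y\<bar>" for n
    by (intro continuous_attains_sup continuous_on_rabs Z_continuous_on *) auto
  then obtain y where y: "\<And>n. y n \<in> {0..1}" "\<And>n t. t \<in> {0..1} \<Longrightarrow> \<bar>Z (e n) t\<bar> \<le> \<bar>Z (e n) (y n)\<bar>" by metis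
  \<comment> \<open>Dividing by the attained maximum makes it 1. It exceeds (n + 1) times
    \<open>B n\<close>, so after division the data is at most 1/(n + 1).\<close>
  define S where "S n = \<bar>Z (e n) (y n)\<bar>" for n
  have B0: "B n \<ge> 0" for n using *(3)[of 0 n] by auto
  have SB: "S n > real (Suc n) * B n" for n
    using *(5)[of n] y(2)[OF *(4)[of n], of n] unfolding S_def by linarith
  have S0: "S n > 0" for n
    using SB[of n] mult_nonneg_nonneg[of "real (Suc n)" "B n"] B0[of n] by linarith
  define f where "f n = (\<lambda>t. (1 / S n) * e n t)" for n
  have Zf: "Z (f n) t = Z (e n) t / S n" for n t unfolding f_def Z_cmult by simp
  have JZf: "J (Z (f n)) t = (1 / S n) * J (Z (e n)) t" for n t
  proof -
    have "Z (f n) = (\<lambda>t. (1 / S n) * Z (e n) t)" by (simp add: Zf fun_eq_iff)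
    then show ?thesis by (simp only: J_cmult)
  qed
  have "T (f n) = (\<lambda>t. (1 / S n) * T (e n) t)" for n
    unfolding T_def JZf by (auto simp: f_def algebra_simps)
  then have ZTf: "Z (T (f n)) t = Z (T (e n)) t / S n" for n t
    using Z_cmult[of "1 / S n" "T (e n)" t] by simp
  show False
  proof (rule no_bad_sequence[of f y])
    show "L2D (f n)" "integral\<^sup>L leb01 (f n) = 0" for n
      unfolding f_def using *(1,2) by (simp_all add: L2D_cmult del: times_divide_eq_left)
    show "\<bar>Z (f n) t\<bar> \<le> 1" if "t \<in> {0..1}" for n t
      using y(2)[OF that, of n] S0[of n] unfolding Zf by (simp add: abs_divide S_def[symmetric])
    show "\<bar>Z (T (f n)) t\<bar> \<le> 1 / Suc n" if "t \<in> {0..1}" for n t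
    proof -
      have "\<bar>Z (T (f n)) t\<bar> \<le> B n / S n"
        using *(3)[OF that, of n] S0[of n] unfolding ZTf by (simp add: abs_divide divide_right_mono)
      also have "\<dots> \<le> 1 / Suc n" using SB[of n] S0[of n] by (simp add: divide_simps mult.commute)
      finally show ?thesis .
    qed
    show "y n \<in> {0..1}" for n by (rule y)
    show "\<bar>Z (f n) (y n)\<bar> = 1" for n
      using S0[of n] unfolding Zf by (simp add: abs_divide S_def[symmetric])
  qed
qed

end

section \<open>Piecewise polynomials\<close>

text \<open>The index of the cell containing x, with cells closed on the left and open on the right;
  these partition [0,1), so mesh points are unambiguous. Outside [0,1) the value carries no
  meaning.\<close>

definition cell :: "real list \<Rightarrow> real \<Rightarrow> nat" where
  "cell xs x = (LEAST i. x < xs ! Suc i)"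

locale mesh01 =
  fixes xs :: "real list"
  assumes part: "partition01 xs"
begin

definition ncells :: nat where "ncells = length xs - 1"
abbreviation left :: "real \<Rightarrow> real" where "left x \<equiv> xs ! cell xs x"
abbreviation icell :: "nat \<Rightarrow> real set" where "icell i \<equiv> {xs ! i..<xs ! Suc i}"
abbreviation right :: "real \<Rightarrow> real" where "right x \<equiv> xs ! Suc (cell xs x)"

lemma length_xs: "length xs = Suc ncells" and ncells_pos: "0 < ncells"
  using part by (auto simp: partition01_def ncells_def)

lemma xs_0: "xs ! 0 = 0" and xs_last: "xs ! ncells = 1"
  using part last_conv_nth[of xs] length_xs by (cases xs; auto simp: partition01_def)+

lemma xs_less: "i < j \<Longrightarrow> j \<le> ncells \<Longrightarrow> xs ! i < xs ! j"
  using part by (auto simp: partition01_def sorted_wrt_iff_nth_less length_xs)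

lemma xs_le: "i \<le> j \<Longrightarrow> j \<le> ncells \<Longrightarrow> xs ! i \<le> xs ! j"
  using xs_less[of i j] by (cases "i = j") auto

lemma xs_bounds: "i \<le> ncells \<Longrightarrow> 0 \<le> xs ! i \<and> xs ! i \<le> 1"
  using xs_le[of 0 i] xs_le[of i ncells] by (simp add: xs_0 xs_last)

lemma cell_eq:
  assumes "i < ncells" "xs ! i \<le> x" "x < xs ! Suc i"
  shows "cell xs x = i"
  unfolding cell_def
proof (rule Least_equality)
  show "i \<le> j" if "x < xs ! Suc j" for j
  proof (rule ccontr)
    assume "\<not> i \<le> j"
    then have "xs ! Suc j \<le> xs ! i" using assms by (intro xs_le) auto
    then show False using that assms by simp
  qed
qed (use assms in auto)

lemma cell:
  assumes "0 \<le> x" "x < 1"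
  shows "cell xs x < ncells" "left x \<le> x" "x < right x"
proof -
  have last: "x < xs ! Suc (ncells - 1)" using assms ncells_pos xs_last by simp
  have "cell xs x \<le> ncells - 1" unfolding cell_def using last by (rule Least_le)
  then show c: "cell xs x < ncells" using ncells_pos by simp
  show "x < right x" unfolding cell_def using last by (rule LeastI)
  show "left x \<le> x"
  proof (cases "cell xs x")
    case 0
    then show ?thesis using assms xs_0 by simp
  next
    case (Suc j)
    then have "\<not> x < xs ! Suc j" using not_less_Least[of j "\<lambda>i. x < xs ! Suc i"] by (simp add: cell_def)
    then show ?thesis using Suc by simp
  qed
qed

lemma left_right_bounds:
  assumes "0 \<le> x" "x < 1"
  shows "0 \<le> left x" "left x < 1" "right x \<le> 1" "right x - left x \<le> mesh xs"
proof -
  note c = cell[OF assms]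
  show "0 \<le> left x" "left x < 1" "right x \<le> 1"
    using xs_bounds[of "cell xs x"] xs_bounds[of "Suc (cell xs x)"] c assms by auto
  show "right x - left x \<le> mesh xs"
    unfolding mesh_def using c by (intro Max_ge) (auto simp: length_xs)
qed

lemma cell_length_le: "i < ncells \<Longrightarrow> xs ! Suc i - xs ! i \<le> mesh xs"
  unfolding mesh_def by (intro Max_ge) (auto simp: length_xs)

lemma mesh_pos: "0 < mesh xs"
  using cell_length_le[of 0] xs_less[of 0 1] ncells_pos by auto

lemma sum_indicator_cells:
  fixes F :: "nat \<Rightarrow> real"
  assumes "0 \<le> x" "x < 1"
  shows "(\<Sum>i<ncells. indicator (icell i) x * F i) = F (cell xs x)"
proof -
  have "(\<Sum>i<ncells. indicator (icell i) x * F i) = (\<Sum>i<ncells. if i = cell xs x then F i else 0)"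
  proof (rule sum.cong[OF refl])
    fix i assume "i \<in> {..<ncells}"
    then show "indicator (icell i) x * F i = (if i = cell xs x then F i else 0)"
      using cell_eq[of i x] cell(2,3)[OF assms] by (cases "i = cell xs x") (auto simp: indicator_def)
  qed
  then show ?thesis using cell(1)[OF assms] by simp
qed

lemma integral_cells:
  fixes f :: "real \<Rightarrow> real"
  assumes "integrable leb01 f"
  shows "integral\<^sup>L leb01 f = (\<Sum>i<ncells. \<integral>x. indicator (icell i) x * f x \<partial>leb01)"
proof -
  have "integral\<^sup>L leb01 f = (\<integral>x. (\<Sum>i<ncells. indicator (icell i) x * f x) \<partial>leb01)"
  proof (intro LINT_cong refl)
    fix x assume "x \<in> space leb01"
    then show "f x = (\<Sum>i<ncells. indicator (icell i) x * f x)"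
      using sum_indicator_cells[of x "\<lambda>_. f x"] by simp
  qed
  also have "\<dots> = (\<Sum>i<ncells. \<integral>x. indicator (icell i) x * f x \<partial>leb01)"
    by (intro Bochner_Integration.integral_sum integrable_indicator_mult assms) auto
  finally show ?thesis .
qed

text \<open>No matching at the mesh points is required: these are the derivatives of the elements of
  \<open>Vh\<close>, one degree lower.\<close>

definition pwpoly :: "nat \<Rightarrow> (real \<Rightarrow> real) \<Rightarrow> bool" where
  "pwpoly k s \<longleftrightarrow> (\<exists>P :: nat \<Rightarrow> real poly. (\<forall>i. degree (P i) \<le> k) \<and> (\<forall>x\<in>{0..<1}. s x = poly (P (cell xs x)) x))"

lemma pwpoly_add:
  assumes "pwpoly k s" "pwpoly k t" shows "pwpoly k (\<lambda>x. s x + t x)"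
proof -
  obtain P Q where "\<forall>i. degree (P i) \<le> k" "\<forall>i. degree (Q i) \<le> k" "\<forall>x\<in>{0..<1}. s x = poly (P (cell xs x)) x"
    "\<forall>x\<in>{0..<1}. t x = poly (Q (cell xs x)) x" using assms unfolding pwpoly_def by metis
  then show ?thesis unfolding pwpoly_def by (intro exI[of _ "\<lambda>i. P i + Q i"]) (auto intro: degree_add_le)
qed

lemma pwpoly_diff:
  assumes "pwpoly k s" "pwpoly k t" shows "pwpoly k (\<lambda>x. s x - t x)"
proof -
  obtain P Q where "\<forall>i. degree (P i) \<le> k" "\<forall>i. degree (Q i) \<le> k" "\<forall>x\<in>{0..<1}. s x = poly (P (cell xs x)) x"
    "\<forall>x\<in>{0..<1}. t x = poly (Q (cell xs x)) x" using assms unfolding pwpoly_def by metis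
  then show ?thesis unfolding pwpoly_def by (intro exI[of _ "\<lambda>i. P i - Q i"]) (auto intro: degree_diff_le)
qed

lemma pwpoly_const_cells: "pwpoly k (\<lambda>x. F (cell xs x))"
  unfolding pwpoly_def by (intro exI[of _ "\<lambda>i. [:F i:]"]) auto

lemma pwpoly_linear_cells: "k \<ge> 1 \<Longrightarrow> pwpoly k (\<lambda>x. F (cell xs x) + G (cell xs x) * (x - left x))"
  unfolding pwpoly_def
  by (intro exI[of _ "\<lambda>i. [:F i - G i * xs ! i, G i:]"]) (auto simp: algebra_simps)

text \<open>Cell by cell, a polynomial times the indicator of the open cell is a limit of test
  functions; the finitely many mesh points do not matter. This is what puts the discrete space
  inside \<open>H01D\<close>.\<close>

lemma pwpoly_test_dense:
  assumes "pwpoly k s" shows "test_dense s"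
proof -
  obtain P where s: "\<And>x. x \<in> {0..<1} \<Longrightarrow> s x = poly (P (cell xs x)) x"
    using assms unfolding pwpoly_def by metis
  define S where "S x = (\<Sum>i<ncells. indicator (icell i) x * poly (P i) x)" for x
  have sS: "s x = S x" if "x \<in> D" for x
    unfolding S_def using that s sum_indicator_cells[of x "\<lambda>i. poly (P i) x"] by auto
  have PL: "L2D (\<lambda>x. indicator (icell i) x * poly (P i) x)" for i
    by (rule L2D_mult_bounded[of _ _ 1])
       (auto intro!: smooth_L2D smooth_poly measurable_leb01 simp: indicator_def)
  have SL: "L2D S" unfolding S_def[abs_def] by (intro L2D_sum PL) auto
  have sm: "s \<in> borel_measurable leb01"
    using measurable_cong[of leb01 s S borel] L2D_measurable[OF SL] sS by auto
  have sL: "L2D s" by (rule L2D_bound(1)[OF sm SL]) (simp add: sS)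
  have "test_dense (\<lambda>x. \<Sum>i<ncells. poly (P i) x * indicator {xs ! i<..<xs ! Suc i} x)"
    using xs_bounds xs_less
    by (intro test_dense_sum test_dense_smooth_indicator smooth_poly) auto
  then show ?thesis
  proof (rule test_dense_cong_AE[OF _ _ sL])
    have "AE x in lborel. x \<notin> set xs"
      by (intro AE_not_in countable_imp_null_set_lborel countable_finite) auto
    then show "AE x in leb01. (\<Sum>i<ncells. poly (P i) x * indicator {xs ! i<..<xs ! Suc i} x) = s x"
      unfolding AE_leb01_iff
    proof eventually_elim
      case (elim x)
      show ?case
      proof
        assume x: "x \<in> D"
        have "(\<Sum>i<ncells. poly (P i) x * indicator {xs ! i<..<xs ! Suc i} x) = S x"
          unfolding S_def
        proof (intro sum.cong refl)
          fix i assume "i \<in> {..<ncells}"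
          then have "xs ! i \<noteq> x" using elim by (metis lessThan_iff nth_mem less_SucI length_xs)
          then show "poly (P i) x * indicator {xs ! i<..<xs ! Suc i} x = indicator (icell i) x * poly (P i) x"
            by (auto simp: indicator_def)
        qed
        then show "(\<Sum>i<ncells. poly (P i) x * indicator {xs ! i<..<xs ! Suc i} x) = s x" using sS[OF x] by simp
      qed
    qed
  qed
qed

lemma pwpoly_L2D: "pwpoly k s \<Longrightarrow> L2D s"
  using pwpoly_test_dense by (auto simp: test_dense_def)

lemma poly_antideriv: "\<exists>A :: real poly. pderiv A = P \<and> degree A \<le> Suc (degree P)"
proof -
  define A where "A = (\<Sum>i\<le>degree P. monom (coeff P i / real (Suc i)) (Suc i))"
  have "coeff (pderiv A) n = coeff P n" for n
  proof -
    have "coeff A (Suc n) = (\<Sum>i\<le>degree P. if i = n then coeff P i / real (Suc i) else 0)"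
      unfolding A_def coeff_sum by (intro sum.cong) auto
    also have "\<dots> = coeff P n / real (Suc n)"
      by (simp add: coeff_eq_0)
    finally show ?thesis by (simp add: coeff_pderiv del: of_nat_Suc)
  qed
  then have "pderiv A = P" by (intro poly_eqI)
  moreover have "degree A \<le> Suc (degree P)"
    unfolding A_def by (intro degree_sum_le) (auto intro: order_trans[OF degree_monom_le])
  ultimately show ?thesis by blast
qed

text \<open>Together with its converse below, this identifies \<open>Vh k xs\<close> on the unit
  interval with the primitives of mean-zero piecewise polynomials, so Galerkin orthogonality becomes
  L2 orthogonality of \<open>T e\<close> to the latter.\<close>

lemma prim_pwpoly_Vh:
  assumes s: "pwpoly k s" and z: "integral\<^sup>L leb01 s = 0"
  shows "prim s \<in> Vh k xs"
  unfolding Vh_def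
proof (intro CollectI conjI allI impI, unfold length_xs diff_Suc_1)
  note sL = pwpoly_L2D[OF s]
  show "continuous_on {0..1} (prim s)" by (rule prim_continuous_on[OF sL])
  show "prim s 0 = 0" "prim s 1 = 0" by (auto simp: prim_0 prim_1 z)
  obtain P where P: "\<And>i. degree (P i) \<le> k" "\<And>x. x \<in> {0..<1} \<Longrightarrow> s x = poly (P (cell xs x)) x"
    using s unfolding pwpoly_def by metis
  fix i assume i: "i < ncells"
  obtain A where A: "pderiv A = P i" "degree A \<le> Suc (degree (P i))" using poly_antideriv by blast
  let ?l = "xs ! i" and ?r = "xs ! Suc i"
  have lr: "0 \<le> ?l" "?l < ?r" "?r \<le> 1" using i xs_bounds[of i] xs_bounds[of "Suc i"] xs_less[of i "Suc i"] by auto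
  have pA: "prim (poly (P i)) x = poly A x - poly A 0" if "x \<in> {0..1}" for x
    using prim_FTC[of "poly A" "{}" "poly (P i)" x] that poly_DERIV[of A] L2D_integrable[OF smooth_L2D[OF smooth_poly, of "P i"]]
    by (simp add: A continuous_on_poly)
  have "prim s x = poly (A + [:prim s ?l - poly A ?l:]) x" if x: "x \<in> {?l..?r}" for x
  proof -
    have "prim s x - prim s ?l = (\<integral>t. indicator {?l..<x} t * s t \<partial>leb01)"
      using x by (intro prim_diff L2D_integrable sL) auto
    also have "\<dots> = (\<integral>t. indicator {?l..<x} t * poly (P i) t \<partial>leb01)"
      using x P(2) cell_eq[OF i] by (intro LINT_cong) (auto simp: indicator_def)
    also have "\<dots> = prim (poly (P i)) x - prim (poly (P i)) ?l"
      using x by (intro prim_diff[symmetric] L2D_integrable smooth_L2D smooth_poly) auto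
    also have "\<dots> = poly A x - poly A ?l" using pA[of x] pA[of ?l] x lr by auto
    finally show ?thesis by simp
  qed
  moreover have "degree (A + [:prim s ?l - poly A ?l:]) \<le> k + 1"
    using A(2) P(1)[of i] by (intro degree_add_le) auto
  ultimately show "\<exists>P. degree P \<le> k + 1 \<and> (\<forall>x\<in>{?l..?r}. prim s x = poly P x)" by blast
qed

lemma Vh_imp_prim:
  assumes v: "v \<in> Vh k xs"
  obtains s where "pwpoly k s" "integral\<^sup>L leb01 s = 0" "\<And>x. x \<in> {0..1} \<Longrightarrow> v x = prim s x"
proof -
  have v': "continuous_on {0..1} v" "v 0 = 0" "v 1 = 0"
    "\<forall>i. \<exists>P. i < ncells \<longrightarrow> degree P \<le> k + 1 \<and> (\<forall>x\<in>{xs ! i..xs ! Suc i}. v x = poly P x)"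
    using v unfolding Vh_def length_xs by auto
  from choice[OF v'(4)] obtain P where P: "\<And>i. i < ncells \<Longrightarrow> degree (P i) \<le> k + 1"
     "\<And>i x. i < ncells \<Longrightarrow> x \<in> {xs ! i..xs ! Suc i} \<Longrightarrow> v x = poly (P i) x" by blast
  \<comment> \<open>Nothing is known of \<open>P i\<close> beyond the last cell, whereas
    \<open>pwpoly\<close> bounds the degree for every index.\<close>
  define Q where "Q i = (if i < ncells then pderiv (P i) else 0)" for i
  define s where "s x = poly (Q (cell xs x)) x" for x
  have "degree (Q i) \<le> k" for i using P(1)[of i] by (auto simp: Q_def degree_pderiv)
  then have pw: "pwpoly k s" unfolding pwpoly_def s_def by blast
  have d: "(v has_real_derivative s x) (at x)" if x: "x \<in> D - set xs" for x
  proof -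
    have x01: "0 \<le> x" "x < 1" using x by auto
    define i where "i = cell xs x"
    have i: "i < ncells" "xs ! i \<le> x" "x < xs ! Suc i" using cell[OF x01] by (auto simp: i_def)
    have "xs ! i \<noteq> x" using x i(1) by (metis DiffE nth_mem less_SucI length_xs)
    then have "\<forall>\<^sub>F y in nhds x. y \<in> {xs ! i<..<xs ! Suc i}"
      using i by (intro eventually_nhds_in_open) auto
    then have "\<forall>\<^sub>F y in nhds x. v y = poly (P i) y"
      by eventually_elim (use P(2)[OF i(1)] in auto)
    moreover have "(poly (P i) has_real_derivative s x) (at x)"
      using poly_DERIV[of "P i" x] i(1) by (simp add: s_def i_def[symmetric] Q_def)
    ultimately show ?thesis by (subst DERIV_cong_ev[OF refl _ refl])
  qed
  have eq: "v x = prim s x" if "x \<in> {0..1}" for x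
    using prim_FTC[OF v'(1) finite_set[of xs] d L2D_integrable[OF pwpoly_L2D[OF pw]] that] v'(2) by simp
  moreover have "integral\<^sup>L leb01 s = 0" using eq[of 1] v'(3) prim_1[of 1 s] by simp
  ultimately show ?thesis using that pw by blast
qed

lemma Vh_H01D:
  assumes s: "pwpoly k s" "integral\<^sup>L leb01 s = 0" and v: "\<And>x. x \<in> {0..1} \<Longrightarrow> v x = prim s x"
  shows "H01D v" "AE x in leb01. wderiv v x = s x"
  using H01D_prim[OF pwpoly_test_dense[OF s(1)] s(2), of v] v by auto

lemma Lipschitz_approx:
  assumes "\<And>s t. 0 \<le> s \<Longrightarrow> s \<le> t \<Longrightarrow> t \<le> 1 \<Longrightarrow> \<bar>f t - f s\<bar> \<le> M * (t - s)" and "0 \<le> M" and x: "x \<in> D"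
  shows "\<bar>f x - f (left x)\<bar> \<le> M * mesh xs"
proof -
  have x01: "0 \<le> x" "x < 1" using x by auto
  have "\<bar>f x - f (left x)\<bar> \<le> M * (x - left x)"
    using left_right_bounds[OF x01] cell[OF x01] x by (intro assms) auto
  also have "\<dots> \<le> M * mesh xs"
    using left_right_bounds[OF x01] cell[OF x01] assms(2) by (intro mult_left_mono) auto
  finally show ?thesis .
qed

end

locale frac_kernel_mesh = frac_kernel + mesh01
begin

lemma ker_approx:
  assumes y: "0 \<le> y" "y \<le> 1"
  obtains s where "pwpoly k s" "L2_norm (\<lambda>t. ker y t - s t) \<le> sqrt (2 / \<eta>) * mesh xs powr (\<alpha> - 3/2)"
proof -
  define s where "s t = (if right t \<le> y then ker y (left t) else 0)" for t
  have pw: "pwpoly k s"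
    unfolding s_def by (rule pwpoly_const_cells[of k "\<lambda>i. if xs ! Suc i \<le> y then ker y (xs ! i) else 0"])
  have "L2_norm (\<lambda>t. ker y t - s t) \<le> sqrt (2 / \<eta>) * mesh xs powr (\<alpha> - 3/2)"
  proof (rule ker_approx_norm[OF y])
    show "0 \<le> mesh xs" using mesh_pos by simp
    show "s \<in> borel_measurable leb01" by (rule L2D_measurable[OF pwpoly_L2D[OF pw]])
    fix t :: real assume "t \<in> D"
    then have t: "0 \<le> t" "t < 1" by auto
    note c = cell[OF t] left_right_bounds[OF t]
    show "\<bar>ker y t - s t\<bar> \<le> indicator {..<y} t * \<bar>ker y t - ker (y + mesh xs) t\<bar>
       \<or> \<bar>ker y t - s t\<bar> \<le> indicator {y - mesh xs..<y} t * ker y t"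
    proof (cases "right t \<le> y")
      case True
      \<comment> \<open>The left end lies between t - h and t and the exponent is negative, so the
        constant is squeezed between the kernel shifted by h and the kernel itself.\<close>
      have "(y + mesh xs - t) powr (\<alpha> - 2) \<le> (y - left t) powr (\<alpha> - 2)"
        "(y - left t) powr (\<alpha> - 2) \<le> (y - t) powr (\<alpha> - 2)"
        using True c \<alpha> by (auto intro!: powr_mono2')
      then have "ker (y + mesh xs) t \<le> s t" "s t \<le> ker y t"
        using True c mesh_pos by (auto simp: ker_def s_def)
      then show ?thesis using True c by auto
    next
      case False
      then have "s t = 0" by (simp add: s_def)
      moreover have "y - mesh xs \<le> t" using False c by linarith
      ultimately have "\<bar>ker y t - s t\<bar> \<le> indicator {y - mesh xs..<y} t * ker y t"
        by (auto simp: ker_def indicator_def)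
      then show ?thesis by blast
    qed
  qed
  with that pw show ?thesis by blast
qed

end

section \<open>Error analysis\<close>

lemma prim_powr:
  assumes "0 \<le> s" "s \<le> t" "t \<le> 1" "e > -1"
  shows "integrable leb01 (\<lambda>x. x powr e)"
    and "prim (\<lambda>x. x powr e) t - prim (\<lambda>x. x powr e) s = (t powr (e + 1) - s powr (e + 1)) / (e + 1)"
proof -
  have "integrable leb01 (\<lambda>t. indicator {0..<1} t * t powr e)"
    by (rule integral_powr) (use assms in auto)
  then show i: "integrable leb01 (\<lambda>x. x powr e)"
    by (subst (asm) Bochner_Integration.integrable_cong[OF refl, of _ _ "\<lambda>x. x powr e"]) auto
  show "prim (\<lambda>x. x powr e) t - prim (\<lambda>x. x powr e) s = (t powr (e + 1) - s powr (e + 1)) / (e + 1)"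
    using prim_diff[OF i assms(2)] integral_powr(2)[OF assms] by simp
qed

context mesh01
begin

text \<open>On a cell, Cauchy-Schwarz bounds the squared integral of \<omega> by the cell length
  times the integral of its square. Integrating this constant over the cell costs the length once
  more, and summing gives h^2 for the squared norms.\<close>

lemma cell_integral_norm:
  assumes \<omega>: "L2D \<omega>"
  shows "L2_norm (\<lambda>x. \<integral>t. indicator {left x..<right x} t * \<omega> t \<partial>leb01) \<le> mesh xs * L2_norm \<omega>"
proof -
  let ?c = "\<lambda>i t. indicator (icell i) t * \<omega> t"
  define I where "I i = (\<integral>t. indicator (icell i) t * \<omega> t \<partial>leb01)" for i
  have ind: "indicator (icell i) \<in> borel_measurable leb01" for i
    by (rule measurable_leb01) simp
  have L: "L2D (?c i)" for i
    by (rule L2D_mult_bounded[where B=1, OF \<omega> ind]) (auto simp: indicator_def)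
  have sq: "integrable leb01 (\<lambda>t. (\<omega> t)^2)" using \<omega> by (simp add: L2D_iff)
  have I_le: "(I i)^2 \<le> mesh xs * (\<integral>t. indicator (icell i) t * (\<omega> t)^2 \<partial>leb01)" (is "_ \<le> _ * ?N")
    if i: "i < ncells" for i
  proof -
    have b: "0 \<le> xs ! i" "xs ! i \<le> xs ! Suc i" "xs ! Suc i \<le> 1"
      using i xs_bounds[of i] xs_bounds[of "Suc i"] xs_le[of i "Suc i"] by auto
    have N: "(L2_norm (?c i))^2 = ?N"
      unfolding L2_norm_power2 by (intro LINT_cong) (auto simp: indicator_def)
    have "prim (?c i) (xs ! Suc i) - prim (?c i) (xs ! i) = I i"
      unfolding prim_diff[OF L2D_integrable[OF L] b(2)] I_def
      by (intro LINT_cong) (auto simp: indicator_def)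
    then have "\<bar>I i\<bar> \<le> L2_norm (?c i) * sqrt (xs ! Suc i - xs ! i)"
      using prim_Holder[OF L b] by metis
    then have "\<bar>I i\<bar>^2 \<le> (L2_norm (?c i) * sqrt (xs ! Suc i - xs ! i))^2"
      by (intro power_mono) auto
    also have "\<dots> = ?N * (xs ! Suc i - xs ! i)"
      using b by (simp add: power_mult_distrib N)
    also have "\<dots> \<le> ?N * mesh xs"
      unfolding N[symmetric] using cell_length_le[OF i] by (intro mult_left_mono) auto
    finally show ?thesis by (simp add: mult.commute)
  qed
  have HL: "L2D (\<lambda>x. I (cell xs x))" by (rule pwpoly_L2D[OF pwpoly_const_cells[of 0 I]])
  have "(L2_norm (\<lambda>x. I (cell xs x)))^2 = (\<Sum>i<ncells. \<integral>x. indicator (icell i) x * (I (cell xs x))^2 \<partial>leb01)"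
    unfolding L2_norm_power2 using HL by (intro integral_cells) (simp add: L2D_iff)
  also have "\<dots> = (\<Sum>i<ncells. (I i)^2 * (xs ! Suc i - xs ! i))"
  proof (intro sum.cong refl)
    fix i assume "i \<in> {..<ncells}"
    then have i: "i < ncells" by simp
    have b: "0 \<le> xs ! i" "xs ! i \<le> xs ! Suc i" "xs ! Suc i \<le> 1"
      using i xs_bounds[of i] xs_bounds[of "Suc i"] xs_le[of i "Suc i"] by auto
    have "(\<integral>x. indicator (icell i) x * (I (cell xs x))^2 \<partial>leb01) = (\<integral>x. (I i)^2 * indicator (icell i) x \<partial>leb01)"
      using cell_eq[OF i] by (intro LINT_cong) (auto simp: indicator_def)
    then show "(\<integral>x. indicator (icell i) x * (I (cell xs x))^2 \<partial>leb01) = (I i)^2 * (xs ! Suc i - xs ! i)"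
      using integral_leb01_indicator[OF b] by simp
  qed
  also have "\<dots> \<le> (\<Sum>i<ncells. (mesh xs * (\<integral>t. indicator (icell i) t * (\<omega> t)^2 \<partial>leb01)) * mesh xs)"
  proof (intro sum_mono mult_mono)
    fix i assume i: "i \<in> {..<ncells}"
    show "(I i)^2 \<le> mesh xs * (\<integral>t. indicator (icell i) t * (\<omega> t)^2 \<partial>leb01)" using I_le i by simp
    then show "0 \<le> mesh xs * (\<integral>t. indicator (icell i) t * (\<omega> t)^2 \<partial>leb01)"
      by (rule order_trans[OF zero_le_power2])
    show "xs ! Suc i - xs ! i \<le> mesh xs" using cell_length_le i by simp
    show "0 \<le> xs ! Suc i - xs ! i" using xs_le[of i "Suc i"] i by simp
  qed
  also have "\<dots> = (mesh xs)^2 * (\<integral>t. (\<omega> t)^2 \<partial>leb01)"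
    unfolding integral_cells[OF sq] by (simp add: sum_distrib_left power2_eq_square ac_simps)
  also have "\<dots> = (mesh xs * L2_norm \<omega>)^2"
    by (simp add: power_mult_distrib L2_norm_power2)
  finally have "L2_norm (\<lambda>x. I (cell xs x)) \<le> mesh xs * L2_norm \<omega>"
    by (rule power2_le_imp_le) (use mesh_pos in simp)
  then show ?thesis by (simp add: I_def)
qed

text \<open>A Taylor expansion at the left end of each cell. As the derivative of m may be singular,
  m is controlled by increments of \<open>prim \<omega>\<close> instead of a Lipschitz constant: the
  error on a cell is at most h times the integral of \<omega> over that cell, and
  \<open>cell_integral_norm\<close> supplies the second factor h.\<close>

lemma linear_approx:
  assumes m: "m \<in> borel_measurable leb01" "\<And>x. x \<in> D \<Longrightarrow> \<bar>m x\<bar> \<le> L"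
    and \<omega>: "L2D \<omega>" "\<And>t. 0 \<le> \<omega> t"
    and mw: "\<And>s t. 0 \<le> s \<Longrightarrow> s \<le> t \<Longrightarrow> t \<le> 1 \<Longrightarrow> \<bar>m t - m s\<bar> \<le> prim \<omega> t - prim \<omega> s"
  shows "L2_norm (\<lambda>x. (c + prim m x) - ((c + prim m (left x)) + m (left x) * (x - left x))) \<le> (mesh xs)^2 * L2_norm \<omega>"
proof -
  note mL = L2D_bounded(1)[OF m]
  note mi = L2D_integrable[OF mL]
  note wi = L2D_integrable[OF \<omega>(1)]
  define H where "H x = (\<integral>t. indicator {left x..<right x} t * \<omega> t \<partial>leb01)" for x
  have HL: "L2D H" unfolding H_def[abs_def]
    by (rule pwpoly_L2D[OF pwpoly_const_cells[of 0 "\<lambda>i. \<integral>t. indicator (icell i) t * \<omega> t \<partial>leb01"]])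
  let ?s = "\<lambda>x. (c + prim m (left x)) + m (left x) * (x - left x)"
  have sL: "L2D ?s"
    by (rule pwpoly_L2D[OF pwpoly_linear_cells[of 1 "\<lambda>i. c + prim m (xs ! i)" "\<lambda>i. m (xs ! i)"]]) simp
  have pm: "prim \<omega> s \<le> prim \<omega> t" if "s \<le> t" for s t
    using prim_diff[OF wi that] \<omega>(2) by (smt (verit) integral_nonneg_AE AE_I2 mult_nonneg_nonneg indicator_pos_le)
  have "L2_norm (\<lambda>x. (c + prim m x) - ?s x) \<le> L2_norm (\<lambda>x. mesh xs * H x)"
  proof (rule L2D_bound(2)[OF _ L2D_cmult[OF HL]])
    show "(\<lambda>x. (c + prim m x) - ?s x) \<in> borel_measurable leb01"
      by (intro L2D_measurable L2D_diff L2D_add L2D_const L2D_prim mL sL)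
    fix x :: real assume "x \<in> D"
    then have x: "0 \<le> x" "x < 1" by auto
    note cl = cell[OF x] left_right_bounds[OF x]
    define l r where "l = left x" and "r = right x"
    have lr: "0 \<le> l" "l \<le> x" "x \<le> r" "r \<le> 1" "x \<le> 1" "l \<le> r" "r - l \<le> mesh xs"
      using cl x by (auto simp: l_def r_def)
    have HW: "H x = prim \<omega> r - prim \<omega> l"
      unfolding H_def l_def[symmetric] r_def[symmetric] using prim_diff[OF wi lr(6)] by simp
    have H0: "0 \<le> H x" using HW pm[OF lr(6)] by simp
    \<comment> \<open>Cut off outside the stretch from l to x, so that the bound by
      \<open>H x\<close>, valid only within the cell, holds for all t.\<close>
    define b where "b t = indicator {l..<x} t * (m t - m l)" for t
    have bL: "L2D b" unfolding b_def[abs_def]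
      by (rule L2D_mult_bounded[of _ _ 1])
         (auto intro!: L2D_diff mL L2D_const measurable_leb01 simp: indicator_def)
    have bb: "\<bar>b t\<bar> \<le> H x" for t
    proof (cases "t \<in> {l..<x}")
      case True
      then have "\<bar>m t - m l\<bar> \<le> prim \<omega> t - prim \<omega> l" using lr by (intro mw) auto
      also have "\<dots> \<le> H x" unfolding HW using pm[of t r] True lr by simp
      finally show ?thesis using True by (simp add: b_def)
    qed (use H0 in \<open>simp add: b_def\<close>)
    have ib: "(\<integral>t. indicator {l..<x} t * m l \<partial>leb01) = m l * (x - l)"
      using integral_leb01_indicator[OF lr(1,2,5)] by (subst mult.commute) simp
    have "(c + prim m x) - ?s x = (prim m x - prim m l) - m l * (x - l)" by (simp add: l_def)
    also have "\<dots> = (\<integral>t. indicator {l..<x} t * m t \<partial>leb01) - (\<integral>t. indicator {l..<x} t * m l \<partial>leb01)"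
      by (rule arg_cong2[where f="(-)", OF prim_diff[OF mi lr(2)] ib[symmetric]])
    also have "\<dots> = (\<integral>t. indicator {l..<x} t * m t - indicator {l..<x} t * m l \<partial>leb01)"
      by (intro Bochner_Integration.integral_diff[symmetric] integrable_indicator_mult mi) auto
    also have "\<dots> = (\<integral>t. indicator {l..<x} t * b t \<partial>leb01)"
      by (intro LINT_cong) (auto simp: b_def indicator_def)
    finally have "\<bar>(c + prim m x) - ?s x\<bar> \<le> H x * (x - l)"
      using integral_indicator_bounded_le[OF L2D_measurable[OF bL] bb lr(1,2,5)] by simp
    also have "\<dots> \<le> H x * mesh xs" using lr H0 by (intro mult_left_mono) auto
    finally show "\<bar>(c + prim m x) - ?s x\<bar> \<le> \<bar>mesh xs * H x\<bar>"
      using H0 mesh_pos by (simp add: abs_mult mult.commute)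
  qed
  also have "\<dots> = mesh xs * L2_norm H" using mesh_pos by (simp add: L2_norm_cmult)
  also have "\<dots> \<le> mesh xs * (mesh xs * L2_norm \<omega>)"
    unfolding H_def[abs_def] using mesh_pos by (intro mult_left_mono cell_integral_norm \<omega>) auto
  finally show ?thesis by (simp add: power2_eq_square mult.assoc)
qed

end

section \<open>Galerkin error, regularity of the solution, and its approximation by piecewise
  polynomials\<close>

context frac_problem
begin

definition C1 :: real where "C1 = sqrt (2 / \<eta>) / Gamma (\<alpha> - 1)"

lemma C1_nonneg: "0 \<le> C1" using \<eta> Gamma_pos by (simp add: C1_def)

lemma T_integral:
  assumes "L2D g" "integral\<^sup>L leb01 g = 0" shows "integral\<^sup>L leb01 (T g) = 0"
  unfolding T_def using L2D_integrable[OF assms(1)] L2D_integrable[OF J_L2D[OF Z_bounded_by[OF assms(1)]]]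
    J_integral[OF Z_bounded_by[OF assms(1)]] assms(2) by simp

lemma T_diff:
  assumes "L2D f" "L2D g" shows "T (\<lambda>x. f x - g x) x = T f x - T g x"
proof -
  have "J (Z (\<lambda>x. f x - g x)) = J (\<lambda>x. Z f x - Z g x)"
    by (intro J_cong Z_diff assms) auto
  then show ?thesis using J_diff[OF Z_bounded_by[OF assms(1)] Z_bounded_by[OF assms(2)], of x]
    by (simp add: T_def)
qed

text \<open>With \<open>r = T e\<close> orthogonal to the piecewise polynomials, \<open>Z r x\<close> only sees the distance of the kernel
  to that space; stability turns this into a bound for \<open>Z e\<close>, which is then absorbed.\<close>

lemma galerkin_error:
  assumes C: "stable C" and part: "partition01 xs"
    and g: "L2D g" and gh: "mesh01.pwpoly xs k gh" and z: "integral\<^sup>L leb01 g = 0" "integral\<^sup>L leb01 gh = 0"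
    and orth: "\<And>s. mesh01.pwpoly xs k s \<Longrightarrow> integral\<^sup>L leb01 s = 0 \<Longrightarrow> (\<integral>x. T (\<lambda>x. g x - gh x) x * s x \<partial>leb01) = 0"
    and s1: "mesh01.pwpoly xs k s1" "L2_norm (\<lambda>x. g x - s1 x) \<le> \<epsilon>"
    and h: "mesh xs \<le> 1" "2 * Cm * C * C1 * mesh xs \<le> 1" and x: "x \<in> {0..1}"
  shows "\<bar>Z (\<lambda>x. g x - gh x) x\<bar> \<le> 2 * C * C1 * mesh xs powr (\<alpha> - 3/2) * \<epsilon>"
proof -
  interpret frac_kernel_mesh \<alpha> xs by unfold_locales (fact part)
  define h where "h = mesh xs"
  define e where "e = (\<lambda>x. g x - gh x)"
  have h0: "0 < h" "h \<le> 1" using mesh_pos h by (auto simp: h_def)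
  have C0: "0 \<le> C" using C by (simp add: stable_def)
  have ghL: "L2D gh" by (rule pwpoly_L2D[OF gh])
  have eL: "L2D e" unfolding e_def by (intro L2D_diff g ghL)
  have e0: "integral\<^sup>L leb01 e = 0" unfolding e_def using L2D_integrable[OF g] L2D_integrable[OF ghL] z by simp
  note rL = T_L2D[OF eL]
  \<comment> \<open>\<open>T e\<close> itself has mean zero, so orthogonality extends from the
    mean-zero piecewise polynomials to all of them, in particular to the approximations of the
    kernel.\<close>
  have orth': "(\<integral>x. T e x * s x \<partial>leb01) = 0" if s: "pwpoly k s" for s
  proof -
    define a where "a = integral\<^sup>L leb01 s"
    note sL = pwpoly_L2D[OF s]
    have pw: "pwpoly k (\<lambda>x. s x - a)" by (intro pwpoly_diff s pwpoly_const_cells[of k "\<lambda>_. a"])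
    have "integral\<^sup>L leb01 (\<lambda>x. s x - a) = 0" using L2D_integrable[OF sL] by (simp add: a_def)
    then have "(\<integral>x. T e x * (s x - a) \<partial>leb01) = 0" using orth pw unfolding e_def by blast
    moreover have "(\<lambda>x. T e x * (s x - a)) = (\<lambda>x. T e x * s x - a * T e x)"
      by (simp add: fun_eq_iff algebra_simps)
    ultimately have "(\<integral>x. T e x * s x - a * T e x \<partial>leb01) = 0" by simp
    then show ?thesis using L2D_mult_integrable[OF rL sL] L2D_integrable[OF rL] T_integral[OF eL e0] by simp
  qed
  define t where "t = L2_norm (T e)"
  define E where "E = C * (C1 * h powr (\<alpha> - 3/2) * t)"
  have t0: "0 \<le> t" by (simp add: t_def)
  have "\<bar>Z (T e) y\<bar> \<le> C1 * h powr (\<alpha> - 3/2) * t" if y: "y \<in> {0..1}" for y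
  proof -
    have y01: "0 \<le> y" "y \<le> 1" using y by auto
    obtain s where s: "pwpoly k s" "L2_norm (\<lambda>t. ker y t - s t) \<le> sqrt (2 / \<eta>) * h powr (\<alpha> - 3/2)"
      using ker_approx[OF y01] unfolding h_def by blast
    note sL = pwpoly_L2D[OF s(1)] and kL = ker_L2D(1)[OF y01]
    have "(\<integral>x. ker y x * T e x \<partial>leb01) = (\<integral>x. (ker y x - s x) * T e x \<partial>leb01)"
      using orth'[OF s(1)] L2D_mult_integrable[OF kL rL] L2D_mult_integrable[OF rL sL]
      by (simp add: left_diff_distrib mult.commute[of "s _"])
    also have "\<bar>\<dots>\<bar> \<le> L2_norm (\<lambda>t. ker y t - s t) * t"
      unfolding t_def by (intro L2_Cauchy_Schwarz L2D_diff kL sL rL)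
    also have "\<dots> \<le> sqrt (2 / \<eta>) * h powr (\<alpha> - 3/2) * t"
      by (intro mult_right_mono s t0)
    finally show ?thesis using Gamma_pos by (simp add: Z_def C1_def abs_divide divide_right_mono)
  qed
  then have ZE: "\<bar>Z e y\<bar> \<le> E" if "y \<in> {0..1}" for y
    using C eL e0 that unfolding stable_def E_def by blast
  then have bE: "bounded_by E (Z e)" using Z_bounded_by[OF eL] by (simp add: bounded_by_def)
  define s2 where "s2 x = J (Z e) (left x)" for x
  have s2: "pwpoly k s2" unfolding s2_def by (rule pwpoly_const_cells[of k "\<lambda>i. J (Z e) (xs ! i)"])
  note JL = J_L2D[OF bE] and s2L = pwpoly_L2D[OF s2] and s1L = pwpoly_L2D[OF s1(1)]
  have n2: "L2_norm (\<lambda>x. J (Z e) x - s2 x) \<le> Cm * E * h"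
  proof (rule L2D_bounded(2))
    show "(\<lambda>x. J (Z e) x - s2 x) \<in> borel_measurable leb01" by (intro L2D_measurable L2D_diff JL s2L)
    show "\<bar>J (Z e) x - s2 x\<bar> \<le> Cm * E * h" if "x \<in> D" for x
      unfolding s2_def h_def using bounded_by_nonneg[OF bE] Cm_nonneg that
      by (intro Lipschitz_approx J_Lipschitz[OF bE]) auto
  qed
  \<comment> \<open>\<open>gh\<close> is itself a piecewise polynomial and cancels: what is left of
    \<open>T e\<close> is the approximation error of \<open>g\<close> plus that of
    \<open>J (Z e)\<close>.\<close>
  define s where "s = (\<lambda>x. (s1 x - gh x) + s2 x)"
  have spw: "pwpoly k s" unfolding s_def by (intro pwpoly_add pwpoly_diff s1 gh s2)
  note sL = pwpoly_L2D[OF spw]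
  have "t^2 = (\<integral>x. T e x * T e x \<partial>leb01)" unfolding t_def L2_norm_power2 by (simp add: power2_eq_square)
  also have "\<dots> = (\<integral>x. T e x * (T e x - s x) \<partial>leb01)"
    using orth'[OF spw] L2D_mult_integrable[OF rL rL] L2D_mult_integrable[OF rL sL] by (simp add: right_diff_distrib)
  also have "\<dots> \<le> t * L2_norm (\<lambda>x. T e x - s x)"
    using L2_Cauchy_Schwarz[OF rL L2D_diff[OF rL sL]] unfolding t_def by linarith
  finally have tt: "t \<le> L2_norm (\<lambda>x. T e x - s x)"
    using t0 by (cases "t = 0") (auto simp: power2_eq_square)
  also have "(\<lambda>x. T e x - s x) = (\<lambda>x. (g x - s1 x) + (J (Z e) x - s2 x))"
    by (auto simp: T_def s_def e_def)
  also have "L2_norm \<dots> \<le> L2_norm (\<lambda>x. g x - s1 x) + L2_norm (\<lambda>x. J (Z e) x - s2 x)"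
    by (intro L2_norm_add L2D_diff g s1L JL s2L)
  also have "\<dots> \<le> \<epsilon> + Cm * E * h" using s1(2) n2 by simp
  \<comment> \<open>\<open>E\<close> is proportional to t, so this term is a multiple of h t; the
    smallness hypothesis on the mesh makes it half of the left-hand side.\<close>
  also have "Cm * E * h \<le> t / 2"
  proof -
    have hp: "h powr (\<alpha> - 3/2) \<le> 1" using h0 \<alpha> by (intro powr_le1) auto
    have "Cm * E * h = (Cm * C * C1 * h * t) * h powr (\<alpha> - 3/2)" by (simp add: E_def)
    also have "\<dots> \<le> (Cm * C * C1 * h * t) * 1"
      using hp Cm_nonneg C0 C1_nonneg h0 t0 by (intro mult_left_mono) auto
    also have "\<dots> = (2 * Cm * C * C1 * h) * (t / 2)" by simp
    also have "\<dots> \<le> 1 * (t / 2)" using h(2) t0 unfolding h_def by (intro mult_right_mono) auto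
    finally show ?thesis by simp
  qed
  finally have t2: "t \<le> 2 * \<epsilon>" by simp
  have "\<bar>Z e x\<bar> \<le> E" by (rule ZE[OF x])
  also have "E = C * C1 * h powr (\<alpha> - 3/2) * t" by (simp add: E_def)
  also have "\<dots> \<le> C * C1 * h powr (\<alpha> - 3/2) * (2 * \<epsilon>)"
    using t2 C0 C1_nonneg by (intro mult_left_mono) auto
  finally show ?thesis by (simp add: e_def h_def)
qed

text \<open>Per unit of \<open>H1_norm f\<close>: \<open>Cm\<close> times the bound
  \<open>2 * C * CZ\<close> for \<open>Z g\<close>, plus 2 from the sup bound of
  \<open>repr f\<close>.\<close>

definition KL :: "real \<Rightarrow> real" where "KL C = 2 * Cm * C * CZ + 2"

text \<open>The equation says that \<open>T g\<close> has weak derivative -f, so \<open>T g\<close>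
  is a constant minus the primitive of f and its L2 norm is at most twice the norm of f. Stability
  turns this into a sup bound for \<open>Z g\<close>; removing \<open>J (Z g)\<close>, also a
  constant minus a primitive, displays the derivative of \<open>g\<close>.\<close>

lemma solution_regularity:
  assumes C: "stable C" and g: "L2D g" "integral\<^sup>L leb01 g = 0" and f: "H1D f"
    and eq: "\<And>\<phi>. test_fun \<phi> \<Longrightarrow> (\<integral>x. T g x * deriv \<phi> x \<partial>leb01) = (\<integral>x. f x * \<phi> x \<partial>leb01)"
  obtains c where "AE x in leb01. g x = c + prim (\<lambda>x. low (Z g) x - repr f x) x"
    "bounded_by (KL C * H1_norm f) (\<lambda>x. low (Z g) x - repr f x)" "\<bar>c\<bar> \<le> KL C * H1_norm f"
    "bounded_by (2 * C * CZ * H1_norm f) (Z g)"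
proof -
  define m where "m = (\<lambda>x. low (Z g) x - repr f x)"
  define F where "F = H1_norm f"
  have F0: "0 \<le> F" using H1_norm_ge(3)[OF f] by (simp add: F_def)
  have C0: "0 \<le> C" using C by (simp add: stable_def)
  have fL: "L2D f" using f by (simp add: H1D_def)
  have rL: "L2D (repr f)" using repr(1)[OF f] test_dense_continuous by (auto simp: test_dense_def)
  have rb: "bounded_by (2 * F) (repr f)"
    unfolding bounded_by_def F_def using repr(3)[OF f] continuous_on_measurable_leb01[OF repr(1)[OF f]] by auto
  have rn: "L2_norm (repr f) \<le> F"
    using L2_norm_cong_AE[OF repr(2)[OF f] L2D_measurable[OF fL] L2D_measurable[OF rL]] H1_norm_ge(1)[OF f] by (simp add: F_def)
  note TL = T_L2D[OF g(1)]
  have neg: "L2D (\<lambda>x. (-1) * repr f x)" by (rule L2D_cmult[OF rL])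
  have "is_weak_deriv (T g) (\<lambda>x. (-1) * repr f x)"
    unfolding is_weak_deriv_iff
  proof (intro allI impI)
    fix \<phi> assume \<phi>: "test_fun \<phi>"
    have "(\<integral>x. f x * \<phi> x \<partial>leb01) = (\<integral>x. repr f x * \<phi> x \<partial>leb01)"
      using repr(2)[OF f] L2D_measurable[OF fL] L2D_measurable[OF rL] L2D_measurable[OF test_fun_L2D[OF \<phi>]]
      by (intro integral_cong_AE) auto
    then show "(\<integral>x. T g x * deriv \<phi> x \<partial>leb01) = - (\<integral>x. (-1) * repr f x * \<phi> x \<partial>leb01)"
      using eq[OF \<phi>] by simp
  qed
  from weak_deriv_imp_prim[OF TL neg this] obtain c' where c': "AE x in leb01. T g x = c' + prim (\<lambda>x. (-1) * repr f x) x" by blast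
  have "prim (\<lambda>x. (-1) * repr f x) x = - prim (repr f) x" for x
    by (subst prim_cmult) simp
  then have c'2: "AE x in leb01. T g x = c' - prim (repr f) x" using c' by simp
  have pr: "\<bar>prim (repr f) x\<bar> \<le> F" for x
    using prim_abs_le[OF L2D_integrable[OF rL]] L1_le_L2_norm(1)[OF rL] rn by (meson order_trans)
  have pL: "L2D (prim (repr f))" by (rule L2D_prim[OF rL])
  \<comment> \<open>The mean zero of \<open>T g\<close> fixes the integration constant and thereby
    bounds it by f.\<close>
  have cc: "c' = integral\<^sup>L leb01 (prim (repr f))"
  proof -
    have "integral\<^sup>L leb01 (T g) = (\<integral>x. c' - prim (repr f) x \<partial>leb01)"
      using c'2 TL pL by (intro integral_cong_AE L2D_measurable L2D_diff L2D_const) auto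
    then show ?thesis using T_integral[OF g] L2D_integrable[OF pL] by simp
  qed
  have pn: "L2_norm (prim (repr f)) \<le> F" by (rule L2D_bounded[OF L2D_measurable[OF pL] pr])
  have c'F: "\<bar>c'\<bar> \<le> F" unfolding cc using L1_le_L2_norm(2)[OF pL] pn by simp
  have "L2_norm (T g) = L2_norm (\<lambda>x. c' - prim (repr f) x)"
    by (intro L2_norm_cong_AE c'2 L2D_measurable TL L2D_diff L2D_const pL)
  also have "\<dots> \<le> L2_norm (\<lambda>_. c') + L2_norm (prim (repr f))"
    by (intro L2_norm_diff L2D_const pL)
  also have "\<dots> \<le> 2 * F" using pn c'F by (simp add: L2_norm_const)
  finally have Tn: "L2_norm (T g) \<le> 2 * F" .
  have "\<bar>Z (T g) x\<bar> \<le> CZ * (2 * F)" if "x \<in> {0..1}" for x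
    using that CZ_pos by (intro order_trans[OF Z_bound[OF TL]] mult_left_mono Tn) auto
  then have Zb: "\<bar>Z g x\<bar> \<le> C * (CZ * (2 * F))" if "x \<in> {0..1}" for x
    using C g that unfolding stable_def by blast
  define E where "E = 2 * C * CZ * F"
  have bE: "bounded_by E (Z g)"
    using Zb Z_bounded_by[OF g(1)] by (auto simp: bounded_by_def E_def mult_ac)
  note lb = low_bounded[OF bE] and lL = low_L2D[OF bE]
  have mb: "bounded_by (KL C * F) m"
    unfolding bounded_by_def
  proof
    show "m \<in> borel_measurable leb01" unfolding m_def by (intro L2D_measurable L2D_diff lL rL)
    show "\<forall>x\<in>{0..1}. \<bar>m x\<bar> \<le> KL C * F"
    proof
      fix x :: real assume x: "x \<in> {0..1}"
      have "\<bar>m x\<bar> \<le> \<bar>low (Z g) x\<bar> + \<bar>repr f x\<bar>" unfolding m_def by (rule abs_triangle_ineq4)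
      also have "\<dots> \<le> Cm * E + 2 * F" using bounded_byD[OF lb x] bounded_byD[OF rb x] by simp
      finally show "\<bar>m x\<bar> \<le> KL C * F" by (simp add: KL_def E_def algebra_simps)
    qed
  qed
  define c where "c = c' - integral\<^sup>L leb01 (prim (low (Z g)))"
  have gc: "AE x in leb01. g x = c + prim m x"
    using c'2
  proof eventually_elim
    case (elim x)
    have "prim m x = prim (low (Z g)) x - prim (repr f) x"
      unfolding m_def by (intro prim_minus L2D_integrable lL rL)
    then show ?case using elim by (simp add: T_def J_def c_def)
  qed
  have mL: "L2D m" using bounded_by_L2D(1)[OF mb] .
  have "integral\<^sup>L leb01 g = (\<integral>x. c + prim m x \<partial>leb01)"
    using gc g(1) L2D_prim[OF mL] by (intro integral_cong_AE L2D_measurable L2D_add L2D_const) auto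
  then have cm: "c = - integral\<^sup>L leb01 (prim m)"
    using g(2) L2D_integrable[OF L2D_prim[OF mL]] by simp
  have "\<bar>prim m x\<bar> \<le> KL C * F" for x
    using prim_abs_le[OF L2D_integrable[OF mL]] L1_le_L2_norm(1)[OF mL] bounded_by_L2D(2)[OF mb] by (meson order_trans)
  then have "L2_norm (prim m) \<le> KL C * F" by (intro L2D_bounded prim_measurable mL)
  then have "\<bar>c\<bar> \<le> KL C * F" using L1_le_L2_norm(2)[OF L2D_prim[OF mL]] unfolding cm by simp
  with that gc mb bE show ?thesis unfolding m_def F_def E_def by blast
qed

lemma powr_L2D: "L2D (\<lambda>x. x powr (\<alpha> - 2))"
proof -
  have "integrable leb01 (\<lambda>x. x powr (2 * \<alpha> - 4))"
    using prim_powr(1)[of 0 0 "2 * \<alpha> - 4"] \<alpha> by simp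
  moreover have "(\<lambda>x. (x powr (\<alpha> - 2))^2) = (\<lambda>x. x powr (2 * \<alpha> - 4))"
    by (simp add: power2_eq_square powr_add[symmetric] fun_eq_iff)
  moreover have "(\<lambda>x. x powr (\<alpha> - 2)) \<in> borel_measurable leb01" by (intro measurable_leb01) measurable
  ultimately show ?thesis by (simp add: L2D_iff)
qed

text \<open>One K serves all f, g and meshes. For k = 0 it suffices that \<open>g\<close> has a
  bounded derivative m; for k = 1 the derivative of m must be dominated by a square integrable
  function of norm proportional to that of f.\<close>

lemma solution_approx:
  assumes C: "stable C" and k: "k \<in> {0, 1}"
  shows "\<exists>K\<ge>0. \<forall>f g xs. H1D f \<longrightarrow> L2D g \<longrightarrow> integral\<^sup>L leb01 g = 0 \<longrightarrow>
     (\<forall>\<phi>. test_fun \<phi> \<longrightarrow> (\<integral>x. T g x * deriv \<phi> x \<partial>leb01) = (\<integral>x. f x * \<phi> x \<partial>leb01)) \<longrightarrow>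
     partition01 xs \<longrightarrow> (\<exists>s. mesh01.pwpoly xs k s \<and> L2_norm (\<lambda>x. g x - s x) \<le> K * mesh xs ^ (k + 1) * H1_norm f)"
proof -
  have C0: "0 \<le> C" using C by (simp add: stable_def)
  have KL0: "0 \<le> KL C" using Cm_nonneg C0 CZ_pos by (simp add: KL_def)
  define E0 where "E0 = 2 * C * CZ"
  have E00: "0 \<le> E0" using C0 CZ_pos by (simp add: E0_def)
  define a where "a = 2 * H1_norm q * KL C / ((\<alpha> - 1) * Gamma (\<alpha> - 1))"
  have a0: "0 \<le> a" using H1_norm_ge(3)[OF q] KL0 \<alpha> Gamma_pos by (simp add: a_def)
  \<comment> \<open>The derivative of the majorant in \<open>Z_regularity\<close>: its primitive has
    exactly those increments.\<close>
  define \<omega>0 where "\<omega>0 = (\<lambda>t :: real. (\<alpha> - 1) * t powr (\<alpha> - 2) + t powr (\<alpha> - 1))"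
  have pL1: "L2D (\<lambda>t. t powr (\<alpha> - 1))"
    using \<alpha> by (intro L2D_bounded[of _ 1] measurable_leb01) (auto intro!: powr_le1)
  have \<omega>0L: "L2D \<omega>0" unfolding \<omega>0_def by (intro L2D_add L2D_cmult powr_L2D pL1)
  have \<omega>0_prim: "prim \<omega>0 t - prim \<omega>0 s = (t powr (\<alpha> - 1) - s powr (\<alpha> - 1)) + (t powr \<alpha> - s powr \<alpha>) / \<alpha>"
    if st: "0 \<le> s" "s \<le> t" "t \<le> 1" for s t
  proof -
    have i: "integrable leb01 (\<lambda>t. (\<alpha> - 1) * t powr (\<alpha> - 2))" "integrable leb01 (\<lambda>t. t powr (\<alpha> - 1))"
      by (intro L2D_integrable L2D_cmult powr_L2D pL1)+
    have e: "\<alpha> - 2 > -1" "\<alpha> - 1 > -1" "\<alpha> - 2 + 1 = \<alpha> - 1" "\<alpha> - 1 \<noteq> 0" "\<alpha> - 1 + 1 = \<alpha>" using \<alpha> by auto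
    have "(\<alpha> - 1) * prim (\<lambda>t. t powr (\<alpha> - 2)) t - (\<alpha> - 1) * prim (\<lambda>t. t powr (\<alpha> - 2)) s = (\<alpha> - 1) * ((t powr (\<alpha> - 1) - s powr (\<alpha> - 1)) / (\<alpha> - 1))"
      using prim_powr(2)[OF st e(1)] unfolding e(3) by (simp only: right_diff_distrib[symmetric])
    also have "\<dots> = t powr (\<alpha> - 1) - s powr (\<alpha> - 1)" using e(4) by simp
    finally have "(\<alpha> - 1) * prim (\<lambda>t. t powr (\<alpha> - 2)) t - (\<alpha> - 1) * prim (\<lambda>t. t powr (\<alpha> - 2)) s = t powr (\<alpha> - 1) - s powr (\<alpha> - 1)" .
    moreover have "prim (\<lambda>t. t powr (\<alpha> - 1)) t - prim (\<lambda>t. t powr (\<alpha> - 1)) s = (t powr \<alpha> - s powr \<alpha>) / \<alpha>"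
      using prim_powr(2)[OF st e(2)] unfolding e(5) .
    ultimately show ?thesis unfolding \<omega>0_def prim_add[OF i] prim_cmult by linarith
  qed
  define K where "K = KL C + (E0 * H1_norm q + E0 * H1_norm p + 1 + a * L2_norm \<omega>0)"
  have K0: "0 \<le> E0 * H1_norm q + E0 * H1_norm p + 1 + a * L2_norm \<omega>0"
    using E00 a0 H1_norm_ge(3)[OF q] H1_norm_ge(3)[OF p] by simp
  show ?thesis
  proof (intro exI[of _ K] conjI allI impI)
    show "0 \<le> K" using K0 KL0 by (simp add: K_def)
    fix f g xs assume f: "H1D f" and g: "L2D g" "integral\<^sup>L leb01 g = 0"
      and eq: "\<forall>\<phi>. test_fun \<phi> \<longrightarrow> (\<integral>x. T g x * deriv \<phi> x \<partial>leb01) = (\<integral>x. f x * \<phi> x \<partial>leb01)"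
      and part: "partition01 xs"
    interpret mesh01 xs by unfold_locales (fact part)
    define F where "F = H1_norm f"
    have F0: "0 \<le> F" using H1_norm_ge(3)[OF f] by (simp add: F_def)
    define m where "m = (\<lambda>x. low (Z g) x - repr f x)"
    obtain c where gc: "AE x in leb01. g x = c + prim m x" and mb: "bounded_by (KL C * F) m"
      and c: "\<bar>c\<bar> \<le> KL C * F" and zb: "bounded_by (E0 * F) (Z g)"
      using solution_regularity[OF C g f] eq unfolding m_def F_def E0_def by blast
    have mm: "m \<in> borel_measurable leb01" "\<And>x. x \<in> D \<Longrightarrow> \<bar>m x\<bar> \<le> KL C * F"
      using mb by (auto simp: bounded_by_def)
    note mL = bounded_by_L2D(1)[OF mb]
    have GL: "L2D (\<lambda>x. c + prim m x)" by (intro L2D_add L2D_const L2D_prim mL)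
    have norm_eq: "L2_norm (\<lambda>x. g x - s x) = L2_norm (\<lambda>x. (c + prim m x) - s x)" if "L2D s" for s
      using gc by (intro L2_norm_cong_AE L2D_measurable L2D_diff g GL that) auto
    show "\<exists>s. pwpoly k s \<and> L2_norm (\<lambda>x. g x - s x) \<le> K * mesh xs ^ (k + 1) * H1_norm f"
    proof (cases "k = 0")
      case True
      define s where "s x = c + prim m (left x)" for x
      have s: "pwpoly k s" unfolding s_def by (rule pwpoly_const_cells[of k "\<lambda>i. c + prim m (xs ! i)"])
      have "L2_norm (\<lambda>x. (c + prim m x) - s x) \<le> KL C * F * mesh xs"
      proof (rule L2D_bounded(2))
        show "(\<lambda>x. (c + prim m x) - s x) \<in> borel_measurable leb01"
          by (intro L2D_measurable L2D_diff GL pwpoly_L2D[OF s])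
        show "\<bar>(c + prim m x) - s x\<bar> \<le> KL C * F * mesh xs" if "x \<in> D" for x
          unfolding s_def using that KL0 F0 prim_Lipschitz[OF mm]
          by (intro Lipschitz_approx[of "\<lambda>x. c + prim m x"]) auto
      qed
      also have "\<dots> \<le> K * F * mesh xs"
        using K0 F0 mesh_pos by (intro mult_right_mono) (auto simp: K_def)
      also have "\<dots> = K * mesh xs ^ (k + 1) * F" by (simp add: True)
      finally show ?thesis using s norm_eq[OF pwpoly_L2D[OF s]] unfolding F_def by auto
    next
      case False
      then have k1: "k = 1" using k by simp
      \<comment> \<open>A majorant for the derivative of m by the product rule:
        \<open>E0 * F\<close> bounds \<open>Z g\<close>, and \<open>a * F\<close> times \<omega>0
        bounds the representative of \<open>q\<close> times the derivative of
        \<open>Z g\<close>.\<close>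
      define \<omega> where "\<omega> = (\<lambda>t. (E0 * F) * \<bar>wderiv q t\<bar> + (E0 * F) * \<bar>wderiv p t\<bar> + \<bar>wderiv f t\<bar> + (a * F) * \<bar>\<omega>0 t\<bar>)"
      have wL: "L2D (\<lambda>t. \<bar>wderiv q t\<bar>)" "L2D (\<lambda>t. \<bar>wderiv p t\<bar>)" "L2D (\<lambda>t. \<bar>wderiv f t\<bar>)" "L2D (\<lambda>t. \<bar>\<omega>0 t\<bar>)"
        by (intro L2D_abs wderiv_props q p f \<omega>0L)+
      have \<omega>L: "L2D \<omega>" unfolding \<omega>_def by (intro L2D_add L2D_cmult wL)
      have \<omega>pos: "0 \<le> \<omega> t" for t using E00 F0 a0 by (simp add: \<omega>_def)
      have abs_norm: "L2_norm (\<lambda>t. \<bar>h t\<bar>) = L2_norm h" for h by (simp add: L2_norm_eq)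
      have \<omega>n: "L2_norm \<omega> \<le> (E0 * H1_norm q + E0 * H1_norm p + 1 + a * L2_norm \<omega>0) * F"
      proof -
        have "L2_norm \<omega> \<le> L2_norm (\<lambda>t. (E0 * F) * \<bar>wderiv q t\<bar>) + L2_norm (\<lambda>t. (E0 * F) * \<bar>wderiv p t\<bar>)
            + L2_norm (\<lambda>t. \<bar>wderiv f t\<bar>) + L2_norm (\<lambda>t. (a * F) * \<bar>\<omega>0 t\<bar>)"
          unfolding \<omega>_def
          by (intro order_trans[OF L2_norm_add] add_right_mono L2D_add L2D_cmult wL) auto
        also have "\<dots> = (E0 * F) * L2_norm (wderiv q) + (E0 * F) * L2_norm (wderiv p) + L2_norm (wderiv f) + (a * F) * L2_norm \<omega>0"
          using E00 F0 a0 by (simp add: L2_norm_cmult abs_norm)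
        also have "\<dots> \<le> (E0 * F) * H1_norm q + (E0 * F) * H1_norm p + F + (a * F) * L2_norm \<omega>0"
          using E00 F0 a0 unfolding F_def
          by (intro add_mono mult_left_mono H1_norm_ge q p f) auto
        finally show ?thesis by (simp add: algebra_simps)
      qed
      have pd: "\<bar>prim b t - prim b s\<bar> \<le> prim (\<lambda>x. \<bar>b x\<bar>) t - prim (\<lambda>x. \<bar>b x\<bar>) s" if "L2D b" "s \<le> t" for b s t
      proof -
        have "\<bar>\<integral>x. indicator {s..<t} x * b x \<partial>leb01\<bar> \<le> (\<integral>x. \<bar>indicator {s..<t} x * b x\<bar> \<partial>leb01)"
          by (rule integral_abs_bound)
        then show ?thesis
          using prim_diff[OF L2D_integrable[OF that(1)] that(2)] prim_diff[OF L2D_integrable[OF L2D_abs[OF that(1)]] that(2)]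
          by (simp add: abs_mult)
      qed
      have m\<omega>: "\<bar>m t - m s\<bar> \<le> prim \<omega> t - prim \<omega> s" if st: "0 \<le> s" "s \<le> t" "t \<le> 1" for s t
      proof -
        have s01: "s \<in> {0..1}" "t \<in> {0..1}" using st by auto
        \<comment> \<open>The product rule in difference form, one summand for each term of
          \<omega>.\<close>
        have mdiff: "m t - m s = (repr q t - repr q s) * Z g t + repr q s * (Z g t - Z g s) + Z g 1 * (repr p t - repr p s) - (repr f t - repr f s)"
          by (simp add: m_def low_def algebra_simps)
        have "\<bar>(repr q t - repr q s) * Z g t\<bar> \<le> (prim (\<lambda>x. \<bar>wderiv q x\<bar>) t - prim (\<lambda>x. \<bar>wderiv q x\<bar>) s) * (E0 * F)"
          unfolding abs_mult repr(4)[OF q]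
          by (intro mult_mono pd wderiv_props q st bounded_byD[OF zb] s01) (use pd[OF wderiv_props(1)[OF q] st(2)] in auto)
        moreover have "\<bar>Z g 1 * (repr p t - repr p s)\<bar> \<le> (E0 * F) * (prim (\<lambda>x. \<bar>wderiv p x\<bar>) t - prim (\<lambda>x. \<bar>wderiv p x\<bar>) s)"
          unfolding abs_mult repr(4)[OF p]
          by (intro mult_mono pd wderiv_props p st bounded_byD[OF zb]) (use E00 F0 in auto)
        moreover have "\<bar>repr f t - repr f s\<bar> \<le> prim (\<lambda>x. \<bar>wderiv f x\<bar>) t - prim (\<lambda>x. \<bar>wderiv f x\<bar>) s"
          unfolding repr(4)[OF f] by (intro pd wderiv_props f st)
        moreover have "\<bar>repr q s * (Z g t - Z g s)\<bar> \<le> (a * F) * (prim (\<lambda>x. \<bar>\<omega>0 x\<bar>) t - prim (\<lambda>x. \<bar>\<omega>0 x\<bar>) s)"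
        proof -
          have "Z g x = Z (\<lambda>x. c + prim m x) x" for x by (rule Z_cong_AE[OF gc g(1) GL])
          then have "\<bar>Z g t - Z g s\<bar> \<le> KL C * F / ((\<alpha> - 1) * Gamma (\<alpha> - 1)) * (prim \<omega>0 t - prim \<omega>0 s)"
            unfolding \<omega>0_prim[OF st] using Z_regularity[OF _ c mm st, of "\<lambda>x. c + prim m x"] by simp
          then have "\<bar>repr q s * (Z g t - Z g s)\<bar> \<le> (2 * H1_norm q) * (KL C * F / ((\<alpha> - 1) * Gamma (\<alpha> - 1)) * (prim \<omega>0 t - prim \<omega>0 s))"
            unfolding abs_mult using H1_norm_ge(3)[OF q] by (intro mult_mono repr(3) q s01) auto
          also have "\<dots> = (a * F) * (prim \<omega>0 t - prim \<omega>0 s)" by (simp add: a_def)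
          also have "\<dots> \<le> (a * F) * (prim (\<lambda>x. \<bar>\<omega>0 x\<bar>) t - prim (\<lambda>x. \<bar>\<omega>0 x\<bar>) s)"
            using pd[OF \<omega>0L st(2)] a0 F0 by (intro mult_left_mono) auto
          finally show ?thesis .
        qed
        moreover have "prim \<omega> x = (E0 * F) * prim (\<lambda>t. \<bar>wderiv q t\<bar>) x + (E0 * F) * prim (\<lambda>t. \<bar>wderiv p t\<bar>) x + prim (\<lambda>t. \<bar>wderiv f t\<bar>) x + (a * F) * prim (\<lambda>t. \<bar>\<omega>0 t\<bar>) x" for x
        proof -
          note i = L2D_integrable[OF L2D_cmult[OF wL(1), of "E0 * F"]] L2D_integrable[OF L2D_cmult[OF wL(2), of "E0 * F"]]
            L2D_integrable[OF wL(3)] L2D_integrable[OF L2D_cmult[OF wL(4), of "a * F"]]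
          show ?thesis
            unfolding \<omega>_def using i by (simp add: prim_add prim_cmult del: mult.assoc)
        qed
        ultimately show ?thesis unfolding mdiff by (simp add: right_diff_distrib left_diff_distrib mult.commute[of _ "E0 * F"])
      qed
      define s where "s x = (c + prim m (left x)) + m (left x) * (x - left x)" for x
      have s: "pwpoly k s" unfolding s_def k1
        by (rule pwpoly_linear_cells[of 1 "\<lambda>i. c + prim m (xs ! i)" "\<lambda>i. m (xs ! i)"]) simp
      have "L2_norm (\<lambda>x. (c + prim m x) - s x) \<le> (mesh xs)^2 * L2_norm \<omega>"
        unfolding s_def by (rule linear_approx[OF mm \<omega>L \<omega>pos m\<omega>])
      also have "\<dots> \<le> (mesh xs)^2 * ((E0 * H1_norm q + E0 * H1_norm p + 1 + a * L2_norm \<omega>0) * F)"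
        by (intro mult_left_mono \<omega>n) auto
      also have "\<dots> \<le> (mesh xs)^2 * (K * F)"
        using KL0 F0 by (intro mult_left_mono mult_right_mono) (auto simp: K_def)
      also have "\<dots> = K * mesh xs ^ (k + 1) * F" by (simp add: k1 power2_eq_square)
      finally show ?thesis using s norm_eq[OF pwpoly_L2D[OF s]] unfolding F_def by auto
    qed
  qed
qed

end

theorem theorem4p7:
  fixes \<alpha> \<mu> \<sigma> :: real and q p :: "real \<Rightarrow> real" and k :: nat
  assumes alpha: "3/2 < \<alpha>" "\<alpha> < 2"
    and mu: "\<mu> \<ge> \<alpha>"
    and k: "k \<in> {0, 1}"
    and sigma: "\<sigma> > 0"
    and q: "H1D q"
    and p_def: "p = (\<lambda>x. Gamma (\<mu> + 1) / Gamma (1 + \<mu> - \<alpha>) * x powr (\<mu> - \<alpha>) - q x * x powr \<mu>)"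
    and p: "H1D p"
    and injA1: "\<And>w. H01D w \<Longrightarrow> (\<forall>v. H01D v \<longrightarrow> bilA \<alpha> q p w v = 0) \<Longrightarrow>
                    (AE x in lborel. x \<in> D \<longrightarrow> w x = 0)"
    and injA2: "\<And>v. H01D v \<Longrightarrow> (\<forall>w. H01D w \<longrightarrow> bilA \<alpha> q p w v = 0) \<Longrightarrow>
                    (AE x in lborel. x \<in> D \<longrightarrow> v x = 0)"
  shows "\<exists>h0 > 0. \<forall>\<beta>. 2 - \<alpha> < \<beta> \<longrightarrow> \<beta> < 1/2 \<longrightarrow>
     (\<exists>c. \<forall>f w xs wh.
        H1D f \<longrightarrow> H01D w \<longrightarrow> (\<forall>\<phi>. H01D \<phi> \<longrightarrow> bilA \<alpha> q p w \<phi> = l2_inner f \<phi>) \<longrightarrow>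
        partition01 xs \<longrightarrow> quasi_uniform \<sigma> xs \<longrightarrow> mesh xs \<le> h0 \<longrightarrow>
        wh \<in> Vh k xs \<longrightarrow> (\<forall>vh \<in> Vh k xs. bilA \<alpha> q p wh vh = l2_inner f vh) \<longrightarrow>
        L2_norm (\<lambda>x. recover \<alpha> \<mu> w x - recover \<alpha> \<mu> wh x)
          \<le> c * mesh xs powr (\<alpha> + real k - 1 + \<beta>) * H1_norm f)"
proof -
  have inj: "AE x in leb01. w x = 0" if "H01D w" "\<And>v. H01D v \<Longrightarrow> bilA \<alpha> q p w v = 0" for w
    unfolding AE_leb01_iff using injA1[OF that(1)] that(2) by blast
  interpret frac_problem \<alpha> q p
    by unfold_locales (fact alpha q p inj)+
  obtain C where C: "stable C" using stability by blast
  then have C0: "0 \<le> C" by (simp add: stable_def)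
  obtain K where K0: "0 \<le> K" and K: "\<And>f g xs. H1D f \<Longrightarrow> L2D g \<Longrightarrow> integral\<^sup>L leb01 g = 0 \<Longrightarrow>
     (\<And>\<phi>. test_fun \<phi> \<Longrightarrow> (\<integral>x. T g x * deriv \<phi> x \<partial>leb01) = (\<integral>x. f x * \<phi> x \<partial>leb01)) \<Longrightarrow>
     partition01 xs \<Longrightarrow> \<exists>s. mesh01.pwpoly xs k s \<and> L2_norm (\<lambda>x. g x - s x) \<le> K * mesh xs ^ (k + 1) * H1_norm f"
    using solution_approx[OF C k] by blast
  define Q where "Q = 2 * Cm * C * C1"
  have Q0: "0 \<le> Q" using Cm_nonneg C0 C1_nonneg by (simp add: Q_def)
  \<comment> \<open>\<open>Q * h0 \<le> 1\<close> is the absorption condition of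
    \<open>galerkin_error\<close>; \<open>h0 \<le> 1\<close> serves the comparison of powers.
    Neither involves \<beta>.\<close>
  define h0 where "h0 = 1 / (1 + Q)"
  have h0: "0 < h0" "h0 \<le> 1" "Q * h0 \<le> 1" using Q0 by (auto simp: h0_def)
  \<comment> \<open>The first 2 comes from the two terms of \<open>recover\<close>,
    \<open>2 * C * C1\<close> from the Galerkin estimate, and \<open>K\<close> from the
    approximation of w'.\<close>
  define c where "c = 2 * (2 * C * C1) * K"
  have c0: "0 \<le> c" using C0 C1_nonneg K0 by (simp add: c_def)
  show ?thesis
  proof (rule exI[of _ h0], intro conjI allI impI h0(1), rule exI[of _ c], intro allI impI)
    fix \<beta> f w xs wh
    assume \<beta>: "2 - \<alpha> < \<beta>" "\<beta> < 1 / 2" and f: "H1D f" and w: "H01D w"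
      and eqw: "\<forall>\<phi>. H01D \<phi> \<longrightarrow> bilA \<alpha> q p w \<phi> = l2_inner f \<phi>"
      and part: "partition01 xs" and h: "mesh xs \<le> h0"
      and wh: "wh \<in> Vh k xs" and eqh: "\<forall>vh\<in>Vh k xs. bilA \<alpha> q p wh vh = l2_inner f vh"
    interpret mesh01 xs by unfold_locales (fact part)
    have hpos: "0 < mesh xs" "mesh xs \<le> 1" using mesh_pos h h0 by auto
    have hQ: "2 * Cm * C * C1 * mesh xs \<le> 1"
      using mult_left_mono[OF h Q0] h0(3) by (simp add: Q_def)
    define g where "g = wderiv w"
    have gL: "L2D g" using wderiv_props w by (simp add: g_def H01D_def)
    have g0: "integral\<^sup>L leb01 g = 0" using H01D_imp_prim[OF w] by (simp add: g_def)
    obtain gh where gh: "pwpoly k gh" "integral\<^sup>L leb01 gh = 0" "\<And>x. x \<in> {0..1} \<Longrightarrow> wh x = prim gh x"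
      using Vh_imp_prim[OF wh] by blast
    note ghL = pwpoly_L2D[OF gh(1)]
    note whH = Vh_H01D[OF gh]
    have whL: "L2D (wderiv wh)" using wderiv_props whH(1) by (simp add: H01D_def)
    have bw: "bilA \<alpha> q p w \<phi> = (\<integral>x. T g x * wderiv \<phi> x \<partial>leb01)" if "H01D \<phi>" for \<phi>
      using bilA_eq[OF gL _ _ that, of w] gL by (simp add: g_def)
    have bwh: "bilA \<alpha> q p wh \<phi> = (\<integral>x. T gh x * wderiv \<phi> x \<partial>leb01)" if "H01D \<phi>" for \<phi>
      by (rule bilA_eq[OF ghL whH(2) whL that])
    \<comment> \<open>A test function lies in \<open>H01D\<close>, but its \<open>wderiv\<close> is
      only some representative and has to be exchanged for \<open>deriv\<close>.\<close>
    have test: "(\<integral>x. T g x * deriv \<phi> x \<partial>leb01) = (\<integral>x. f x * \<phi> x \<partial>leb01)" if \<phi>: "test_fun \<phi>" for \<phi>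
    proof -
      have td: "test_dense (deriv \<phi>)"
        using \<phi> by (intro test_dense_continuous smooth_continuous_on smooth_deriv(2)) (simp add: test_fun_iff)
      have dL: "L2D (deriv \<phi>)" by (rule test_fun_deriv_L2D[OF \<phi>])
      note H = H01D_prim[OF td test_fun_deriv_integral[OF \<phi>], of \<phi>]
      have \<phi>H: "H01D \<phi>" "AE x in leb01. wderiv \<phi> x = deriv \<phi> x"
        using H test_fun_eq_prim[OF \<phi>] by auto
      have wL: "L2D (wderiv \<phi>)" using wderiv_props \<phi>H(1) by (simp add: H01D_def)
      have "(\<integral>x. T g x * deriv \<phi> x \<partial>leb01) = (\<integral>x. T g x * wderiv \<phi> x \<partial>leb01)"
        using \<phi>H(2) by (intro integral_cong_AE borel_measurable_times L2D_measurable T_L2D gL dL wL) auto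
      then show ?thesis using bw[OF \<phi>H(1)] eqw \<phi>H(1) by (simp add: l2_inner_eq)
    qed
    obtain s1 where s1: "pwpoly k s1" "L2_norm (\<lambda>x. g x - s1 x) \<le> K * mesh xs ^ (k + 1) * H1_norm f"
      using K[OF f gL g0 test part] by blast
    have orth: "(\<integral>x. T (\<lambda>x. g x - gh x) x * s x \<partial>leb01) = 0" if s: "pwpoly k s" "integral\<^sup>L leb01 s = 0" for s
    proof -
      \<comment> \<open>The primitive of s is admissible in both the continuous and the discrete
        equation, whose right-hand sides agree.\<close>
      note v = Vh_H01D[OF s refl]
      have vL: "L2D (wderiv (prim s))" using wderiv_props v(1) by (simp add: H01D_def)
      note sL = pwpoly_L2D[OF s(1)]
      have AEs: "(\<integral>x. T g' x * wderiv (prim s) x \<partial>leb01) = (\<integral>x. T g' x * s x \<partial>leb01)" if "L2D g'" for g'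
        using v(2) that by (intro integral_cong_AE borel_measurable_times L2D_measurable T_L2D vL sL) auto
      have "bilA \<alpha> q p w (prim s) = bilA \<alpha> q p wh (prim s)"
        using eqw eqh v(1) prim_pwpoly_Vh[OF s] by simp
      then have "(\<integral>x. T g x * s x \<partial>leb01) = (\<integral>x. T gh x * s x \<partial>leb01)"
        using bw[OF v(1)] bwh[OF v(1)] AEs[OF gL] AEs[OF ghL] by simp
      then show ?thesis
        using L2D_mult_integrable[OF T_L2D[OF gL] sL] L2D_mult_integrable[OF T_L2D[OF ghL] sL]
        by (simp add: T_diff[OF gL ghL] left_diff_distrib)
    qed
    define E where "E = 2 * C * C1 * mesh xs powr (\<alpha> - 3/2) * (K * mesh xs ^ (k + 1) * H1_norm f)"
    let ?e = "\<lambda>x. g x - gh x"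
    have ZE: "\<bar>Z ?e x\<bar> \<le> E" if "x \<in> {0..1}" for x
      unfolding E_def by (rule galerkin_error[OF C part gL gh(1) g0 gh(2) orth s1 hpos(2) hQ that])
    have rec: "recover \<alpha> \<mu> w x - recover \<alpha> \<mu> wh x = Z ?e x - Z ?e 1 * x powr \<mu>" if x: "x \<in> {0<..<1}" for x
    proof -
      have "rl_D \<alpha> w y - rl_D \<alpha> wh y = Z ?e y" if "0 \<le> y" "y \<le> 1" for y
        using frac_int_eq_Z[OF that(2)] Z_cong_AE[OF whH(2) whL ghL, of y] Z_diff[OF gL ghL that]
        by (simp add: rl_D_def g_def)
      from this[of x] this[of 1] show ?thesis
        using x by (simp add: recover_def left_diff_distrib[symmetric] algebra_simps flip: left_diff_distrib)
    qed
    have eL: "L2D ?e" by (intro L2D_diff gL ghL)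
    have "L2_norm (\<lambda>x. recover \<alpha> \<mu> w x - recover \<alpha> \<mu> wh x) = L2_norm (\<lambda>x. Z ?e x - Z ?e 1 * x powr \<mu>)"
      unfolding L2_norm_eq using rec by (intro arg_cong[where f=sqrt] LINT_cong) auto
    also have "\<dots> \<le> 2 * E"
    proof (rule L2D_bounded(2))
      have "(\<lambda>x. x powr \<mu>) \<in> borel_measurable leb01" by (intro measurable_leb01) measurable
      then show "(\<lambda>x. Z ?e x - Z ?e 1 * x powr \<mu>) \<in> borel_measurable leb01"
        using continuous_on_measurable_leb01[OF Z_continuous_on[OF eL]] by measurable
      fix x :: real assume x: "x \<in> {0<..<1}"
      \<comment> \<open>So the boundary correction costs no more than \<open>Z e\<close> itself, and
        a sup bound suffices for the L2 norm.\<close>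
      have "x powr \<mu> \<le> 1" using x mu alpha by (intro powr_le1) auto
      then have "\<bar>Z ?e 1 * x powr \<mu>\<bar> \<le> E * 1"
        unfolding abs_mult using ZE[of 1] by (intro mult_mono) auto
      then show "\<bar>Z ?e x - Z ?e 1 * x powr \<mu>\<bar> \<le> 2 * E"
        using ZE[of x] x abs_triangle_ineq4[of "Z ?e x" "Z ?e 1 * x powr \<mu>"] by auto
    qed
    also have "2 * E = c * (mesh xs powr (\<alpha> - 3/2) * mesh xs ^ (k + 1)) * H1_norm f"
      by (simp add: E_def c_def)
    also have "mesh xs powr (\<alpha> - 3/2) * mesh xs ^ (k + 1) = mesh xs powr (\<alpha> - 3/2 + real (k + 1))"
      using hpos(1) by (simp only: powr_realpow[symmetric] powr_add)
    \<comment> \<open>The base is at most 1, so lowering the exponent, possible since \<beta> < 1/2,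
      enlarges the power.\<close>
    also have "c * mesh xs powr (\<alpha> - 3/2 + real (k + 1)) * H1_norm f \<le> c * mesh xs powr (\<alpha> + real k - 1 + \<beta>) * H1_norm f"
      using hpos \<beta> c0 H1_norm_ge(3)[OF f] by (intro mult_right_mono mult_left_mono powr_mono') auto
    finally show "L2_norm (\<lambda>x. recover \<alpha> \<mu> w x - recover \<alpha> \<mu> wh x)
          \<le> c * mesh xs powr (\<alpha> + real k - 1 + \<beta>) * H1_norm f" .
  qed
qed

end
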